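(* Consider a stable Mn/Gn/1 queue with arrival rates $\lambda_n>0$, $n\ge 0$, and service time CDFs $G_n$ with LSTs $G_n^*$, $n\ge 1$. Let $R_n$, $n\ge 1$, be the CDF of the steady-state residual service time at an arrival instance, given that the arrival finds $n$ customers in the system. Then $$R_1 = D_{\lambda_1,G_1}$$ and $$R_n = (1-G_n^*(\lambda_n))\, D_{\lambda_n,G_n}+ G_n^*(\lambda_n)\,D_{\lambda_n,R_{n-1}}, \quad n \geq 2.$$
   Context: Mn/Gn/1 queue: a single-server queue in which service times are independent, and a service that commences with $n\ge 1$ customers in the system has (nonnegative) duration with CDF $G_n$ and LST $G_n^*(s)=\int_0^\infty e^{-sx}\,dG_n(x)$. Arrivals: given that there are $n$ customers in the system at time $t$, the number of arrivals in $[t,t+\Delta]$ is independent of the past, the probability of a single arrival in this interval is $\lambda_n\Delta+o(\Delta)$, and the probability of two or more is $o(\Delta)$. The system is assumed stable; steady-state distributions are long-run averages. The residual service time at an arrival instance is the remaining service time of the customer in service at that instance; the number $n$ of customers in the system in the definition of $R_n$ is the number found by the arriving customer (not counting herself). For $\alpha>0$ and a CDF $F$ of a nonnegative random variable $X$ with $P(X\in(0,\infty))>0$ (assumed for every CDF to which the operation is applied), let $Y_\alpha$ be exponential with rate $\alpha$, independent of $X$. Then $D_{\alpha,F}$ denotes the CDF of the random variable $X-Y_\alpha$ conditioned on $X\ge Y_\alpha$. *)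

theory Defs
  imports "HOL-Probability.Probability"
begin

definition service_cdf :: "(real \<Rightarrow> real) \<Rightarrow> bool" where
  "service_cdf F \<longleftrightarrow> (\<exists>\<mu>. real_distribution \<mu> \<and> F = cdf \<mu> \<and>
     measure \<mu> {..<0} = 0 \<and> measure \<mu> {0<..} > 0)"

(* An atom of the distribution at 0 is included in the integral. *)
definition LST :: "(real \<Rightarrow> real) \<Rightarrow> real \<Rightarrow> real" where
  "LST F s = (LINT x:{0..}|interval_measure F. exp (- s * x))"

(* The CDF of X - Y given X >= Y, for independent X with CDF F (first component)
   and Y exponential with rate a (second component). *)
definition D :: "real \<Rightarrow> (real \<Rightarrow> real) \<Rightarrow> real \<Rightarrow> real" where
  "D a F z = \<P>(w in interval_measure F \<Otimes>\<^sub>M density lborel (exponential_density a).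
                fst w - snd w \<le> z \<bar> fst w \<ge> snd w)"

(* A work-conserving, non-preemptive single-server queue observed from time 0.  There are
   N0 customers at time 0, T i is the epoch of arrival number i >= 0, and X j is
   the duration of service number j >= 0.  If N0 > 0 then service 0 is the one in progress
   at time 0 and X 0 is its remaining duration, which is arbitrary. *)
locale single_server_queue = prob_space M for M :: "'a measure" +
  fixes N0 :: "'a \<Rightarrow> nat" and T X :: "nat \<Rightarrow> 'a \<Rightarrow> real"
  assumes N0_measurable: "N0 \<in> M \<rightarrow>\<^sub>M count_space UNIV"
    and T_measurable: "\<And>i. T i \<in> borel_measurable M"
    and X_measurable: "\<And>j. X j \<in> borel_measurable M"
    and T_nonneg: "\<And>i \<omega>. \<omega> \<in> space M \<Longrightarrow> 0 \<le> T i \<omega>"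
    and T_mono: "\<And>\<omega>. \<omega> \<in> space M \<Longrightarrow> mono (\<lambda>i. T i \<omega>)"
    and T_unbounded: "\<And>\<omega>. \<omega> \<in> space M \<Longrightarrow> filterlim (\<lambda>i. T i \<omega>) at_top sequentially"
    and X_nonneg: "\<And>j \<omega>. \<omega> \<in> space M \<Longrightarrow> 0 \<le> X j \<omega>"
begin

(* Entry epoch of the m-th customer when the initial customers are numbered first. *)
definition entry :: "nat \<Rightarrow> 'a \<Rightarrow> real" where
  "entry m \<omega> = (if m < N0 \<omega> then 0 else T (m - N0 \<omega>) \<omega>)"

(* Service j + 1 starts as soon as service j is completed and at least j + 2 customers have
   entered; the order in which customers are served plays no role. *)
primrec service_start :: "nat \<Rightarrow> 'a \<Rightarrow> real" where
  "service_start 0 \<omega> = entry 0 \<omega>"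
| "service_start (Suc j) \<omega> = max (service_start j \<omega> + X j \<omega>) (entry (Suc j) \<omega>)"

definition service_end :: "nat \<Rightarrow> 'a \<Rightarrow> real" where
  "service_end j \<omega> = service_start j \<omega> + X j \<omega>"

definition in_system :: "real \<Rightarrow> 'a \<Rightarrow> nat" where
  "in_system t \<omega> = N0 \<omega> + card {i. T i \<omega> \<le> t} - card {j. service_end j \<omega> \<le> t}"

(* The number of customers present when service j commences: exactly j services have been
   completed by then (time alone would not tell, as services may have duration 0). *)
definition in_system_at_start :: "nat \<Rightarrow> 'a \<Rightarrow> nat" where
  "in_system_at_start j \<omega> = N0 \<omega> + card {i. T i \<omega> \<le> service_start j \<omega>} - j"

definition arrivals :: "real \<Rightarrow> real \<Rightarrow> 'a \<Rightarrow> nat" where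
  "arrivals t u \<omega> = card {i. t \<le> T i \<omega> \<and> T i \<omega> \<le> u}"

(* The events determined by the arrivals up to time t and by the services that have
   commenced by time t, including their durations. *)
definition past :: "real \<Rightarrow> 'a set set" where
  "past t = sigma_sets (space M)
     ({{\<omega> \<in> space M. N0 \<omega> = n} | n. True} \<union>
      {{\<omega> \<in> space M. T i \<omega> \<le> s} | i s. s \<le> t} \<union>
      {{\<omega> \<in> space M. service_start j \<omega> \<le> t \<and> X j \<omega> \<le> x} | j x. True})"

(* The events determined by what has happened up to the commencement of service j,
   excluding the durations of service j and of the later ones. *)
definition past_of_service :: "nat \<Rightarrow> 'a set set" where
  "past_of_service j = sigma_sets (space M)
     ({{\<omega> \<in> space M. N0 \<omega> = n} | n. True} \<union>
      {{\<omega> \<in> space M. T i \<omega> \<le> s \<and> T i \<omega> \<le> service_start j \<omega>} | i s. True} \<union>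
      {{\<omega> \<in> space M. X i \<omega> \<le> x} | i x. i < j})"

(* Stability: the long-run fractions of time spent in the states form a proper distribution. *)
definition stable :: bool where
  "stable \<longleftrightarrow> (\<exists>p :: nat pmf. AE \<omega> in M. \<forall>n.
     ((\<lambda>t. measure lborel {s \<in> {0..t}. in_system s \<omega> = n} / t) \<longlongrightarrow> pmf p n) at_top)"

definition completed_before :: "nat \<Rightarrow> 'a \<Rightarrow> nat" where
  "completed_before i \<omega> = card {j. service_end j \<omega> < T i \<omega>}"

definition found :: "nat \<Rightarrow> 'a \<Rightarrow> nat" where
  "found i \<omega> = N0 \<omega> + i - completed_before i \<omega>"

(* Meaningful if found i > 0: then the service in progress just before arrival i is
   the one whose number is that of the services completed so far. *)
definition residual :: "nat \<Rightarrow> 'a \<Rightarrow> real" where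
  "residual i \<omega> = service_end (completed_before i \<omega>) \<omega> - T i \<omega>"

(* The almost sure long-run fraction, among the arrivals that find n customers, of those
   for which the residual service time is at most x. *)
definition residual_cdf :: "nat \<Rightarrow> real \<Rightarrow> real" where
  "residual_cdf n x = (THE r. AE \<omega> in M.
     (\<lambda>k. real (card {i. i < k \<and> found i \<omega> = n \<and> residual i \<omega> \<le> x}) /
          real (card {i. i < k \<and> found i \<omega> = n})) \<longlonglongrightarrow> r)"

end

(* In one_arrival and more_arrivals, dividing by the probability of the event conditioned on
   gives: conditionally on n customers at time t and on any event of the past, a single arrival
   in [t, t + d] has probability lam n * d + o(d), and two or more have probability o(d).
   Exact independence of the past for fixed d > 0 cannot be asked for, since the arrival
   rate changes if a service is completed during the interval. *)
locale MnGn1_queue = single_server_queue M N0 T X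
  for M :: "'a measure" and N0 :: "'a \<Rightarrow> nat" and T X :: "nat \<Rightarrow> 'a \<Rightarrow> real" +
  fixes lam :: "nat \<Rightarrow> real" and G :: "nat \<Rightarrow> real \<Rightarrow> real"
  assumes one_arrival: "\<And>t n E. 0 \<le> t \<Longrightarrow> E \<in> past t \<Longrightarrow>
      ((\<lambda>d. prob (E \<inter> {\<omega> \<in> space M. in_system t \<omega> = n \<and> arrivals t (t + d) \<omega> = 1}) / d)
         \<longlongrightarrow> lam n * prob (E \<inter> {\<omega> \<in> space M. in_system t \<omega> = n})) (at_right 0)"
    and more_arrivals: "\<And>t n E. 0 \<le> t \<Longrightarrow> E \<in> past t \<Longrightarrow>
      ((\<lambda>d. prob (E \<inter> {\<omega> \<in> space M. in_system t \<omega> = n \<and> arrivals t (t + d) \<omega> \<ge> 2}) / d)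
         \<longlongrightarrow> 0) (at_right 0)"
    and service_law: "\<And>j n E x. 1 \<le> n \<Longrightarrow> E \<in> past_of_service j \<Longrightarrow>
      E \<subseteq> {\<omega> \<in> space M. in_system_at_start j \<omega> = n \<and> (j = 0 \<longrightarrow> N0 \<omega> = 0)} \<Longrightarrow>
      prob (E \<inter> {\<omega> \<in> space M. X j \<omega> \<le> x}) = G n x * prob E"

end

theory Submission
  imports Defs
begin

text \<open>
  The proof cuts the evolution of the queue into sojourns, the periods between consecutive events
(arrivals and commencements of services).  Write $A_n$ for the number of arrivals that find
$n \geq 1$ customers.  Each of them ends a sojourn in state $n$, and such a sojourn begins in one
of two ways: a service commences with $n$ customers, and then the remaining service time at the
beginning of the sojourn has CDF \<open>G n\<close>; or, for $n \geq 2$, a customer arrives who finds $n - 1$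
others, and then the remaining service time is the residual service time seen by that customer.
Either way, the next arrival behaves like an exponential clock of rate \<open>lam n\<close> as long as the
service lasts (\<open>prob_arrival_during_sojourn\<close>).  If the remaining service time at the beginning has CDF
$F$, then the sojourn ends with an arrival that sees a residual service time above $x$ with
probability \<open>excess_tail (lam n) F x\<close>, the probability that $V - Y > x$ for $V$ with CDF $F$ and an
independent exponential $Y$.

A law of large numbers for bounded martingale differences (\<open>selected_average_tendsto_0\<close>) turns these
probabilities into almost sure frequencies, separately for the two kinds of sojourns
(\<open>services_hit_frequency\<close>, \<open>arrivals_hit_frequency\<close>).  Let $S_n$ count the services that commence with
$n$ customers, and let $g$ and $\rho$ be the tails \<open>excess_tail\<close> for \<open>G n\<close> and for the long-run CDF of
the residual service times seen by the arrivals that find $n - 1$.  Sorting the arrivals that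
find $n$ and see a residual above $x$ by the sojourn that they end
(\<open>arrivals_split_by_previous_event\<close>) shows that their number is about $g(x) S_n + \rho(x) A_{n-1}$.
For $n \geq 2$ the arrivals that find $n$ are the upcrossings from $n$ to $n + 1$, and the services that
commence with $n$ customers are the downcrossings from $n + 1$ to $n$, so $S_n - A_n$ is bounded
(\<open>level_crossing_balance\<close>).  At $x = 0$ this gives $A_{n-1} \rho(0) \approx (1 - g(0)) A_n$, and so
the long-run fraction of residuals above $x$ is $g(x) + (1 - g(0)) \rho(x) / \rho(0)$.  This is the
recursion, since $g(x) / g(0)$ and $\rho(x) / \rho(0)$ are the tails of the two \<open>D\<close> and
$1 - g(0)$ is the LST of \<open>G n\<close> at \<open>lam n\<close>.  For $n = 1$ only the first kind of sojourn occurs, and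
$g(x) / g(0)$ remains.

Stability serves only to show that all these counts are infinite: some number of customers is found
infinitely often, the balance and the positive probability of a service without arrivals carry
this down to level 1, and from there the recursion carries it up again.

The arrival hypotheses are right derivatives at fixed times, without any uniformity.  They
are exploited by showing that a continuous function whose right derivative vanishes everywhere is
constant.  Applied to probabilities that are continuous in time, since arrival epochs have no atoms,
it yields the exponential clock after a fixed time (\<open>prob_no_arrival\<close>) and excludes almost surely the
simultaneous arrivals and the arrivals at the end of a service in progress.  The passage to the random beginning
of a sojourn approximates it by a grid.
\<close>

section \<open>Continuous functions with vanishing right derivative\<close>

text \<open>
  The right derivative need only exist pointwise.  The furthest point at which \<open>f\<close> is within slope
  \<open>e\<close> of its starting value cannot lie before \<open>b\<close>, because the derivative there would allow a further step.
\<close>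

lemma zero_right_derivative_imp_eq:
  fixes f :: "real \<Rightarrow> real"
  assumes ab: "a \<le> b" and cont: "continuous_on {a..b} f"
    and deriv: "\<And>x. a \<le> x \<Longrightarrow> x < b \<Longrightarrow> ((\<lambda>d. (f (x + d) - f x) / d) \<longlongrightarrow> 0) (at_right 0)"
  shows "f b = f a"
proof -
  have bound: "\<bar>f b - f a\<bar> \<le> e * (b - a)" if e: "e > 0" for e
  proof -
    define S where "S = {x \<in> {a..b}. \<bar>f x - f a\<bar> - e * (x - a) \<in> {..0}}"
    have "continuous_on {a..b} (\<lambda>x. \<bar>f x - f a\<bar> - e * (x - a))"
      by (intro continuous_intros cont)
    then have "closed S"
      unfolding S_def by (intro continuous_on_closed_Collect_le continuous_closed_preimage
          continuous_closed_preimage[unfolded vimage_def Int_def, simplified]) auto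
    moreover have "a \<in> S" and bdd: "bdd_above S"
      using ab by (auto simp: S_def)
    ultimately have c: "Sup S \<in> S"
      by (intro closed_contains_Sup) auto
    define c where "c = Sup S"
    have "c = b"
    proof (rule ccontr)
      assume "c \<noteq> b"
      with c have c': "a \<le> c" "c < b" "\<bar>f c - f a\<bar> \<le> e * (c - a)"
        by (auto simp: S_def c_def)
      from tendstoD[OF deriv[OF c'(1,2)] e]
      obtain d0 where d0: "d0 > 0" "\<And>d. 0 < d \<Longrightarrow> d < d0 \<Longrightarrow> \<bar>(f (c + d) - f c) / d\<bar> < e"
        by (auto simp: eventually_at_right_field dist_real_def)
      define d where "d = min (d0 / 2) (b - c)"
      have d: "0 < d" "d < d0" "c + d \<le> b"
        using d0 c' by (auto simp: d_def)
      have "\<bar>f (c + d) - f c\<bar> < e * d"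
        using d0(2)[OF d(1,2)] d(1) by (simp add: abs_divide field_simps)
      then have "c + d \<in> S"
        using c' d by (auto simp: S_def algebra_simps)
      then have "c + d \<le> c"
        unfolding c_def by (intro cSup_upper bdd)
      with d show False by simp
    qed
    with c show ?thesis by (simp add: S_def c_def)
  qed
  have "\<bar>f b - f a\<bar> \<le> 0 + e" if "e > 0" for e
  proof -
    have "\<bar>f b - f a\<bar> \<le> e / (b - a + 1) * (b - a)"
      using that ab by (intro bound) auto
    also have "\<dots> \<le> e"
      using that ab by (auto simp: field_simps)
    finally show ?thesis by simp
  qed
  then have "\<bar>f b - f a\<bar> \<le> 0"
    by (rule field_le_epsilon)
  then show ?thesis by simp
qed

section \<open>A law of large numbers for selected terms\<close>

text \<open>
  The bound is linear in \<open>u\<close>, so that its expectation is at most 1 when \<open>u\<close> is replaced by a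
  centred random variable.
\<close>

lemma exp_tilt_le:
  fixes u \<theta> :: real
  assumes "\<bar>u\<bar> \<le> 1" "0 \<le> \<theta>" "\<theta> \<le> 1"
  shows "exp (\<theta> * u - \<theta>\<^sup>2) \<le> 1 + exp (- \<theta>\<^sup>2) * \<theta> * u"
proof -
  have le: "\<bar>\<theta> * u\<bar> \<le> 1"
    using assms by (simp add: abs_mult mult_le_one)
  have sq: "(\<theta> * u)\<^sup>2 \<le> \<theta>\<^sup>2"
    using assms by (simp add: power_mult_distrib abs_square_le_1 mult_left_le)
  have "exp (\<theta> * u) \<le> 1 + \<theta> * u + (\<theta> * u)\<^sup>2"
  proof (cases "\<theta> * u \<ge> 0")
    case True
    then show ?thesis using exp_bound[of "\<theta> * u"] le by simp
  next
    case False
    \<comment> \<open>For negative exponents the quadratic bound is obtained by inverting a lower Taylor bound.\<close>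
    define v where "v = - (\<theta> * u)"
    have v: "0 \<le> v" "v \<le> 1" using False le by (auto simp: v_def)
    have "1 + v + v\<^sup>2 / 2 \<le> exp v"
      using exp_lower_Taylor_quadratic[of v] v by simp
    moreover have "1 \<le> (1 - v + v\<^sup>2) * (1 + v + v\<^sup>2 / 2)"
    proof -
      have "(1 - v + v\<^sup>2) * (1 + v + v\<^sup>2 / 2) = 1 + v\<^sup>2 / 2 + v ^ 3 / 2 + v ^ 4 / 2"
        by (simp add: field_simps power2_eq_square power3_eq_cube power4_eq_xxxx)
      then show ?thesis using v by simp
    qed
    moreover have "0 \<le> 1 - v + v\<^sup>2" using v by simp
    ultimately have "1 \<le> (1 - v + v\<^sup>2) * exp v"
      by (meson mult_left_mono order_trans)
    then have "exp (- v) \<le> 1 - v + v\<^sup>2"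
      by (simp add: exp_minus field_simps)
    then show ?thesis by (simp add: v_def)
  qed
  also have "\<dots> \<le> (1 + \<theta>\<^sup>2) + \<theta> * u" using sq by simp
  also have "\<dots> \<le> exp (\<theta>\<^sup>2) + \<theta> * u" using exp_ge_add_one_self[of "\<theta>\<^sup>2"] by simp
  finally have "exp (- \<theta>\<^sup>2) * exp (\<theta> * u) \<le> exp (- \<theta>\<^sup>2) * (exp (\<theta>\<^sup>2) + \<theta> * u)"
    by simp
  then show ?thesis
    by (simp add: exp_diff exp_minus field_simps)
qed

text \<open>
  Being centred on the events of \<open>F\<close> means having conditional expectation 0 given \<open>F\<close>; hence bounded
  \<open>F\<close>-measurable factors can be inserted.
\<close>

lemma (in prob_space) integral_centred_eq_0:
  fixes \<xi> g :: "'a \<Rightarrow> real"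
  assumes sub: "subalgebra M F" and \<xi>: "\<xi> \<in> borel_measurable M"
    and bounded: "\<And>\<omega>. \<omega> \<in> space M \<Longrightarrow> \<bar>\<xi> \<omega>\<bar> \<le> 1"
    and e: "Measurable.pred F e"
    and centred: "\<And>E. E \<in> sets F \<Longrightarrow> E \<subseteq> {\<omega> \<in> space M. e \<omega>} \<Longrightarrow> (LINT \<omega>:E|M. \<xi> \<omega>) = 0"
    and g: "g \<in> borel_measurable F" and g_bounded: "\<And>\<omega>. \<omega> \<in> space M \<Longrightarrow> \<bar>g \<omega>\<bar> \<le> B"
  shows "integrable M (\<lambda>\<omega>. g \<omega> * (of_bool (e \<omega>) * \<xi> \<omega>))"
    and "(LINT \<omega>|M. g \<omega> * (of_bool (e \<omega>) * \<xi> \<omega>)) = 0"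
proof -
  interpret finite_measure_subalgebra M F
    using sub by unfold_locales
  have sp: "space F = space M" using sub by (simp add: subalgebra_def)
  have g'[measurable]: "g \<in> borel_measurable M" and [measurable]: "Measurable.pred M e"
    using measurable_from_subalg[OF sub] g e by auto
  note [measurable] = \<xi>
  show int: "integrable M (\<lambda>\<omega>. g \<omega> * (of_bool (e \<omega>) * \<xi> \<omega>))"
  proof (rule integrable_const_bound[where B = "\<bar>B\<bar>"])
    show "AE \<omega> in M. norm (g \<omega> * (of_bool (e \<omega>) * \<xi> \<omega>)) \<le> \<bar>B\<bar>"
    proof (intro AE_I2)
      fix \<omega> assume "\<omega> \<in> space M"
      then have "\<bar>g \<omega>\<bar> * \<bar>of_bool (e \<omega>) * \<xi> \<omega>\<bar> \<le> \<bar>B\<bar> * 1"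
        using bounded[of \<omega>] g_bounded[of \<omega>] by (intro mult_mono) (auto split: split_of_bool)
      then show "norm (g \<omega> * (of_bool (e \<omega>) * \<xi> \<omega>)) \<le> \<bar>B\<bar>" by (simp add: abs_mult)
    qed
  qed measurable
  have int': "integrable M (\<lambda>\<omega>. of_bool (e \<omega>) * \<xi> \<omega>)"
    by (rule integrable_const_bound[where B = 1]) (auto intro!: AE_I2 bounded split: split_of_bool)
  have "AE \<omega> in M. real_cond_exp M F (\<lambda>\<omega>. of_bool (e \<omega>) * \<xi> \<omega>) \<omega> = 0"
  proof (rule real_cond_exp_charact)
    fix A assume A: "A \<in> sets F"
    have "{\<omega> \<in> space F. e \<omega>} \<in> sets F" using e by simp
    then have A': "A \<inter> {\<omega> \<in> space F. e \<omega>} \<in> sets F" using A by blast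
    have "(LINT \<omega>:A|M. of_bool (e \<omega>) * \<xi> \<omega>) = (LINT \<omega>:A \<inter> {\<omega> \<in> space F. e \<omega>}|M. \<xi> \<omega>)"
      unfolding set_lebesgue_integral_def
      by (intro Bochner_Integration.integral_cong) (auto simp: sp indicator_def)
    also have "\<dots> = 0" using A' by (intro centred) (auto simp: sp)
    finally show "(LINT \<omega>:A|M. of_bool (e \<omega>) * \<xi> \<omega>) = (LINT \<omega>:A|M. 0)" 
      by (simp add: set_lebesgue_integral_def)
  qed (use int' in auto)
  then have "(LINT \<omega>|M. g \<omega> * real_cond_exp M F (\<lambda>\<omega>. of_bool (e \<omega>) * \<xi> \<omega>) \<omega>) = (LINT \<omega>|M. 0)"
    by (intro integral_cong_AE) auto
  then show "(LINT \<omega>|M. g \<omega> * (of_bool (e \<omega>) * \<xi> \<omega>)) = 0"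
    using real_cond_exp_intg(2)[OF int g] by simp
qed

text \<open>
  The terms selected by \<open>e\<close> are bounded martingale differences, so the exponential of their sum has
  a supermartingale compensation.  By Markov's inequality, the sum of the first \<open>m\<close> selected terms exceeds
  \<open>\<epsilon> m\<close> with a probability that is exponentially small in \<open>m\<close>, and the Borel-Cantelli lemma applies.
\<close>

lemma (in prob_space) selected_average_upper:
  fixes F :: "nat \<Rightarrow> 'a measure" and e :: "nat \<Rightarrow> 'a \<Rightarrow> bool" and \<xi> :: "nat \<Rightarrow> 'a \<Rightarrow> real"
  assumes sub: "\<And>k. subalgebra M (F k)"
    and e: "\<And>l k. l \<le> k \<Longrightarrow> Measurable.pred (F k) (e l)"
    and \<xi>: "\<And>l k. l < k \<Longrightarrow> \<xi> l \<in> borel_measurable (F k)"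
    and bounded: "\<And>k \<omega>. \<omega> \<in> space M \<Longrightarrow> \<bar>\<xi> k \<omega>\<bar> \<le> 1"
    and centred: "\<And>k E. E \<in> sets (F k) \<Longrightarrow> E \<subseteq> {\<omega> \<in> space M. e k \<omega>} \<Longrightarrow> (LINT \<omega>:E|M. \<xi> k \<omega>) = 0"
    and eps: "0 < \<epsilon>" "\<epsilon> \<le> 1"
  shows "AE \<omega> in M. eventually (\<lambda>m. \<forall>K. (\<Sum>l<K. of_bool (e l \<omega>)) = m \<longrightarrow>
           (\<Sum>l<K. of_bool (e l \<omega>) * \<xi> l \<omega>) < \<epsilon> * real m) sequentially"
proof -
  define N where "N K \<omega> = (\<Sum>l<K. of_bool (e l \<omega>) :: nat)" for K \<omega>
  have eM[measurable]: "Measurable.pred M (e l)" for l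
    using measurable_from_subalg[OF sub e[of l l]] by simp
  have \<xi>M[measurable]: "\<xi> l \<in> borel_measurable M" for l
    using measurable_from_subalg[OF sub \<xi>[of l "Suc l"]] by simp
  \<comment> \<open>Only the first \<open>m\<close> selected terms are kept, so that the compensator is at most \<open>m\<close>.\<close>
  define b where "b m l \<omega> \<longleftrightarrow> e l \<omega> \<and> N l \<omega> < m" for m l \<omega>
  define Y where "Y m K \<omega> = (\<Sum>l<K. of_bool (b m l \<omega>) * \<xi> l \<omega>)" for m K \<omega>
  define C where "C m K \<omega> = (\<Sum>l<K. of_bool (b m l \<omega>) :: real)" for m K \<omega>
  have b: "Measurable.pred (F k) (b m l)" if "l \<le> k" for m l k
  proof -
    have [measurable]: "Measurable.pred (F k) (e i)" if "i \<le> l" for i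
      using e[of i k] that \<open>l \<le> k\<close> by simp
    show ?thesis unfolding b_def N_def by measurable
  qed
  have bM[measurable]: "Measurable.pred M (b m l)" for m l
    unfolding b_def N_def by measurable
  have NM[measurable]: "N K \<in> measurable M (count_space UNIV)" for K
    unfolding N_def by measurable
  have YM[measurable]: "Y m K \<in> borel_measurable M" for m K unfolding Y_def by measurable
  have CM[measurable]: "C m K \<in> borel_measurable M" for m K unfolding C_def by measurable
  \<comment> \<open>This \<open>\<theta>\<close> maximises the exponent \<open>\<theta> \<epsilon> - \<theta>\<^sup>2\<close> in the resulting bound.\<close>
  define \<theta> where "\<theta> = \<epsilon> / 2"
  have \<theta>: "0 \<le> \<theta>" "\<theta> \<le> 1" using eps by (auto simp: \<theta>_def)
  define W where "W m K \<omega> = exp (\<theta> * Y m K \<omega> - \<theta>\<^sup>2 * C m K \<omega>)" for m K \<omega>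
  have W_bounded: "\<bar>W m K \<omega>\<bar> \<le> exp (real K)" if "\<omega> \<in> space M" for m K \<omega>
  proof -
    have "Y m K \<omega> \<le> (\<Sum>l<K. 1)" unfolding Y_def
      using bounded[OF that] by (intro sum_mono) (auto split: split_of_bool simp: abs_le_iff)
    then have Y: "Y m K \<omega> \<le> real K" by simp
    have "\<theta> * Y m K \<omega> \<le> \<theta> * real K" using Y \<theta> by (intro mult_left_mono) auto
    also have "\<dots> \<le> real K" using \<theta> by (simp add: mult_left_le_one_le)
    finally have "\<theta> * Y m K \<omega> \<le> real K" .
    moreover have "0 \<le> C m K \<omega>" unfolding C_def by (intro sum_nonneg) auto
    then have "0 \<le> \<theta>\<^sup>2 * C m K \<omega>" by simp
    ultimately have "\<theta> * Y m K \<omega> - \<theta>\<^sup>2 * C m K \<omega> \<le> real K" by linarith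
    then show ?thesis unfolding W_def by simp
  qed
  have WM[measurable]: "W m K \<in> borel_measurable M" for m K unfolding W_def by measurable
  have W_int: "integrable M (W m K)" for m K
    by (rule integrable_const_bound[where B = "exp (real K)"]) (auto intro!: AE_I2 W_bounded)
  have W_le: "(LINT \<omega>|M. W m K \<omega>) \<le> 1" for m K
  proof (induction K)
    case 0
    then show ?case by (simp add: W_def Y_def C_def prob_space)
  next
    case (Suc K)
    have WF: "W m K \<in> borel_measurable (F K)"
    proof -
      have [measurable]: "Measurable.pred (F K) (b m l)" if "l < K" for l using b[of l K] that by simp
      have [measurable]: "\<xi> l \<in> borel_measurable (F K)" if "l < K" for l using \<xi> that by simp
      show ?thesis unfolding W_def Y_def C_def by measurable
    qed
    have cen: "(LINT \<omega>:E|M. \<xi> K \<omega>) = 0" if "E \<in> sets (F K)" "E \<subseteq> {\<omega> \<in> space M. b m K \<omega>}" for E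
      using that by (intro centred) (auto simp: b_def)
    note zero = integral_centred_eq_0[OF sub[of K] \<xi>M bounded b[OF order_refl] cen WF W_bounded]
    have step: "W m (Suc K) \<omega> \<le> W m K \<omega> + exp (- \<theta>\<^sup>2) * \<theta> * (W m K \<omega> * (of_bool (b m K \<omega>) * \<xi> K \<omega>))"
      if "\<omega> \<in> space M" for \<omega>
    proof (cases "b m K \<omega>")
      case True
      have "W m (Suc K) \<omega> = W m K \<omega> * exp (\<theta> * \<xi> K \<omega> - \<theta>\<^sup>2)"
        using True by (simp add: W_def Y_def C_def exp_add[symmetric] algebra_simps)
      also have "\<dots> \<le> W m K \<omega> * (1 + exp (- \<theta>\<^sup>2) * \<theta> * \<xi> K \<omega>)"
        using exp_tilt_le[OF bounded[OF that] \<theta>, of K] by (intro mult_left_mono) (auto simp: W_def)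
      finally show ?thesis using True by (simp add: algebra_simps)
    next
      case False
      then show ?thesis by (simp add: W_def Y_def C_def)
    qed
    have "(LINT \<omega>|M. W m (Suc K) \<omega>) \<le>
        (LINT \<omega>|M. W m K \<omega> + exp (- \<theta>\<^sup>2) * \<theta> * (W m K \<omega> * (of_bool (b m K \<omega>) * \<xi> K \<omega>)))"
      by (intro integral_mono W_int Bochner_Integration.integrable_add integrable_mult_right zero(1) step)
    also have "\<dots> = (LINT \<omega>|M. W m K \<omega>)"
      using zero W_int by simp
    finally show ?case using Suc by simp
  qed
  \<comment> \<open>Once \<open>m\<close> terms have been selected the sum is frozen, so these events increase with \<open>K\<close>.\<close>
  define B where "B m K = {\<omega> \<in> space M. m \<le> N K \<omega> \<and> \<epsilon> * real m \<le> Y m K \<omega>}" for m K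
  have B_meas[measurable]: "B m K \<in> sets M" for m K unfolding B_def by measurable
  have N_mono: "mono (\<lambda>K. N K \<omega>)" for \<omega>
    unfolding N_def by (intro monoI sum_mono2) auto
  have B_mono: "B m K \<subseteq> B m K'" if "K \<le> K'" for m K K'
    using that
  proof (induction K' rule: dec_induct)
    case (step k)
    have "B m k \<subseteq> B m (Suc k)"
      by (auto simp: B_def Y_def b_def N_def)
    with step show ?case by blast
  qed simp
  have C_le: "C m K \<omega> \<le> real m" for m K \<omega>
  proof -
    have "C m K \<omega> = real (min m (N K \<omega>))"
    proof (induction K)
      case (Suc K)
      then show ?case by (auto simp: C_def b_def N_def min_def)
    qed (simp add: C_def N_def)
    then show ?thesis by simp
  qed
  have B_prob: "prob (B m K) \<le> exp (- (\<epsilon>\<^sup>2 / 4)) ^ m" for m K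
  proof -
    have sub: "exp (\<epsilon>\<^sup>2 / 4 * real m) \<le> W m K \<omega>" if "\<omega> \<in> B m K" for \<omega>
    proof -
      have "\<theta> * (\<epsilon> * real m) \<le> \<theta> * Y m K \<omega>" using that \<theta> by (intro mult_left_mono) (auto simp: B_def)
      moreover have "\<theta>\<^sup>2 * C m K \<omega> \<le> \<theta>\<^sup>2 * real m" using C_le by (intro mult_left_mono) auto
      moreover have "\<theta> * (\<epsilon> * real m) - \<theta>\<^sup>2 * real m = \<epsilon>\<^sup>2 / 4 * real m"
        by (simp add: \<theta>_def power2_eq_square field_simps)
      ultimately show ?thesis unfolding W_def by simp
    qed
    have "exp (\<epsilon>\<^sup>2 / 4 * real m) * prob (B m K) = (LINT \<omega>|M. exp (\<epsilon>\<^sup>2 / 4 * real m) * indicator (B m K) \<omega>)"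
      by simp
    also have "\<dots> \<le> (LINT \<omega>|M. W m K \<omega>)"
    proof (rule integral_mono)
      show "integrable M (\<lambda>\<omega>. exp (\<epsilon>\<^sup>2 / 4 * real m) * indicator (B m K) \<omega>)"
        by (intro integrable_mult_right integrable_real_indicator) (auto simp: less_top[symmetric])
      show "exp (\<epsilon>\<^sup>2 / 4 * real m) * indicator (B m K) \<omega> \<le> W m K \<omega>" for \<omega>
        using sub[of \<omega>] by (cases "\<omega> \<in> B m K") (auto simp: W_def)
    qed (rule W_int)
    also have "\<dots> \<le> 1" by (rule W_le)
    finally show ?thesis
      by (simp add: exp_minus exp_of_nat_mult[symmetric] field_simps flip: exp_of_nat2_mult)
  qed
  have UB_prob: "prob (\<Union>K. B m K) \<le> exp (- (\<epsilon>\<^sup>2 / 4)) ^ m" for m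
  proof -
    have "(\<lambda>K. prob (B m K)) \<longlonglongrightarrow> prob (\<Union>K. B m K)"
      using B_mono by (intro finite_Lim_measure_incseq) (auto simp: incseq_def)
    then show ?thesis by (rule LIMSEQ_le_const2) (auto intro: B_prob)
  qed
  have "AE \<omega> in M. eventually (\<lambda>m. \<omega> \<in> space M - (\<Union>K. B m K)) sequentially"
  proof (rule borel_cantelli_AE1)
    show "summable (\<lambda>m. prob (\<Union>K. B m K))"
      by (rule summable_comparison_test[OF _ summable_geometric[of "exp (- (\<epsilon>\<^sup>2 / 4))"]])
        (use UB_prob eps in \<open>auto\<close>)
  qed (auto simp: less_top[symmetric])
  then show ?thesis
  proof eventually_elim
    case (elim \<omega>)
    then show ?case
    proof eventually_elim
      case (elim m)
      show ?case
      proof (intro allI impI)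
        fix K assume K: "(\<Sum>l<K. of_bool (e l \<omega>)) = m"
        have "N l \<omega> < m" if "l < K" "e l \<omega>" for l
        proof -
          have "N (Suc l) \<omega> \<le> N K \<omega>" using that by (intro monoD[OF N_mono]) auto
          then show ?thesis using K that by (simp add: N_def)
        qed
        then have "Y m K \<omega> = (\<Sum>l<K. of_bool (e l \<omega>) * \<xi> l \<omega>)"
          unfolding Y_def b_def by (intro sum.cong) auto
        then show "(\<Sum>l<K. of_bool (e l \<omega>) * \<xi> l \<omega>) < \<epsilon> * real m"
          using elim K by (auto simp: B_def N_def not_le)
      qed
    qed
  qed
qed

text \<open>
  The strong law for a random selection of terms: on the event that infinitely many terms are
  selected, their average vanishes.  The decision to select a term is taken before its value is known.
\<close>

theorem (in prob_space) selected_average_tendsto_0: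
  fixes F :: "nat \<Rightarrow> 'a measure" and e :: "nat \<Rightarrow> 'a \<Rightarrow> bool" and \<xi> :: "nat \<Rightarrow> 'a \<Rightarrow> real"
  assumes sub: "\<And>k. subalgebra M (F k)"
    and e: "\<And>l k. l \<le> k \<Longrightarrow> Measurable.pred (F k) (e l)"
    and \<xi>: "\<And>l k. l < k \<Longrightarrow> \<xi> l \<in> borel_measurable (F k)"
    and bounded: "\<And>k \<omega>. \<omega> \<in> space M \<Longrightarrow> \<bar>\<xi> k \<omega>\<bar> \<le> 1"
    and centred: "\<And>k E. E \<in> sets (F k) \<Longrightarrow> E \<subseteq> {\<omega> \<in> space M. e k \<omega>} \<Longrightarrow> (LINT \<omega>:E|M. \<xi> k \<omega>) = 0"
  shows "AE \<omega> in M. filterlim (\<lambda>K. \<Sum>l<K. of_bool (e l \<omega>) :: nat) at_top sequentially \<longrightarrow>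
           (\<lambda>K. (\<Sum>l<K. of_bool (e l \<omega>) * \<xi> l \<omega>) / real (\<Sum>l<K. of_bool (e l \<omega>))) \<longlonglongrightarrow> 0"
proof -
  have "AE \<omega> in M. eventually (\<lambda>m. \<forall>K. (\<Sum>l<K. of_bool (e l \<omega>)) = m \<longrightarrow>
           (\<Sum>l<K. of_bool (e l \<omega>) * \<xi> l \<omega>) < 1 / real (Suc p) * real m) sequentially" for p
    by (rule selected_average_upper[OF sub e \<xi> bounded centred]) auto
  moreover have "AE \<omega> in M. eventually (\<lambda>m. \<forall>K. (\<Sum>l<K. of_bool (e l \<omega>)) = m \<longrightarrow>
           (\<Sum>l<K. of_bool (e l \<omega>) * - \<xi> l \<omega>) < 1 / real (Suc p) * real m) sequentially" for p
    by (rule selected_average_upper[OF sub e])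
      (use \<xi> bounded centred in \<open>auto simp: set_lebesgue_integral_def\<close>)
  ultimately have "AE \<omega> in M. \<forall>p.
     (eventually (\<lambda>m. \<forall>K. (\<Sum>l<K. of_bool (e l \<omega>)) = m \<longrightarrow>
           (\<Sum>l<K. of_bool (e l \<omega>) * \<xi> l \<omega>) < 1 / real (Suc p) * real m) sequentially) \<and>
     (eventually (\<lambda>m. \<forall>K. (\<Sum>l<K. of_bool (e l \<omega>)) = m \<longrightarrow>
           (\<Sum>l<K. of_bool (e l \<omega>) * - \<xi> l \<omega>) < 1 / real (Suc p) * real m) sequentially)"
    unfolding AE_all_countable AE_conj_iff by blast
  then show ?thesis
  proof (eventually_elim, intro impI)
    case (elim \<omega>)
    define N where "N K = (\<Sum>l<K. of_bool (e l \<omega>) :: nat)" for K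
    define s where "s K = (\<Sum>l<K. of_bool (e l \<omega>) * \<xi> l \<omega>)" for K
    assume lim: "filterlim (\<lambda>K. \<Sum>l<K. of_bool (e l \<omega>) :: nat) at_top sequentially"
    then have limN: "filterlim N at_top sequentially" unfolding N_def .
    have "(\<lambda>K. s K / real (N K)) \<longlonglongrightarrow> 0"
    proof (rule LIMSEQ_I)
      fix r :: real assume "r > 0"
      then obtain p where p: "1 / real (Suc p) < r" using nat_approx_posE by blast
      have up: "eventually (\<lambda>K. s K < 1 / real (Suc p) * real (N K)) sequentially"
        using elim[rule_format, of p, THEN conjunct1] limN
        unfolding filterlim_iff by (fastforce elim: eventually_mono simp: N_def s_def)
      have lo: "eventually (\<lambda>K. - s K < 1 / real (Suc p) * real (N K)) sequentially"
        using elim[rule_format, of p, THEN conjunct2] limN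
        unfolding filterlim_iff by (fastforce elim: eventually_mono simp: N_def s_def sum_negf)
      have pos: "eventually (\<lambda>K. 0 < N K) sequentially"
        using limN eventually_gt_at_top[of 0] unfolding filterlim_iff by blast
      have "eventually (\<lambda>K. norm (s K / real (N K) - 0) < r) sequentially"
        using up lo pos
      proof eventually_elim
        case (elim K)
        then have "\<bar>s K\<bar> < 1 / real (Suc p) * real (N K)" by linarith
        also have "\<dots> \<le> r * real (N K)" using p by (intro mult_right_mono) auto
        finally show ?case using elim by (simp add: abs_divide pos_divide_less_eq)
      qed
      then show "\<exists>no. \<forall>n\<ge>no. norm (s n / real (N n) - 0) < r"
        by (simp add: eventually_sequentially)
    qed
    then show "(\<lambda>K. (\<Sum>l<K. of_bool (e l \<omega>) * \<xi> l \<omega>) / real (\<Sum>l<K. of_bool (e l \<omega>))) \<longlonglongrightarrow> 0"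
      by (simp add: s_def N_def)
  qed
qed

section \<open>The excess of a service time over an exponential clock\<close>

definition exponential_cdf :: "real \<Rightarrow> real \<Rightarrow> real" where
  "exponential_cdf a v = 1 - exp (- a * max v 0)"

text \<open>
  This is the probability that $X - Y > x$ for $X$ with CDF \<open>F\<close> and an independent exponential $Y$ of
  rate \<open>a\<close>.
\<close>

definition excess_tail :: "real \<Rightarrow> (real \<Rightarrow> real) \<Rightarrow> real \<Rightarrow> real" where
  "excess_tail a F x = (LINT v|interval_measure F. exponential_cdf a (v - x))"

lemma exponential_cdf_measurable[measurable]: "exponential_cdf a \<in> borel_measurable borel"
  unfolding exponential_cdf_def by measurable

lemma exponential_cdf_continuous: "isCont (exponential_cdf a) x"
  unfolding exponential_cdf_def by (intro continuous_intros)

lemma exponential_cdf_bounds: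
  assumes "0 < a"
  shows "0 \<le> exponential_cdf a v" "exponential_cdf a v \<le> 1" "\<bar>exponential_cdf a v\<bar> \<le> 1"
  using assms by (auto simp: exponential_cdf_def)

lemma exponential_cdf_mono:
  assumes "0 < a" "u \<le> v"
  shows "exponential_cdf a u \<le> exponential_cdf a v"
  using assms by (auto simp: exponential_cdf_def max_def intro: mult_left_mono)

lemma exponential_cdf_nonpos: "v \<le> 0 \<Longrightarrow> exponential_cdf a v = 0"
  by (simp add: exponential_cdf_def max_def)

text \<open>
  The Lipschitz bound makes \<open>excess_tail\<close> continuous in \<open>x\<close> even where \<open>F\<close> has atoms; long-run CDFs of
  residuals are therefore continuous, and convergence at rational points suffices later.
\<close>

lemma exponential_cdf_lipschitz:
  assumes a: "0 < a"
  shows "\<bar>exponential_cdf a u - exponential_cdf a v\<bar> \<le> a * \<bar>u - v\<bar>"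
proof -
  have *: "exponential_cdf a u - exponential_cdf a v \<le> a * (u - v)" if "v \<le> u" for u v :: real
  proof -
    define s where "s = max v 0"
    define d where "d = max u 0 - s"
    have d: "0 \<le> d" "d \<le> u - v" "0 \<le> s" using that by (auto simp: d_def s_def)
    have "exponential_cdf a u - exponential_cdf a v = exp (- a * s) * (1 - exp (- a * d))"
      by (simp add: exponential_cdf_def d_def flip: s_def)
        (simp add: algebra_simps flip: exp_add)
    also have "\<dots> \<le> 1 * (1 - exp (- a * d))" using a d by (intro mult_right_mono) auto
    also have "\<dots> \<le> a * d" using exp_ge_add_one_self[of "- a * d"] by simp
    also have "\<dots> \<le> a * (u - v)" using a d by (intro mult_left_mono) auto
    finally show ?thesis .
  qed
  show ?thesis
  proof (cases "v \<le> u")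
    case True
    then show ?thesis using *[of v u] exponential_cdf_mono[OF a True] by simp
  next
    case False
    then show ?thesis using *[of u v] exponential_cdf_mono[OF a, of u v] by (simp add: abs_if)
  qed
qed

lemma measure_exponential:
  fixes a :: real
  assumes a: "0 < a"
  defines "E \<equiv> density lborel (exponential_density a)"
  shows "measure E {..x} = exponential_cdf a x" "measure E {..<x} = exponential_cdf a x"
proof -
  interpret prob_space E unfolding E_def by (rule prob_space_exponential_density[OF a])
  have dist: "distributed E lborel (\<lambda>x. x) (exponential_density a)"
    unfolding distributed_def E_def by (auto simp: distr_id2)
  have E_space: "space E = UNIV" "sets E = sets borel" by (auto simp: E_def)
  have pos: "measure E {..x} = exponential_cdf a x" if "0 \<le> x" for x
    using exponential_distributedD_le[OF dist that a] that
    by (simp add: E_space exponential_cdf_def atMost_def ac_simps)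
  show le: "measure E {..x} = exponential_cdf a x"
  proof (cases "0 \<le> x")
    case False
    then have "measure E {..x} \<le> measure E {..0}"
      by (intro finite_measure_mono) (auto simp: E_space)
    then have "measure E {..x} = 0" using pos[of 0] by (simp add: exponential_cdf_def measure_le_0_iff)
    then show ?thesis using False by (simp add: exponential_cdf_def)
  qed (rule pos)
  have "AE y in E. y \<noteq> x"
  proof -
    have "AE y in lborel. y \<noteq> x" by (rule AE_lborel_singleton)
    then have "AE y in lborel. 0 < ennreal (exponential_density a y) \<longrightarrow> y \<noteq> x" by eventually_elim simp
    then show ?thesis unfolding E_def by (subst AE_density) simp_all
  qed
  then have "measure E {..<x} = measure E {..x}"
    by (intro measure_eq_AE) (auto simp: E_space)
  with le show "measure E {..<x} = exponential_cdf a x" by simp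
qed

text \<open>
  A CDF determines its measure, so the measure hidden in \<open>service_cdf\<close> is the interval measure.
\<close>

lemma service_cdf_interval_measure:
  assumes "service_cdf F"
  shows "real_distribution (interval_measure F)" "cdf (interval_measure F) = F"
    "measure (interval_measure F) {..<0} = 0" "measure (interval_measure F) {0<..} > 0"
proof -
  obtain \<mu> where \<mu>: "real_distribution \<mu>" "F = cdf \<mu>" "measure \<mu> {..<0} = 0" "measure \<mu> {0<..} > 0"
    using assms by (auto simp: service_cdf_def)
  interpret real_distribution \<mu> by fact
  have "real_distribution (interval_measure F)" "cdf (interval_measure F) = F"
    unfolding \<mu>(2)
    by (intro real_distribution_interval_measure cdf_interval_measure cdf_nondecreasing
        cdf_is_right_cont cdf_lim_at_bot cdf_lim_at_top_prob; assumption)+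
  moreover from this have "interval_measure F = \<mu>"
    using \<mu> by (intro cdf_unique) auto
  ultimately show "real_distribution (interval_measure F)" "cdf (interval_measure F) = F"
    "measure (interval_measure F) {..<0} = 0" "measure (interval_measure F) {0<..} > 0"
    using \<mu> by auto
qed

lemma service_cdfI_continuous:
  assumes mono: "mono F" and cont: "\<And>x. isCont F x" and zero: "\<And>x. x \<le> 0 \<Longrightarrow> F x = 0"
    and lim: "(F \<longlongrightarrow> 1) at_top"
  shows "service_cdf F"
proof -
  have bot: "(F \<longlongrightarrow> 0) at_bot"
    by (rule tendsto_eventually) (auto simp: eventually_at_bot_linorder intro!: exI[of _ 0] zero)
  have rc: "continuous (at_right x) F" for x
    using cont[of x] by (rule continuous_at_imp_continuous_within)
  interpret real_distribution "interval_measure F"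
    by (intro real_distribution_interval_measure monoD[OF mono] rc bot lim)
  have cdf: "cdf (interval_measure F) = F"
    by (intro cdf_interval_measure monoD[OF mono] rc bot lim)
  have "measure (interval_measure F) {..0} = 0"
    using zero[of 0] cdf by (metis cdf_def2 order_refl)
  moreover have "measure (interval_measure F) {..<0} \<le> measure (interval_measure F) {..0}"
    by (intro finite_measure_mono) auto
  moreover have "measure (interval_measure F) {0<..} = 1 - measure (interval_measure F) {..0}"
    using prob_compl[of "{..0}"] by (simp add: Compl_eq_Diff_UNIV[symmetric] not_le)
  ultimately show ?thesis
    unfolding service_cdf_def
    by (intro exI[of _ "interval_measure F"]) (auto simp: cdf measure_le_0_iff real_distribution_axioms)
qed

context
  fixes a :: real and F :: "real \<Rightarrow> real"
  assumes a: "0 < a" and F: "service_cdf F"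
begin

interpretation F: real_distribution "interval_measure F"
  by (rule service_cdf_interval_measure(1)[OF F])

lemma service_AE_nonneg: "AE v in interval_measure F. 0 \<le> v"
  using service_cdf_interval_measure(3)[OF F]
  by (intro AE_I[of _ _ "{..<0}"]) (auto simp: F.emeasure_eq_measure)

lemma excess_integrable: "integrable (interval_measure F) (\<lambda>v. exponential_cdf a (v - x))"
  by (rule F.integrable_const_bound[where B = 1]) (auto simp: exponential_cdf_bounds[OF a])

lemma excess_tail_nonneg: "0 \<le> excess_tail a F x"
  unfolding excess_tail_def by (intro Bochner_Integration.integral_nonneg) (simp add: exponential_cdf_bounds[OF a])

lemma excess_tail_antimono: "x \<le> y \<Longrightarrow> excess_tail a F y \<le> excess_tail a F x"
  unfolding excess_tail_def by (intro integral_mono excess_integrable exponential_cdf_mono a) auto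

lemma excess_tail_pos: "0 < excess_tail a F 0"
proof -
  have "excess_tail a F 0 \<noteq> 0"
  proof
    assume "excess_tail a F 0 = 0"
    then have "AE v in interval_measure F. exponential_cdf a v = 0"
      using integral_nonneg_eq_0_iff_AE[OF excess_integrable[of 0]]
      by (simp add: excess_tail_def exponential_cdf_bounds[OF a])
    then have "AE v in interval_measure F. v \<notin> {0<..}"
      by eventually_elim (use a in \<open>auto simp: exponential_cdf_def max_def\<close>)
    then have "measure (interval_measure F) {0<..} = 0"
      using F.prob_eq_0[of "{0<..}"] by simp
    with service_cdf_interval_measure(4)[OF F] show False by simp
  qed
  with excess_tail_nonneg[of 0] show ?thesis by simp
qed

lemma excess_tail_less_1: "excess_tail a F x < 1"
proof -
  have int: "integrable (interval_measure F) (\<lambda>v. exp (- a * max (v - x) 0))"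
    by (rule F.integrable_const_bound[where B = 1]) (use a in auto)
  have "excess_tail a F x = 1 - (LINT v|interval_measure F. exp (- a * max (v - x) 0))"
    unfolding excess_tail_def exponential_cdf_def
    using int by (subst Bochner_Integration.integral_diff) (auto simp: F.prob_space[unfolded F.space_eq_univ])
  moreover have "0 < (LINT v|interval_measure F. exp (- a * max (v - x) 0))"
  proof -
    have "(LINT v|interval_measure F. exp (- a * max (v - x) 0)) \<noteq> 0"
      using integral_nonneg_eq_0_iff_AE[OF int] F.AE_const[of False] by simp
    moreover have "0 \<le> (LINT v|interval_measure F. exp (- a * max (v - x) 0))"
      by (intro Bochner_Integration.integral_nonneg) simp
    ultimately show ?thesis by (metis less_le)
  qed
  ultimately show ?thesis by simp
qed

lemma excess_tail_isCont: "isCont (excess_tail a F) x"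
proof -
  have lip: "\<bar>excess_tail a F y - excess_tail a F x\<bar> \<le> a * \<bar>y - x\<bar>" for y
  proof -
    have "\<bar>excess_tail a F y - excess_tail a F x\<bar>
      \<le> (LINT v|interval_measure F. \<bar>exponential_cdf a (v - y) - exponential_cdf a (v - x)\<bar>)"
      unfolding excess_tail_def
      by (subst Bochner_Integration.integral_diff[OF excess_integrable excess_integrable, symmetric])
        (rule integral_abs_bound)
    also have "\<dots> \<le> (LINT v|interval_measure F. a * \<bar>y - x\<bar>)"
    proof (intro integral_mono integrable_abs Bochner_Integration.integrable_diff excess_integrable)
      show "\<bar>exponential_cdf a (v - y) - exponential_cdf a (v - x)\<bar> \<le> a * \<bar>y - x\<bar>" for v
        using exponential_cdf_lipschitz[OF a, of "v - y" "v - x"] by (simp add: abs_minus_commute)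
    qed simp
    also have "\<dots> = a * \<bar>y - x\<bar>" using F.prob_space[unfolded F.space_eq_univ] by simp
    finally show ?thesis .
  qed
  have "((\<lambda>y. excess_tail a F y - excess_tail a F x) \<longlongrightarrow> 0) (at x)"
  proof (rule Lim_null_comparison)
    show "\<forall>\<^sub>F y in at x. norm (excess_tail a F y - excess_tail a F x) \<le> a * \<bar>y - x\<bar>"
      using lip by simp
    show "((\<lambda>y. a * \<bar>y - x\<bar>) \<longlongrightarrow> 0) (at x)"
      by (rule tendsto_eq_intros refl | simp)+
  qed
  then show ?thesis unfolding isCont_def by (rule LIM_zero_cancel)
qed

lemma excess_tail_at_top: "(excess_tail a F \<longlongrightarrow> 0) at_top"
proof -
  have "((\<lambda>x. LINT v|interval_measure F. exponential_cdf a (v - x)) \<longlongrightarrow> (LINT v|interval_measure F. 0)) at_top"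
  proof (rule integral_dominated_convergence_at_top[where w = "\<lambda>_. 1"])
    show "AE v in interval_measure F. ((\<lambda>x. exponential_cdf a (v - x)) \<longlongrightarrow> 0) at_top"
    proof (intro AE_I2 tendsto_eventually)
      fix v show "\<forall>\<^sub>F x in at_top. exponential_cdf a (v - x) = 0"
        using eventually_ge_at_top[of v] by eventually_elim (simp add: exponential_cdf_nonpos)
    qed
  qed (auto simp: exponential_cdf_bounds[OF a])
  then show ?thesis by (simp add: excess_tail_def[abs_def])
qed

lemma LST_eq_excess_tail: "LST F a = 1 - excess_tail a F 0"
proof -
  have "LST F a = (LINT v|interval_measure F. 1 - exponential_cdf a v)"
    unfolding LST_def set_lebesgue_integral_def
  proof (intro integral_cong_AE)
    show "AE v in interval_measure F. indicat_real {0..} v *\<^sub>R exp (- a * v) = 1 - exponential_cdf a v"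
      using service_AE_nonneg by eventually_elim (auto simp: exponential_cdf_def max_def)
  qed auto
  also have "\<dots> = 1 - excess_tail a F 0"
    unfolding excess_tail_def using excess_integrable[of 0]
    by (subst Bochner_Integration.integral_diff) (auto simp: F.prob_space[unfolded F.space_eq_univ])
  finally show ?thesis .
qed

text \<open>
  Integrating over the exponential variable first, by Fubini, reduces the conditional probability to
  two values of \<open>excess_tail\<close>.
\<close>

lemma D_eq_excess_tail:
  "D a F z = (if z < 0 then 0 else 1 - excess_tail a F z / excess_tail a F 0)"
proof -
  define E where "E = density lborel (exponential_density a)"
  define P where "P = interval_measure F \<Otimes>\<^sub>M E"
  interpret E: prob_space E unfolding E_def by (rule prob_space_exponential_density[OF a])
  interpret P: pair_prob_space "interval_measure F" E ..
  have P_prob: "prob_space P" unfolding P_def by (rule P.prob_space_axioms)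
  then interpret PP: prob_space P .
  have setsE[measurable_cong]: "sets E = sets borel" and spE: "space E = UNIV" by (auto simp: E_def)
  have [measurable_cong]: "sets P = sets (borel \<Otimes>\<^sub>M borel)"
    unfolding P_def by (intro sets_pair_measure_cong) (auto simp: setsE)
  have spP: "space P = UNIV" by (simp add: P_def space_pair_measure spE)
  have slice: "measure P A = (LINT v|interval_measure F. measure E (Pair v -` A))"
    if A[measurable]: "A \<in> sets P" for A
  proof -
    have int: "integrable P (indicat_real A)" by (simp add: less_top[symmetric])
    have "measure P A = (LINT w|P. indicat_real A w)" by simp
    also have "\<dots> = (LINT v|interval_measure F. LINT y|E. indicat_real A (v, y))"
      using P.integral_fst[of "\<lambda>v y. indicat_real A (v, y)"] int by (simp add: P_def case_prod_unfold)
    also have "\<dots> = (LINT v|interval_measure F. LINT y|E. indicat_real (Pair v -` A) y)"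
      by (simp add: indicator_def vimage_def)
    also have "\<dots> = (LINT v|interval_measure F. measure E (Pair v -` A))"
      by (simp add: spE)
    finally show ?thesis .
  qed
  have le: "measure P {w. snd w \<le> fst w} = excess_tail a F 0"
  proof -
    have "{w \<in> space P. snd w \<le> fst w} \<in> sets P" by measurable
    then have "measure P {w. snd w \<le> fst w} = (LINT v|interval_measure F. measure E (Pair v -` {w. snd w \<le> fst w}))"
      by (intro slice) (simp add: spP)
    also have "\<dots> = excess_tail a F 0"
      unfolding excess_tail_def using measure_exponential(1)[OF a]
      by (simp add: E_def vimage_def atMost_def)
    finally show ?thesis .
  qed
  have gt: "measure P {w. snd w < fst w - z} = excess_tail a F z"
  proof -
    have "{w \<in> space P. snd w < fst w - z} \<in> sets P" by measurable
    then have "measure P {w. snd w < fst w - z} = (LINT v|interval_measure F. measure E (Pair v -` {w. snd w < fst w - z}))"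
      by (intro slice) (simp add: spP)
    also have "\<dots> = excess_tail a F z"
      unfolding excess_tail_def using measure_exponential(2)[OF a]
      by (simp add: E_def vimage_def lessThan_def)
    finally show ?thesis .
  qed
  have D: "D a F z = measure P {w. fst w - snd w \<le> z \<and> snd w \<le> fst w} / measure P {w. snd w \<le> fst w}"
    unfolding D_def cond_prob_def by (simp add: E_def[symmetric] P_def[symmetric] spP)
  show ?thesis
  proof (cases "z < 0")
    case True
    then have "{w. fst w - snd w \<le> z \<and> snd w \<le> fst w} = {}" by auto
    then have "measure P {w. fst w - snd w \<le> z \<and> snd w \<le> fst w} = 0" by (metis measure_empty)
    then show ?thesis unfolding D using True by simp
  next
    case False
    define A B where "A = {w::real \<times> real. snd w \<le> fst w}" and "B = {w::real \<times> real. snd w < fst w - z}"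
    have "{w \<in> space P. snd w \<le> fst w} \<in> sets P" "{w \<in> space P. snd w < fst w - z} \<in> sets P" by measurable
    then have AB: "A \<in> sets P" "B \<in> sets P" by (simp_all add: spP A_def B_def)
    have "B \<subseteq> A" using False by (auto simp: A_def B_def)
    have "{w. fst w - snd w \<le> z \<and> snd w \<le> fst w} = A - B"
      by (auto simp: A_def B_def)
    then have "measure P {w. fst w - snd w \<le> z \<and> snd w \<le> fst w} = measure P (A - B)"
      by (rule arg_cong)
    also have "\<dots> = measure P A - measure P B"
      using AB \<open>B \<subseteq> A\<close> by (rule PP.finite_measure_Diff)
    also have "\<dots> = excess_tail a F 0 - excess_tail a F z"
      by (simp only: A_def B_def le gt)
    finally have "measure P {w. fst w - snd w \<le> z \<and> snd w \<le> fst w} = excess_tail a F 0 - excess_tail a F z" .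
    then have "D a F z = (excess_tail a F 0 - excess_tail a F z) / excess_tail a F 0"
      by (simp only: D le)
    then show ?thesis using False excess_tail_pos by (simp add: diff_divide_distrib)
  qed
qed

lemma D_props:
  "mono (D a F)" "isCont (D a F) x" "x \<le> 0 \<Longrightarrow> D a F x = 0" "(D a F \<longlongrightarrow> 1) at_top"
proof -
  define Q where "Q = excess_tail a F"
  have Q0: "0 < Q 0" unfolding Q_def by (rule excess_tail_pos)
  have eq: "D a F z = 1 - Q (max z 0) / Q 0" for z
    using Q0 by (simp add: D_eq_excess_tail max_def Q_def)
  show "mono (D a F)"
    unfolding mono_def eq using Q0
    by (auto intro!: divide_right_mono excess_tail_antimono simp: Q_def)
  show "isCont (D a F) x"
  proof -
    have "isCont (\<lambda>z. Q (max z 0)) x"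
      by (rule isCont_o2[where g = Q]) (auto intro!: continuous_intros excess_tail_isCont simp: Q_def)
    then show ?thesis
      unfolding eq[abs_def] using Q0 by (intro continuous_intros) auto
  qed
  show "x \<le> 0 \<Longrightarrow> D a F x = 0" using Q0 by (simp add: eq max_def)
  have "((\<lambda>z. Q (max z 0)) \<longlongrightarrow> 0) at_top"
    using excess_tail_at_top
    by (rule Lim_transform_eventually) (auto simp: Q_def max_def intro!: eventually_mono[OF eventually_gt_at_top[of 0]])
  then have "((\<lambda>z. 1 - Q (max z 0) / Q 0) \<longlongrightarrow> 1 - 0 / Q 0) at_top"
    using Q0 by (intro tendsto_intros) auto
  then show "(D a F \<longlongrightarrow> 1) at_top" unfolding eq[abs_def] by simp
qed

end

text \<open>
  The CDFs produced by the recursion are again admissible as arguments of \<open>D\<close>, which permits the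
  induction on the number of customers.
\<close>

lemma mixture_D_props:
  fixes p :: real
  assumes p: "0 \<le> p" "p \<le> 1" and a: "0 < a" and F: "service_cdf F" and G: "service_cdf G"
  defines "H \<equiv> \<lambda>x. p * D a F x + (1 - p) * D a G x"
  shows "isCont H x" "service_cdf H" "x \<le> 0 \<Longrightarrow> H x = 0"
proof -
  note DF = D_props[OF a F] and DG = D_props[OF a G]
  show cont: "isCont H x" for x
    unfolding H_def by (intro continuous_intros DF(2) DG(2))
  show zero: "H x = 0" if "x \<le> 0" for x
    using that by (simp add: H_def DF(3) DG(3))
  have "mono H"
    unfolding H_def mono_def using p
    by (auto intro!: add_mono mult_left_mono monoD[OF DF(1)] monoD[OF DG(1)])
  moreover have "(H \<longlongrightarrow> p * 1 + (1 - p) * 1) at_top"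
    unfolding H_def by (intro tendsto_intros DF(4) DG(4))
  ultimately show "service_cdf H"
    using cont zero by (intro service_cdfI_continuous) auto
qed

section \<open>Sample paths of the queue\<close>

lemma initial_segment_nat:
  fixes A :: "nat set"
  assumes "finite A" and down: "\<And>i j. i \<in> A \<Longrightarrow> j \<le> i \<Longrightarrow> j \<in> A"
  shows "A = {..<card A}"
proof -
  obtain n where n: "A = {..<n}"
  proof (cases "A = {}")
    case True
    then show ?thesis using that[of 0] by simp
  next
    case False
    have "A = {..<Suc (Max A)}"
    proof (intro set_eqI iffI)
      fix x assume "x \<in> A"
      then show "x \<in> {..<Suc (Max A)}" using Max_ge[OF \<open>finite A\<close>] by (simp add: less_Suc_eq_le)
    next
      fix x assume "x \<in> {..<Suc (Max A)}"
      then show "x \<in> A" using down[OF Max_in[OF \<open>finite A\<close> False], of x] by (simp add: less_Suc_eq_le)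
    qed
    then show ?thesis by (rule that)
  qed
  show ?thesis by (simp add: n)
qed

text \<open>
  All counting in the queue is of initial segments of the natural numbers, because arrivals and
  services are ordered in time; comparisons with such counts become comparisons of epochs.
\<close>

lemma less_card_initial_segment:
  fixes P :: "nat \<Rightarrow> bool"
  assumes "finite {i. P i}" and "\<And>i j. P i \<Longrightarrow> j \<le> i \<Longrightarrow> P j"
  shows "m < card {i. P i} \<longleftrightarrow> P m"
  using initial_segment_nat[of "{i. P i}"] assms by blast

context single_server_queue
begin

text \<open>
  The card is the index of the first arrival strictly after \<open>t\<close>.
\<close>

definition next_arrival :: "real \<Rightarrow> 'a \<Rightarrow> real" where
  "next_arrival t \<omega> = T (card {i. T i \<omega> \<le> t}) \<omega>"

definition started_before :: "nat \<Rightarrow> 'a \<Rightarrow> nat" where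
  "started_before i \<omega> = card {j. service_start j \<omega> < T i \<omega>}"

context
  fixes \<omega>
  assumes \<omega>: "\<omega> \<in> space M"
begin

lemma finite_T_le: "finite {i. T i \<omega> \<le> t}"
proof -
  have "eventually (\<lambda>i. t < T i \<omega>) sequentially"
    using T_unbounded[OF \<omega>] by (simp add: filterlim_at_top_dense)
  then obtain n where "\<And>i. n \<le> i \<Longrightarrow> t < T i \<omega>" by (auto simp: eventually_sequentially)
  then have "{i. T i \<omega> \<le> t} \<subseteq> {..n}" by (auto simp: not_le[symmetric]) (meson nat_le_linear)
  then show ?thesis by (rule finite_subset) simp
qed

lemma T_le_iff: "m < card {i. T i \<omega> \<le> t} \<longleftrightarrow> T m \<omega> \<le> t"
  using finite_T_le T_mono[OF \<omega>] by (intro less_card_initial_segment) (auto dest: monoD intro: order_trans)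

lemma T_monoD: "i \<le> j \<Longrightarrow> T i \<omega> \<le> T j \<omega>"
  using T_mono[OF \<omega>] by (rule monoD)

lemma entry_le_start: "entry j \<omega> \<le> service_start j \<omega>"
  by (cases j) auto

lemma entry_nonneg: "0 \<le> entry j \<omega>"
  using T_nonneg[OF \<omega>] by (auto simp: entry_def)

lemma start_nonneg: "0 \<le> service_start j \<omega>"
  using entry_nonneg entry_le_start order_trans by blast

lemma start_le_end: "service_start j \<omega> \<le> service_end j \<omega>"
  using X_nonneg[OF \<omega>] by (simp add: service_end_def)

lemma end_le_start_Suc: "service_end j \<omega> \<le> service_start (Suc j) \<omega>"
  by (simp add: service_end_def)

lemma start_mono: "i \<le> j \<Longrightarrow> service_start i \<omega> \<le> service_start j \<omega>"
  by (rule lift_Suc_mono_le[of "\<lambda>j. service_start j \<omega>"])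
    (use start_le_end end_le_start_Suc order_trans in blast)+

lemma end_mono: "i \<le> j \<Longrightarrow> service_end i \<omega> \<le> service_end j \<omega>"
  by (rule lift_Suc_mono_le[of "\<lambda>j. service_end j \<omega>"])
    (use start_le_end end_le_start_Suc order_trans in blast)+

lemma end_le_start: "i < j \<Longrightarrow> service_end i \<omega> \<le> service_start j \<omega>"
  by (rule order_trans[OF end_le_start_Suc start_mono]) simp

lemma start_unbounded: "filterlim (\<lambda>j. service_start j \<omega>) at_top sequentially"
proof -
  have "filterlim (\<lambda>j. T (j - N0 \<omega>) \<omega>) at_top sequentially"
    by (rule filterlim_compose[OF T_unbounded[OF \<omega>] filterlim_minus_const_nat_at_top])
  moreover have "eventually (\<lambda>j. T (j - N0 \<omega>) \<omega> \<le> service_start j \<omega>) sequentially"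
  proof (rule eventually_sequentiallyI[of "N0 \<omega>"])
    fix j assume "N0 \<omega> \<le> j"
    then show "T (j - N0 \<omega>) \<omega> \<le> service_start j \<omega>"
      using entry_le_start[of j] by (simp add: entry_def)
  qed
  ultimately show ?thesis by (rule filterlim_at_top_mono)
qed

lemma finite_start_le: "finite {j. service_start j \<omega> \<le> t}"
proof -
  have "eventually (\<lambda>j. t < service_start j \<omega>) sequentially"
    using start_unbounded by (simp add: filterlim_at_top_dense)
  then obtain n where "\<And>i. n \<le> i \<Longrightarrow> t < service_start i \<omega>" by (auto simp: eventually_sequentially)
  then have "{i. service_start i \<omega> \<le> t} \<subseteq> {..n}" by (auto simp: not_le[symmetric]) (meson nat_le_linear)
  then show ?thesis by (rule finite_subset) simp
qed

lemma finite_end_le: "finite {j. service_end j \<omega> \<le> t}"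
  by (rule finite_subset[OF _ finite_start_le[of t]]) (use start_le_end order_trans in blast)

lemma end_le_iff: "m < card {j. service_end j \<omega> \<le> t} \<longleftrightarrow> service_end m \<omega> \<le> t"
  using finite_end_le end_mono by (intro less_card_initial_segment) (auto intro: order_trans)

lemma completed_iff: "m < completed_before i \<omega> \<longleftrightarrow> service_end m \<omega> < T i \<omega>"
  unfolding completed_before_def
  by (intro less_card_initial_segment finite_subset[OF _ finite_end_le[of "T i \<omega>"]])
    (auto intro: le_less_trans[OF end_mono])

lemma started_iff: "m < started_before i \<omega> \<longleftrightarrow> service_start m \<omega> < T i \<omega>"
  unfolding started_before_def
  by (intro less_card_initial_segment finite_subset[OF _ finite_start_le[of "T i \<omega>"]])
    (auto intro: le_less_trans[OF start_mono])

text \<open>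
  The service numbered by the completed ones is the one in progress, or the next to commence.
\<close>

lemma end_completed: "T i \<omega> \<le> service_end (completed_before i \<omega>) \<omega>"
  using completed_iff[of "completed_before i \<omega>" i] by simp

lemma residual_nonneg: "0 \<le> residual i \<omega>"
  using end_completed by (simp add: residual_def)

lemma completed_mono: "i \<le> k \<Longrightarrow> completed_before i \<omega> \<le> completed_before k \<omega>"
  by (meson T_monoD completed_iff leI less_le_trans nat_less_le order_less_irrefl)

lemma entry_le_T: "entry (N0 \<omega> + i) \<omega> = T i \<omega>"
  by (simp add: entry_def)

lemma completed_le: "completed_before i \<omega> \<le> N0 \<omega> + i"
proof (rule ccontr)
  assume "\<not> ?thesis"
  then have "service_end (N0 \<omega> + i) \<omega> < T i \<omega>" by (simp add: completed_iff[symmetric])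
  then show False using entry_le_T[of i] entry_le_start[of "N0 \<omega> + i"] start_le_end[of "N0 \<omega> + i"] by simp
qed

lemma next_arrival_gt: "t < next_arrival t \<omega>"
  using T_le_iff[of "card {i. T i \<omega> \<le> t}" t] by (simp add: next_arrival_def)

lemma next_arrival_le: "t < T i \<omega> \<Longrightarrow> next_arrival t \<omega> \<le> T i \<omega>"
  unfolding next_arrival_def using T_le_iff[of i t] by (intro T_monoD) linarith

lemma less_next_arrival_iff: "t \<le> u \<Longrightarrow> u < next_arrival t \<omega> \<longleftrightarrow> (\<forall>i. T i \<omega> \<le> t \<or> u < T i \<omega>)"
  using next_arrival_gt[of t] next_arrival_le[of t] unfolding next_arrival_def
  by (meson less_le_trans not_le)

lemma next_arrival_eq: "t \<le> u \<Longrightarrow> u < next_arrival t \<omega> \<Longrightarrow> {i. T i \<omega> \<le> u} = {i. T i \<omega> \<le> t}"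
  using less_next_arrival_iff[of t u] by (auto intro: order_trans)

lemma next_arrival_cong: "t \<le> u \<Longrightarrow> u < next_arrival t \<omega> \<Longrightarrow> next_arrival u \<omega> = next_arrival t \<omega>"
  using next_arrival_eq[of t u] by (simp add: next_arrival_def)

lemma arrivals_pos_iff: "0 < arrivals t u \<omega> \<longleftrightarrow> (\<exists>i. t \<le> T i \<omega> \<and> T i \<omega> \<le> u)"
proof -
  have "finite {i. t \<le> T i \<omega> \<and> T i \<omega> \<le> u}"
    by (rule finite_subset[OF _ finite_T_le[of u]]) auto
  then show ?thesis by (auto simp: arrivals_def card_gt_0_iff)
qed

end

section \<open>What is known at a fixed time\<close>

text \<open>
  The events of \<open>past t\<close> as a measurable space, for the use of measurability proofs.
\<close>

definition past_algebra :: "real \<Rightarrow> 'a measure" where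
  "past_algebra t = sigma (space M) (past t)"

lemma sigma_algebra_past: "sigma_algebra (space M) (past t)"
  unfolding past_def by (rule sigma_algebra_sigma_sets) auto

lemma space_past_algebra[simp]: "space (past_algebra t) = space M"
  unfolding past_algebra_def by (rule sigma_algebra.space_measure_of_eq[OF sigma_algebra_past])

lemma sets_past_algebra: "sets (past_algebra t) = past t"
  unfolding past_algebra_def by (rule sigma_algebra.sets_measure_of_eq[OF sigma_algebra_past])

lemma past_gen:
  "{\<omega> \<in> space M. N0 \<omega> = n} \<in> past t"
  "s \<le> t \<Longrightarrow> {\<omega> \<in> space M. T i \<omega> \<le> s} \<in> past t"
  "{\<omega> \<in> space M. service_start j \<omega> \<le> t \<and> X j \<omega> \<le> x} \<in> past t"
  unfolding past_def by (rule sigma_sets.Basic; blast)+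

lemma pred_past_iff: "Measurable.pred (past_algebra t) P \<longleftrightarrow> {\<omega> \<in> space M. P \<omega>} \<in> past t"
  by (simp add: pred_def sets_past_algebra)

lemma N0_past[measurable]: "N0 \<in> measurable (past_algebra t) (count_space UNIV)"
proof (rule measurable_count_space_eq_countable[THEN iffD2])
  show "N0 \<in> space (past_algebra t) \<rightarrow> UNIV \<and> (\<forall>n\<in>UNIV. N0 -` {n} \<inter> space (past_algebra t) \<in> sets (past_algebra t))"
    using past_gen(1)[of _ t] by (auto simp: sets_past_algebra vimage_def Int_def conj_commute)
qed simp

lemma start_le_past: "{\<omega> \<in> space M. service_start j \<omega> \<le> t} \<in> past t"
proof -
  have "{\<omega> \<in> space M. service_start j \<omega> \<le> t} = (\<Union>x::nat. {\<omega> \<in> space M. service_start j \<omega> \<le> t \<and> X j \<omega> \<le> real x})"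
    by (auto intro: real_arch_simple)
  also have "\<dots> \<in> sets (past_algebra t)"
    by (intro sets.countable_UN) (auto simp: sets_past_algebra past_gen)
  finally show ?thesis by (simp add: sets_past_algebra)
qed

lemma capped_T_past[measurable]: "(\<lambda>\<omega>. if T i \<omega> \<le> t then T i \<omega> else t + 1) \<in> borel_measurable (past_algebra t)"
proof (rule borel_measurableI_le)
  fix y
  consider "y \<le> t" | "t < y" "y < t + 1" | "t + 1 \<le> y" by linarith
  then have "{\<omega> \<in> space M. (if T i \<omega> \<le> t then T i \<omega> else t + 1) \<le> y} \<in> past t"
  proof cases
    case 1
    then have "{\<omega> \<in> space M. (if T i \<omega> \<le> t then T i \<omega> else t + 1) \<le> y} = {\<omega> \<in> space M. T i \<omega> \<le> y}" by auto
    then show ?thesis using past_gen(2)[OF 1] by simp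
  next
    case 2
    then have "{\<omega> \<in> space M. (if T i \<omega> \<le> t then T i \<omega> else t + 1) \<le> y} = {\<omega> \<in> space M. T i \<omega> \<le> t}" by auto
    then show ?thesis using past_gen(2)[OF order_refl] by simp
  next
    case 3
    then have "{\<omega> \<in> space M. (if T i \<omega> \<le> t then T i \<omega> else t + 1) \<le> y} = space (past_algebra t)" by auto
    then show ?thesis using sets.top[of "past_algebra t"] by (simp add: sets_past_algebra)
  qed
  then show "{\<omega> \<in> space (past_algebra t). (if T i \<omega> \<le> t then T i \<omega> else t + 1) \<le> y} \<in> sets (past_algebra t)"
    by (simp add: sets_past_algebra)
qed

lemma T_le_past[measurable]: "Measurable.pred (past_algebra t) (\<lambda>\<omega>. T i \<omega> \<le> t)"
  unfolding pred_past_iff by (rule past_gen) simp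

lemma start_le_past'[measurable]: "Measurable.pred (past_algebra t) (\<lambda>\<omega>. service_start j \<omega> \<le> t)"
  unfolding pred_past_iff by (rule start_le_past)

lemma X_past[measurable]: "(\<lambda>\<omega>. if service_start j \<omega> \<le> t then X j \<omega> else 0) \<in> borel_measurable (past_algebra t)"
proof (rule borel_measurableI_le)
  fix y
  have "{\<omega> \<in> space M. (if service_start j \<omega> \<le> t then X j \<omega> else 0) \<le> y} =
    {\<omega> \<in> space M. service_start j \<omega> \<le> t \<and> X j \<omega> \<le> y} \<union> (if 0 \<le> y then space M - {\<omega> \<in> space M. service_start j \<omega> \<le> t} else {})"
    by auto
  also have "\<dots> \<in> sets (past_algebra t)"
    using past_gen(3)[of j t y] start_le_past[of j t] sets.top[of "past_algebra t"]
    by (auto simp: sets_past_algebra[symmetric] intro: sets.Un sets.Diff)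
  finally show "{\<omega> \<in> space (past_algebra t). (if service_start j \<omega> \<le> t then X j \<omega> else 0) \<le> y} \<in> sets (past_algebra t)"
    by simp
qed

text \<open>
  An epoch is not known at time \<open>t\<close> if it lies in the future.  The variants below are known: an epoch
  after \<open>t\<close> is replaced by \<open>t + 1\<close>.  The end of a service that has commenced is known even when it
  lies in the future.
\<close>

definition capped_entry :: "real \<Rightarrow> nat \<Rightarrow> 'a \<Rightarrow> real" where
  "capped_entry t j \<omega> = (if entry j \<omega> \<le> t then entry j \<omega> else t + 1)"

definition capped_start :: "real \<Rightarrow> nat \<Rightarrow> 'a \<Rightarrow> real" where
  "capped_start t j \<omega> = (if service_start j \<omega> \<le> t then service_start j \<omega> else t + 1)"

definition capped_end :: "real \<Rightarrow> nat \<Rightarrow> 'a \<Rightarrow> real" where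
  "capped_end t j \<omega> = (if service_start j \<omega> \<le> t then service_end j \<omega> else t + 1)"

lemma nat_indexed_measurable:
  assumes "\<And>i. f i \<in> measurable N K" "g \<in> measurable N (count_space (UNIV :: nat set))"
  shows "(\<lambda>\<omega>. f (g \<omega>) \<omega>) \<in> measurable N K"
  by (rule measurable_compose_countable[OF assms])

lemma capped_entry_past[measurable]:
  assumes "0 \<le> t"
  shows "capped_entry t j \<in> borel_measurable (past_algebra t)"
proof -
  have [measurable]: "(\<lambda>\<omega>. if T (j - N0 \<omega>) \<omega> \<le> t then T (j - N0 \<omega>) \<omega> else t + 1) \<in> borel_measurable (past_algebra t)"
    by (rule nat_indexed_measurable[OF capped_T_past]) measurable
  have "(\<lambda>\<omega>. if j < N0 \<omega> then 0 else (if T (j - N0 \<omega>) \<omega> \<le> t then T (j - N0 \<omega>) \<omega> else t + 1)) \<in> borel_measurable (past_algebra t)"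
    by measurable
  also have "(\<lambda>\<omega>. if j < N0 \<omega> then 0 else (if T (j - N0 \<omega>) \<omega> \<le> t then T (j - N0 \<omega>) \<omega> else t + 1)) =
     capped_entry t j"
    using assms by (auto simp: capped_entry_def entry_def)
  finally show ?thesis .
qed

lemma capped_start_end_past:
  assumes t: "0 \<le> t"
  shows "capped_start t j \<in> borel_measurable (past_algebra t)" "capped_end t j \<in> borel_measurable (past_algebra t)"
proof -
  have *: "capped_end t j \<in> borel_measurable (past_algebra t)" if [measurable]: "capped_start t j \<in> borel_measurable (past_algebra t)" for j
  proof -
    have "(\<lambda>\<omega>. if service_start j \<omega> \<le> t then capped_start t j \<omega> + (if service_start j \<omega> \<le> t then X j \<omega> else 0) else t + 1) \<in> borel_measurable (past_algebra t)"
      by measurable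
    also have "(\<lambda>\<omega>. if service_start j \<omega> \<le> t then capped_start t j \<omega> + (if service_start j \<omega> \<le> t then X j \<omega> else 0) else t + 1) = capped_end t j"
      by (auto simp: capped_start_def capped_end_def service_end_def)
    finally show ?thesis .
  qed
  show "capped_start t j \<in> borel_measurable (past_algebra t)"
  proof (induction j)
    case 0
    show ?case using capped_entry_past[OF t, of 0]
      unfolding capped_start_def[abs_def] capped_entry_def[abs_def] service_start.simps .
  next
    case (Suc j)
    note [measurable] = *[OF Suc] capped_entry_past[OF t]
    let ?v = "\<lambda>\<omega>. max (capped_end t j \<omega>) (capped_entry t (Suc j) \<omega>)"
    have "(\<lambda>\<omega>. if ?v \<omega> \<le> t then ?v \<omega> else t + 1) \<in> borel_measurable (past_algebra t)" by measurable
    moreover have "(if ?v \<omega> \<le> t then ?v \<omega> else t + 1) = capped_start t (Suc j) \<omega>" if "\<omega> \<in> space (past_algebra t)" for \<omega>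
    proof -
      have "\<omega> \<in> space M" using that by simp
      then show ?thesis
        using start_mono[of \<omega> j "Suc j"] start_le_end[of \<omega> j]
        by (auto simp: capped_start_def capped_end_def capped_entry_def service_end_def max_def)
    qed
    ultimately show ?case by (rule measurable_cong[THEN iffD1, rotated])
  qed
  then show "capped_end t j \<in> borel_measurable (past_algebra t)" by (rule *)
qed

lemma end_le_past[measurable]:
  assumes "0 \<le> t" shows "Measurable.pred (past_algebra t) (\<lambda>\<omega>. service_end j \<omega> \<le> t)"
proof -
  note [measurable] = capped_start_end_past[OF assms]
  have "Measurable.pred (past_algebra t) (\<lambda>\<omega>. capped_end t j \<omega> \<le> t)" by measurable
  moreover have "(capped_end t j \<omega> \<le> t) = (service_end j \<omega> \<le> t)" if "\<omega> \<in> space (past_algebra t)" for \<omega>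
    using start_le_end[of \<omega> j] that by (auto simp: capped_end_def)
  ultimately show ?thesis by (rule measurable_cong[THEN iffD1, rotated])
qed

lemma measurable_card_initial_segment:
  fixes P :: "nat \<Rightarrow> 'a \<Rightarrow> bool"
  assumes [measurable]: "\<And>i. Measurable.pred N (P i)"
    and iff: "\<And>\<omega> m. \<omega> \<in> space N \<Longrightarrow> m < card {i. P i \<omega>} \<longleftrightarrow> P m \<omega>"
  shows "(\<lambda>\<omega>. card {i. P i \<omega>}) \<in> measurable N (count_space UNIV)"
proof (rule measurable_count_space_eq_countable[THEN iffD2])
  have "(\<lambda>\<omega>. card {i. P i \<omega>}) -` {n} \<inter> space N \<in> sets N" for n
  proof -
    have "(\<lambda>\<omega>. card {i. P i \<omega>}) -` {n} \<inter> space N = {\<omega> \<in> space N. (\<forall>m<n. P m \<omega>) \<and> \<not> P n \<omega>}"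
    proof -
      have "c = n \<longleftrightarrow> (\<forall>m<n. Q m) \<and> \<not> Q n" if "\<And>m. m < c \<longleftrightarrow> Q m" for c :: nat and Q
        using that by (metis linorder_neqE_nat less_irrefl)
      from this[OF iff] show ?thesis by blast
    qed
    also have "\<dots> \<in> sets N" by measurable
    finally show ?thesis .
  qed
  then show "(\<lambda>\<omega>. card {i. P i \<omega>}) \<in> space N \<rightarrow> UNIV \<and> (\<forall>n\<in>UNIV. (\<lambda>\<omega>. card {i. P i \<omega>}) -` {n} \<inter> space N \<in> sets N)"
    by auto
qed simp

lemma in_system_past[measurable]:
  assumes t: "0 \<le> t" shows "in_system t \<in> measurable (past_algebra t) (count_space UNIV)"
proof -
  have [measurable]: "(\<lambda>\<omega>. card {i. T i \<omega> \<le> t}) \<in> measurable (past_algebra t) (count_space UNIV)"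
    by (rule measurable_card_initial_segment) (auto simp: T_le_iff)
  have [measurable]: "(\<lambda>\<omega>. card {j. service_end j \<omega> \<le> t}) \<in> measurable (past_algebra t) (count_space UNIV)"
    by (rule measurable_card_initial_segment) (auto simp: end_le_iff end_le_past[OF t])
  show ?thesis unfolding in_system_def[abs_def] by measurable
qed

lemma past_mono:
  assumes "0 \<le> s" "s \<le> t" shows "past s \<subseteq> past t"
proof -
  have t: "0 \<le> t" using assms by simp
  note [measurable] = capped_start_end_past[OF t]
  have "{\<omega> \<in> space M. service_start j \<omega> \<le> s \<and> X j \<omega> \<le> x} \<in> past t" for j x
  proof -
    have "{\<omega> \<in> space M. service_start j \<omega> \<le> s \<and> X j \<omega> \<le> x} =
       {\<omega> \<in> space (past_algebra t). capped_start t j \<omega> \<le> s \<and> (if service_start j \<omega> \<le> t then X j \<omega> else 0) \<le> x}"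
      using assms by (auto simp: capped_start_def split: if_splits)
    also have "\<dots> \<in> sets (past_algebra t)" by measurable
    finally show ?thesis by (simp add: sets_past_algebra)
  qed
  moreover have "{\<omega> \<in> space M. T i \<omega> \<le> s'} \<in> past t" if "s' \<le> s" for i s'
    using past_gen(2)[of s' t i] that assms by simp
  ultimately show ?thesis
    unfolding past_def[of s]
    by (subst sets_past_algebra[symmetric], subst space_past_algebra[symmetric, of t], intro sets.sigma_sets_subset)
       (auto simp: sets_past_algebra past_gen)
qed

lemma entry_measurable[measurable]: "entry j \<in> borel_measurable M"
proof -
  note [measurable] = N0_measurable
  have [measurable]: "(\<lambda>\<omega>. T (j - N0 \<omega>) \<omega>) \<in> borel_measurable M"
    by (rule nat_indexed_measurable[where f = T, OF T_measurable]) measurable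
  show ?thesis unfolding entry_def[abs_def] by measurable
qed

lemma service_start_measurable[measurable]: "service_start j \<in> borel_measurable M"
proof (induction j)
  case 0 then show ?case using entry_measurable[of 0] by (simp cong: measurable_cong)
next
  case (Suc j)
  note [measurable] = Suc X_measurable
  have "(\<lambda>\<omega>. max (service_start j \<omega> + X j \<omega>) (entry (Suc j) \<omega>)) \<in> borel_measurable M" by measurable
  then show ?case by (simp cong: measurable_cong)
qed

lemma service_end_measurable[measurable]: "service_end j \<in> borel_measurable M"
proof -
  note [measurable] = X_measurable
  show ?thesis unfolding service_end_def[abs_def] by measurable
qed

lemma subalgebra_past:
  assumes "0 \<le> t" shows "subalgebra M (past_algebra t)"
proof -
  note [measurable] = N0_measurable T_measurable X_measurable
  have "past t \<subseteq> sets M"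
    unfolding past_def by (intro sets.sigma_sets_subset) auto
  then show ?thesis by (simp add: subalgebra_def sets_past_algebra)
qed

lemma past_events: "0 \<le> t \<Longrightarrow> E \<in> past t \<Longrightarrow> E \<in> sets M"
  using subalgebra_past[of t] by (auto simp: subalgebra_def sets_past_algebra)

lemma measurable_from_past: "0 \<le> t \<Longrightarrow> f \<in> measurable (past_algebra t) N \<Longrightarrow> f \<in> measurable M N"
  using subalgebra_past measurable_from_subalg by blast

lemma in_system_measurable[measurable]: "0 \<le> t \<Longrightarrow> in_system t \<in> measurable M (count_space UNIV)"
  by (rule measurable_from_past[OF _ in_system_past])

lemma next_arrival_measurable[measurable]: "next_arrival t \<in> borel_measurable M"
proof -
  note [measurable] = T_measurable
  have [measurable]: "(\<lambda>\<omega>. card {i. T i \<omega> \<le> t}) \<in> measurable M (count_space UNIV)"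
    by (rule measurable_card_initial_segment) (auto simp: T_le_iff)
  show ?thesis
    unfolding next_arrival_def[abs_def] by (rule nat_indexed_measurable[where f = T, OF T_measurable]) measurable
qed

lemma completed_before_measurable[measurable]: "completed_before i \<in> measurable M (count_space UNIV)"
proof -
  note [measurable] = T_measurable
  show ?thesis unfolding completed_before_def[abs_def]
    by (rule measurable_card_initial_segment) (auto simp: completed_iff[unfolded completed_before_def])
qed

lemma found_measurable[measurable]: "found i \<in> measurable M (count_space UNIV)"
proof -
  note [measurable] = N0_measurable
  show ?thesis unfolding found_def[abs_def] by measurable
qed

end

section \<open>Arrivals after a fixed time\<close>

text \<open>
  The absence of atoms turns pointwise convergence of the indicators into almost sure convergence.
\<close>

lemma (in prob_space) continuous_on_prob_le:
  fixes S :: "'a \<Rightarrow> real"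
  assumes S[measurable]: "S \<in> borel_measurable M" and A[measurable]: "A \<in> sets M"
    and no_atom: "\<And>u. a \<le> u \<Longrightarrow> AE \<omega> in M. S \<omega> \<noteq> u"
  shows "continuous_on {a..b} (\<lambda>u. prob (A \<inter> {\<omega> \<in> space M. S \<omega> \<le> u}))"
  unfolding continuous_on_sequentially
proof (intro allI ballI impI)
  fix v u assume u: "u \<in> {a..b}" and v: "(\<forall>n. v n \<in> {a..b}) \<and> v \<longlonglongrightarrow> u"
  have "(\<lambda>n. LINT \<omega>|M. indicat_real (A \<inter> {\<omega> \<in> space M. S \<omega> \<le> v n}) \<omega>) \<longlonglongrightarrow>
    (LINT \<omega>|M. indicat_real (A \<inter> {\<omega> \<in> space M. S \<omega> \<le> u}) \<omega>)"
  proof (rule integral_dominated_convergence[where w = "\<lambda>_. 1"])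
    have "AE \<omega> in M. S \<omega> \<noteq> u" using no_atom[of u] u by auto
    then show "AE \<omega> in M. (\<lambda>n. indicat_real (A \<inter> {\<omega> \<in> space M. S \<omega> \<le> v n}) \<omega>) \<longlonglongrightarrow>
        indicat_real (A \<inter> {\<omega> \<in> space M. S \<omega> \<le> u}) \<omega>"
    proof eventually_elim
      case (elim \<omega>)
      have "eventually (\<lambda>n. (S \<omega> \<le> v n) = (S \<omega> \<le> u)) sequentially"
      proof (cases "S \<omega> < u")
        case True
        with v have "eventually (\<lambda>n. S \<omega> < v n) sequentially" by (auto dest: order_tendstoD)
        then show ?thesis by eventually_elim (use True in auto)
      next
        case False
        with elim have "u < S \<omega>" by simp
        with v have "eventually (\<lambda>n. v n < S \<omega>) sequentially" by (auto dest: order_tendstoD)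
        then show ?thesis by eventually_elim (use False elim in auto)
      qed
      then show ?case
        by (intro tendsto_eventually) (auto elim!: eventually_mono simp: indicator_def)
    qed
  qed (auto simp: indicator_def)
  then show "((\<lambda>u. prob (A \<inter> {\<omega> \<in> space M. S \<omega> \<le> u})) \<circ> v) \<longlonglongrightarrow> prob (A \<inter> {\<omega> \<in> space M. S \<omega> \<le> u})"
    by (simp add: comp_def)
qed

text \<open>
  Identities that hold for each value of a discrete random variable hold in total; this glues the
  cells of the time grids.
\<close>

lemma (in prob_space) set_integral_eq_by_countable_partition:
  fixes f g :: "'a \<Rightarrow> real" and \<kappa> :: "'a \<Rightarrow> 'c :: countable"
  assumes f: "integrable M f" and g: "integrable M g" and E[measurable]: "E \<in> sets M"
    and \<kappa>[measurable]: "\<kappa> \<in> measurable M (count_space UNIV)"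
    and eq: "\<And>c. (LINT \<omega>:E \<inter> {\<omega> \<in> space M. \<kappa> \<omega> = c}|M. f \<omega>) = (LINT \<omega>:E \<inter> {\<omega> \<in> space M. \<kappa> \<omega> = c}|M. g \<omega>)"
  shows "(LINT \<omega>:E|M. f \<omega>) = (LINT \<omega>:E|M. g \<omega>)"
proof -
  define A where "A i = E \<inter> {\<omega> \<in> space M. to_nat (\<kappa> \<omega>) = i}" for i
  have UN: "(\<Union>i. A i) = E" using sets.sets_into_space[OF E] by (auto simp: A_def)
  have A_meas: "A i \<in> sets M" for i unfolding A_def by measurable
  have sum: "(LINT \<omega>:E|M. h \<omega>) = (\<Sum>i. LINT \<omega>:A i|M. h \<omega>)" if h: "integrable M h" for h :: "'a \<Rightarrow> real"
  proof -
    have "set_integrable M (\<Union>i. A i) h"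
      unfolding UN set_integrable_def using integrable_mult_indicator[OF E h] by simp
    then show ?thesis
      using lebesgue_integral_countable_add[of A M h] A_meas UN by (auto simp: A_def)
  qed
  have "(LINT \<omega>:A i|M. f \<omega>) = (LINT \<omega>:A i|M. g \<omega>)" for i
  proof (cases "i \<in> range (to_nat :: 'c \<Rightarrow> nat)")
    case True
    then obtain c :: 'c where "i = to_nat c" by auto
    then have "A i = E \<inter> {\<omega> \<in> space M. \<kappa> \<omega> = c}" by (auto simp: A_def)
    then show ?thesis using eq by simp
  next
    case False
    then have "A i = {}" by (auto simp: A_def)
    then show ?thesis by (simp add: set_lebesgue_integral_def)
  qed
  then show ?thesis using sum[OF f] sum[OF g] by simp
qed

context single_server_queue
begin

lemma arrivals_measurable[measurable]: "arrivals t u \<in> measurable M (count_space UNIV)"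
proof -
  note [measurable] = T_measurable
  have [measurable]: "(\<lambda>\<omega>. card {i. T i \<omega> \<le> u}) \<in> measurable M (count_space UNIV)"
    by (rule measurable_card_initial_segment) (auto simp: T_le_iff)
  have fin: "finite {i. T i \<omega> < t}" if "\<omega> \<in> space M" for \<omega>
    by (rule finite_subset[OF _ finite_T_le[OF that, of t]]) auto
  have [measurable]: "(\<lambda>\<omega>. card {i. T i \<omega> < t}) \<in> measurable M (count_space UNIV)"
    by (rule measurable_card_initial_segment)
      (auto intro!: less_card_initial_segment fin intro: le_less_trans[OF T_monoD])
  have "(\<lambda>\<omega>. card {i. T i \<omega> \<le> u} - card {i. T i \<omega> < t}) \<in> measurable M (count_space UNIV)" by measurable
  moreover have "card {i. T i \<omega> \<le> u} - card {i. T i \<omega> < t} = arrivals t u \<omega>" if "\<omega> \<in> space M" for \<omega>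
  proof (cases "t \<le> u")
    case True
    have eq: "{i. t \<le> T i \<omega> \<and> T i \<omega> \<le> u} = {i. T i \<omega> \<le> u} - {i. T i \<omega> < t}" by auto
    have "{i. T i \<omega> < t} \<subseteq> {i. T i \<omega> \<le> u}" using True by auto
    then show ?thesis unfolding arrivals_def eq
      by (rule card_Diff_subset[OF fin[OF that], symmetric])
  next
    case False
    then have eq: "{i. t \<le> T i \<omega> \<and> T i \<omega> \<le> u} = {}" and sub: "{i. T i \<omega> \<le> u} \<subseteq> {i. T i \<omega> < t}" by auto
    show ?thesis unfolding arrivals_def eq using card_mono[OF fin[OF that] sub] by simp
  qed
  ultimately show ?thesis by (rule measurable_cong[THEN iffD1, rotated])
qed

lemma in_system_in_progress:
  assumes \<omega>: "\<omega> \<in> space M" and "service_start j \<omega> \<le> t" "t < service_end j \<omega>"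
  shows "in_system t \<omega> = N0 \<omega> + card {i. T i \<omega> \<le> t} - j"
proof -
  have "service_end m \<omega> \<le> t \<longleftrightarrow> m < j" for m
  proof (cases "m < j")
    case True
    then show ?thesis using end_le_start[OF \<omega> True] assms(2) by simp
  next
    case False
    then have "service_end j \<omega> \<le> service_end m \<omega>" by (intro end_mono[OF \<omega>]) simp
    then show ?thesis using False assms(3) by simp
  qed
  then have "{m. service_end m \<omega> \<le> t} = {..<j}" by auto
  then show ?thesis by (simp add: in_system_def)
qed

text \<open>
  During a sojourn the number of customers is constant.
\<close>

lemma in_system_until_next_event:
  assumes \<omega>: "\<omega> \<in> space M" and "service_start j \<omega> \<le> t" "t \<le> u" "u < service_end j \<omega>" "u < next_arrival t \<omega>"
  shows "in_system u \<omega> = in_system t \<omega>"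
  using in_system_in_progress[OF \<omega>, of j t] in_system_in_progress[OF \<omega>, of j u]
    next_arrival_eq[OF \<omega>, of t u] assms by simp

lemma start_less_of_found_pos:
  assumes \<omega>: "\<omega> \<in> space M" and pos: "0 < T 0 \<omega>" and strict: "\<And>i. T i \<omega> < T (Suc i) \<omega>"
    and found: "0 < found i \<omega>"
  shows "service_start (completed_before i \<omega>) \<omega> < T i \<omega>"
proof -
  define c where "c = completed_before i \<omega>"
  have smono: "T k \<omega> < T i \<omega>" if "k < i" for k i
    using strict that by (rule lift_Suc_mono_less)
  have c: "c < N0 \<omega> + i" using found by (simp add: found_def c_def)
  have Ti: "0 < T i \<omega>" using pos T_monoD[OF \<omega>, of 0 i] by simp
  have "entry c \<omega> < T i \<omega>"
    using c Ti by (auto simp: entry_def intro!: smono)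
  moreover have "service_end c' \<omega> < T i \<omega>" if "c' < c" for c'
    using that completed_iff[OF \<omega>, of c' i] by (simp add: c_def)
  ultimately have "service_start c \<omega> < T i \<omega>"
    by (cases c) (auto simp: service_end_def)
  then show ?thesis by (simp add: c_def)
qed

lemma next_arrival_between:
  assumes \<omega>: "\<omega> \<in> space M" and "\<And>k. k < i \<Longrightarrow> T k \<omega> \<le> t" "t < T i \<omega>"
  shows "next_arrival t \<omega> = T i \<omega>"
proof -
  have "T m \<omega> \<le> t \<longleftrightarrow> m < i" for m
    using assms T_monoD[OF \<omega>, of i m] by (cases "m < i") auto
  then have "{m. T m \<omega> \<le> t} = {..<i}" by auto
  then show ?thesis by (simp add: next_arrival_def)
qed

end

context MnGn1_queue
begin

text \<open>
  One arrival and at least two arrivals are lumped together; the latter do not contribute to the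
  limit.
\<close>

lemma arrival_rate_aux:
  assumes t: "0 \<le> t" and E: "E \<in> past t"
  shows "((\<lambda>d. prob (E \<inter> {\<omega> \<in> space M. in_system t \<omega> = n \<and> (\<exists>i. t \<le> T i \<omega> \<and> T i \<omega> \<le> t + d)}) / d)
     \<longlongrightarrow> lam n * prob (E \<inter> {\<omega> \<in> space M. in_system t \<omega> = n})) (at_right 0)"
proof -
  have EM[measurable]: "E \<in> sets M" using past_events[OF t E] .
  note [measurable] = in_system_measurable[OF t]
  have "prob (E \<inter> {\<omega> \<in> space M. in_system t \<omega> = n \<and> (\<exists>i. t \<le> T i \<omega> \<and> T i \<omega> \<le> t + d)}) =
     prob (E \<inter> {\<omega> \<in> space M. in_system t \<omega> = n \<and> arrivals t (t + d) \<omega> = 1}) +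
     prob (E \<inter> {\<omega> \<in> space M. in_system t \<omega> = n \<and> arrivals t (t + d) \<omega> \<ge> 2})" (is "prob ?A = prob ?B + prob ?C") for d
  proof -
    have B: "?B \<in> sets M" by (intro sets.Int[OF EM]) measurable
    have C: "?C \<in> sets M" by (intro sets.Int[OF EM]) measurable
    have "(\<exists>i. t \<le> T i \<omega> \<and> T i \<omega> \<le> t + d) \<longleftrightarrow> arrivals t (t + d) \<omega> = 1 \<or> arrivals t (t + d) \<omega> \<ge> 2"
      if "\<omega> \<in> space M" for \<omega>
      using arrivals_pos_iff[OF that, of t "t + d"] by auto
    then have eq: "?A = ?B \<union> ?C" by blast
    have "?B \<inter> ?C = {}" by auto
    then show ?thesis unfolding eq by (rule finite_measure_Union[OF B C])
  qed
  moreover have "((\<lambda>d. prob (E \<inter> {\<omega> \<in> space M. in_system t \<omega> = n \<and> arrivals t (t + d) \<omega> = 1}) / d +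
     prob (E \<inter> {\<omega> \<in> space M. in_system t \<omega> = n \<and> arrivals t (t + d) \<omega> \<ge> 2}) / d)
     \<longlongrightarrow> lam n * prob (E \<inter> {\<omega> \<in> space M. in_system t \<omega> = n}) + 0) (at_right 0)"
    by (intro tendsto_add one_arrival more_arrivals t E)
  ultimately show ?thesis by (simp add: add_divide_distrib)
qed

text \<open>
  The hypotheses concern closed intervals, which contain an arrival at \<open>t\<close> itself.  In each state, its
  probability is below a multiple of the length \<open>d\<close>, for every small \<open>d\<close>.
\<close>

lemma no_arrival_at_fixed_time:
  assumes t: "0 \<le> t"
  shows "AE \<omega> in M. \<forall>i. T i \<omega> \<noteq> t"
proof -
  note [measurable] = in_system_measurable[OF t] T_measurable
  have "AE \<omega> in M. \<not> (in_system t \<omega> = n \<and> (\<exists>i. T i \<omega> = t))" for n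
  proof -
    define p where "p d = prob (space M \<inter> {\<omega> \<in> space M. in_system t \<omega> = n \<and> (\<exists>i. t \<le> T i \<omega> \<and> T i \<omega> \<le> t + d)})" for d
    have S: "space M \<in> past t" using sets.top[of "past_algebra t"] by (simp add: sets_past_algebra)
    have "((\<lambda>d. p d / d * d) \<longlongrightarrow> lam n * prob (space M \<inter> {\<omega> \<in> space M. in_system t \<omega> = n}) * 0) (at_right 0)"
      unfolding p_def by (intro tendsto_mult arrival_rate_aux t S tendsto_ident_at)
    then have "((\<lambda>d. p d / d * d) \<longlongrightarrow> 0) (at_right 0)" by simp
    then have lim: "(p \<longlongrightarrow> 0) (at_right 0)"
      by (rule Lim_transform_eventually) (auto simp: eventually_at_right_field intro!: exI[of _ 1])
    have "prob {\<omega> \<in> space M. in_system t \<omega> = n \<and> (\<exists>i. T i \<omega> = t)} \<le> 0"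
    proof (rule tendsto_lowerbound[OF lim])
      show "\<forall>\<^sub>F d in at_right 0. prob {\<omega> \<in> space M. in_system t \<omega> = n \<and> (\<exists>i. T i \<omega> = t)} \<le> p d"
        unfolding p_def eventually_at_right_field
        by (intro exI[of _ 1] conjI allI impI finite_measure_mono) (auto intro: exI)
    qed simp
    then have "prob {\<omega> \<in> space M. in_system t \<omega> = n \<and> (\<exists>i. T i \<omega> = t)} = 0"
      by (simp add: measure_le_0_iff)
    then show ?thesis by (subst (asm) prob_eq_0) auto
  qed
  then have "AE \<omega> in M. \<forall>n. \<not> (in_system t \<omega> = n \<and> (\<exists>i. T i \<omega> = t))"
    unfolding AE_all_countable by blast
  then show ?thesis by eventually_elim auto
qed

lemma next_arrival_no_atom: "0 \<le> u \<Longrightarrow> AE \<omega> in M. next_arrival t \<omega> \<noteq> u"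
  using no_arrival_at_fixed_time[of u] by (auto simp: next_arrival_def)

text \<open>
  The form in which the arrival hypotheses are used: half-open intervals, and a state that is fixed
  almost surely on the event.
\<close>

lemma arrival_rate:
  assumes t: "0 \<le> t" and E: "E \<in> past t" and n: "AE \<omega> in M. \<omega> \<in> E \<longrightarrow> in_system t \<omega> = n"
  shows "((\<lambda>d. prob (E \<inter> {\<omega> \<in> space M. \<exists>i. t < T i \<omega> \<and> T i \<omega> \<le> t + d}) / d)
     \<longlongrightarrow> lam n * prob E) (at_right 0)"
proof -
  have EM[measurable]: "E \<in> sets M" using past_events[OF t E] .
  note [measurable] = in_system_measurable[OF t] T_measurable
  have "prob (E \<inter> {\<omega> \<in> space M. in_system t \<omega> = n}) = prob E"
  proof (rule finite_measure_eq_AE)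
    show "AE x in M. (x \<in> E \<inter> {\<omega> \<in> space M. in_system t \<omega> = n}) = (x \<in> E)"
      using n by (auto elim!: eventually_mono intro: AE_mp)
  qed (auto intro!: sets.Int)
  moreover have "prob (E \<inter> {\<omega> \<in> space M. in_system t \<omega> = n \<and> (\<exists>i. t \<le> T i \<omega> \<and> T i \<omega> \<le> t + d)}) =
     prob (E \<inter> {\<omega> \<in> space M. \<exists>i. t < T i \<omega> \<and> T i \<omega> \<le> t + d})" for d
  proof (rule finite_measure_eq_AE)
    show "AE x in M. (x \<in> E \<inter> {\<omega> \<in> space M. in_system t \<omega> = n \<and> (\<exists>i. t \<le> T i \<omega> \<and> T i \<omega> \<le> t + d)}) =
      (x \<in> E \<inter> {\<omega> \<in> space M. \<exists>i. t < T i \<omega> \<and> T i \<omega> \<le> t + d})"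
      using n no_arrival_at_fixed_time[OF t]
      by eventually_elim (auto simp: less_le)
  qed (auto intro!: sets.Int)
  ultimately show ?thesis using arrival_rate_aux[OF t E, of n] by simp
qed

text \<open>
  With $\psi$ the probability that no arrival has occurred by \<open>u\<close>, the arrival hypotheses give
  $\psi' = - \lambda \psi$ as a right derivative.  So $e^{\lambda u} \psi(u)$ has right derivative 0.
\<close>

lemma prob_no_arrival:
  assumes t: "0 \<le> t" and tv: "t \<le> v" and E: "E \<in> past t"
    and n: "\<And>u. t \<le> u \<Longrightarrow> u < v \<Longrightarrow> AE \<omega> in M. \<omega> \<in> E \<and> u < next_arrival t \<omega> \<longrightarrow> in_system u \<omega> = n"
  shows "prob (E \<inter> {\<omega> \<in> space M. v < next_arrival t \<omega>}) = exp (- lam n * (v - t)) * prob E"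
proof -
  have EM[measurable]: "E \<in> sets M" using past_events[OF t E] .
  note [measurable] = T_measurable
  define \<psi> where "\<psi> u = prob (E \<inter> {\<omega> \<in> space M. u < next_arrival t \<omega>})" for u
  have \<psi>: "\<psi> u = prob E - prob (E \<inter> {\<omega> \<in> space M. next_arrival t \<omega> \<le> u})" for u
  proof -
    have eq: "E \<inter> {\<omega> \<in> space M. u < next_arrival t \<omega>} = E - E \<inter> {\<omega> \<in> space M. next_arrival t \<omega> \<le> u}"
      using sets.sets_into_space[OF EM] by auto
    show ?thesis unfolding \<psi>_def eq by (rule finite_measure_Diff) auto
  qed
  \<comment> \<open>The exponential factor compensates the decay of \<open>\<psi>\<close>.\<close>
  define f where "f u = exp (lam n * (u - t)) * \<psi> u" for u
  have "f v = f t"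
  proof (rule zero_right_derivative_imp_eq[OF tv])
    have "continuous_on {t..v} (\<lambda>u. prob (E \<inter> {\<omega> \<in> space M. next_arrival t \<omega> \<le> u}))"
      using t by (intro continuous_on_prob_le next_arrival_no_atom) auto
    then show "continuous_on {t..v} f"
      unfolding f_def \<psi> by (intro continuous_intros)
  next
    fix u assume u: "t \<le> u" "u < v"
    define A where "A = E \<inter> {\<omega> \<in> space M. u < next_arrival t \<omega>}"
    have u0: "0 \<le> u" using t u by simp
    have A: "A \<in> past u"
    proof -
      have E': "E \<in> sets (past_algebra u)" using past_mono[OF t u(1)] E by (auto simp: sets_past_algebra)
      have [measurable]: "Measurable.pred (past_algebra u) (\<lambda>\<omega>. T i \<omega> \<le> t)" for i
        unfolding pred_past_iff by (rule past_gen(2)) (use u in simp)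
      have "{\<omega> \<in> space (past_algebra u). \<forall>i. T i \<omega> \<le> t \<or> \<not> T i \<omega> \<le> u} \<in> sets (past_algebra u)" by measurable
      then have "E \<inter> {\<omega> \<in> space (past_algebra u). \<forall>i. T i \<omega> \<le> t \<or> \<not> T i \<omega> \<le> u} \<in> sets (past_algebra u)"
        using E' by blast
      also have "E \<inter> {\<omega> \<in> space (past_algebra u). \<forall>i. T i \<omega> \<le> t \<or> \<not> T i \<omega> \<le> u} = A"
        using less_next_arrival_iff[OF _ u(1)] by (auto simp: A_def not_le)
      finally show ?thesis by (simp add: sets_past_algebra)
    qed
    have AM[measurable]: "A \<in> sets M" using past_events[OF u0 A] .
    have rate: "((\<lambda>d. prob (A \<inter> {\<omega> \<in> space M. \<exists>i. u < T i \<omega> \<and> T i \<omega> \<le> u + d}) / d) \<longlongrightarrow> lam n * \<psi> u) (at_right 0)"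
      using arrival_rate[OF u0 A, of n] n[OF u] by (auto simp: A_def \<psi>_def)
    have diff: "\<psi> (u + d) - \<psi> u = - prob (A \<inter> {\<omega> \<in> space M. \<exists>i. u < T i \<omega> \<and> T i \<omega> \<le> u + d})" if "0 < d" for d
    proof -
      have iff: "(\<exists>i. u < T i \<omega> \<and> T i \<omega> \<le> u + d) \<longleftrightarrow> next_arrival t \<omega> \<le> u + d"
        if "\<omega> \<in> space M" "u < next_arrival t \<omega>" for \<omega>
        using next_arrival_le[OF that(1), of t] u that(2) unfolding next_arrival_def
        by (meson le_less_trans order_trans)
      then have eq: "E \<inter> {\<omega> \<in> space M. u + d < next_arrival t \<omega>} = A - A \<inter> {\<omega> \<in> space M. \<exists>i. u < T i \<omega> \<and> T i \<omega> \<le> u + d}"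
      proof -
        have "u + d < next_arrival t \<omega> \<longleftrightarrow> u < next_arrival t \<omega> \<and> \<not> (\<exists>i. u < T i \<omega> \<and> T i \<omega> \<le> u + d)"
          if "\<omega> \<in> space M" for \<omega>
          using iff[OF that] \<open>0 < d\<close> by (cases "u < next_arrival t \<omega>") (auto simp: not_le)
        then show ?thesis
          unfolding A_def using sets.sets_into_space[OF EM] by blast
      qed
      have "\<psi> (u + d) = prob A - prob (A \<inter> {\<omega> \<in> space M. \<exists>i. u < T i \<omega> \<and> T i \<omega> \<le> u + d})"
        unfolding \<psi>_def eq by (rule finite_measure_Diff) auto
      then show ?thesis by (simp add: \<psi>_def A_def)
    qed
    have e: "((\<lambda>d. exp (lam n * d)) \<longlongrightarrow> exp (lam n * 0)) (at_right 0)"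
      by (intro tendsto_intros)
    have e': "((\<lambda>d. (exp (lam n * d) - 1) / d) \<longlongrightarrow> lam n) (at_right 0)"
    proof -
      have "((\<lambda>d. exp (lam n * d)) has_real_derivative lam n) (at 0)"
        by (auto intro!: derivative_eq_intros)
      then have "((\<lambda>d. (exp (lam n * d) - 1) / d) \<longlongrightarrow> lam n) (at 0)"
        by (simp add: DERIV_def)
      then show ?thesis by (rule tendsto_mono[rotated]) (simp add: at_le)
    qed
    have L: "((\<lambda>d. exp (lam n * (u - t)) * (exp (lam n * d) * - (prob (A \<inter> {\<omega> \<in> space M. \<exists>i. u < T i \<omega> \<and> T i \<omega> \<le> u + d}) / d)
        + \<psi> u * ((exp (lam n * d) - 1) / d))) \<longlongrightarrow>
       exp (lam n * (u - t)) * (exp (lam n * 0) * - (lam n * \<psi> u) + \<psi> u * lam n)) (at_right 0)"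
      by (intro tendsto_intros rate e e')
    have quotient: "exp (lam n * (u - t)) * (exp (lam n * d) * - (prob (A \<inter> {\<omega> \<in> space M. \<exists>i. u < T i \<omega> \<and> T i \<omega> \<le> u + d}) / d)
        + \<psi> u * ((exp (lam n * d) - 1) / d)) = (f (u + d) - f u) / d" if "0 < d" for d
    proof -
      define P where "P = prob (A \<inter> {\<omega> \<in> space M. \<exists>i. u < T i \<omega> \<and> T i \<omega> \<le> u + d})"
      have "f (u + d) = exp (lam n * (u - t)) * exp (lam n * d) * \<psi> (u + d)"
        unfolding f_def exp_add[symmetric] by (simp add: algebra_simps)
      also have "\<psi> (u + d) = \<psi> u - P" using diff[OF that] by (simp add: P_def)
      finally have fd: "f (u + d) = exp (lam n * (u - t)) * exp (lam n * d) * (\<psi> u - P)" .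
      have alg: "a * (b * - (p / d) + w * ((b - 1) / d)) = (a * b * (w - p) - a * w) / d" for a b p w :: real
        using that by (simp add: divide_simps) (simp add: algebra_simps)
      show ?thesis unfolding P_def[symmetric] fd f_def[of u] by (rule alg)
    qed
    have "((\<lambda>d. (f (u + d) - f u) / d) \<longlongrightarrow>
       exp (lam n * (u - t)) * (exp (lam n * 0) * - (lam n * \<psi> u) + \<psi> u * lam n)) (at_right 0)"
      by (rule Lim_transform_eventually[OF L], unfold eventually_at_right_field)
        (intro exI[of _ 1] conjI allI impI quotient, simp_all)
    then show "((\<lambda>d. (f (u + d) - f u) / d) \<longlongrightarrow> 0) (at_right 0)" by simp
  qed
  moreover have "\<psi> t = prob E"
    unfolding \<psi>_def using sets.sets_into_space[OF EM] by (intro arg_cong[where f = prob]) (auto intro: next_arrival_gt)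
  ultimately have "exp (lam n * (v - t)) * \<psi> v = prob E" by (simp add: f_def)
  then have "exp (- lam n * (v - t)) * prob E = exp (- lam n * (v - t)) * exp (lam n * (v - t)) * \<psi> v"
    by simp
  also have "exp (- lam n * (v - t)) * exp (lam n * (v - t)) = 1"
    unfolding exp_add[symmetric] by simp
  finally show ?thesis by (simp add: \<psi>_def)
qed

text \<open>
  The probability of a coincidence of two given arrivals before \<open>u\<close> has right derivative 0 in \<open>u\<close>.  The
  bounds on two or more arrivals hold for each state separately; restricting the initial number of
  customers leaves finitely many states before arrival \<open>i\<close>, and the bounds can be added.
\<close>

lemma arrivals_strictly_increasing: "AE \<omega> in M. 0 < T 0 \<omega> \<and> (\<forall>i. T i \<omega> < T (Suc i) \<omega>)"
proof -
  note [measurable] = T_measurable N0_measurable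
  have zero: "prob ({\<omega> \<in> space M. N0 \<omega> \<le> K \<and> T i \<omega> = T (Suc i) \<omega>} \<inter> {\<omega> \<in> space M. T i \<omega> \<le> b}) = 0"
    if b: "0 \<le> b" for K i b
  proof -
    define A where "A = {\<omega> \<in> space M. N0 \<omega> \<le> K \<and> T i \<omega> = T (Suc i) \<omega>}"
    have A[measurable]: "A \<in> sets M" unfolding A_def by measurable
    define f where "f u = prob (A \<inter> {\<omega> \<in> space M. T i \<omega> \<le> u})" for u
    have "f b = f 0"
    proof (rule zero_right_derivative_imp_eq[OF b])
      show "continuous_on {0..b} f"
        unfolding f_def
      proof (intro continuous_on_prob_le)
        show "AE \<omega> in M. T i \<omega> \<noteq> u" if "0 \<le> u" for u
          using no_arrival_at_fixed_time[OF that] by eventually_elim auto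
      qed auto
    next
      fix u assume u: "0 \<le> u" "u < b"
      note [measurable] = in_system_measurable[OF u(1)]
      define E where "E = {\<omega> \<in> space M. N0 \<omega> \<le> K}"
      have E: "E \<in> past u" unfolding E_def pred_past_iff[symmetric] by measurable
      have EM[measurable]: "E \<in> sets M" by (rule past_events[OF u(1) E])
      define g where "g n d = prob (E \<inter> {\<omega> \<in> space M. in_system u \<omega> = n \<and> arrivals u (u + d) \<omega> \<ge> 2})" for n d
      have g: "((\<lambda>d. \<Sum>n\<le>K+i. g n d / d) \<longlongrightarrow> (\<Sum>n\<le>K+i. 0)) (at_right 0)"
        unfolding g_def by (intro tendsto_sum more_arrivals u E)
      have bound: "0 \<le> f (u + d) - f u \<and> f (u + d) - f u \<le> (\<Sum>n\<le>K+i. g n d)" if d: "0 < d" for d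
      proof -
        have "f (u + d) - f u = prob (A \<inter> {\<omega> \<in> space M. T i \<omega> \<le> u + d} - A \<inter> {\<omega> \<in> space M. T i \<omega> \<le> u})"
          unfolding f_def by (subst finite_measure_Diff) (use d in auto)
        moreover have "prob (A \<inter> {\<omega> \<in> space M. T i \<omega> \<le> u + d} - A \<inter> {\<omega> \<in> space M. T i \<omega> \<le> u})
           \<le> prob (\<Union>n\<in>{..K+i}. E \<inter> {\<omega> \<in> space M. in_system u \<omega> = n \<and> arrivals u (u + d) \<omega> \<ge> 2})"
        proof (rule finite_measure_mono)
          show "A \<inter> {\<omega> \<in> space M. T i \<omega> \<le> u + d} - A \<inter> {\<omega> \<in> space M. T i \<omega> \<le> u}
            \<subseteq> (\<Union>n\<in>{..K+i}. E \<inter> {\<omega> \<in> space M. in_system u \<omega> = n \<and> arrivals u (u + d) \<omega> \<ge> 2})"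
          proof
            fix \<omega> assume w: "\<omega> \<in> A \<inter> {\<omega> \<in> space M. T i \<omega> \<le> u + d} - A \<inter> {\<omega> \<in> space M. T i \<omega> \<le> u}"
            then have \<omega>: "\<omega> \<in> space M" "u < T i \<omega>" "T i \<omega> \<le> u + d" "N0 \<omega> \<le> K" "T i \<omega> = T (Suc i) \<omega>"
              by (auto simp: A_def)
            have "card {k. T k \<omega> \<le> u} \<le> i" using T_le_iff[OF \<omega>(1), of i u] \<omega>(2) by simp
            then have "in_system u \<omega> \<le> K + i" using \<omega>(4) by (simp add: in_system_def)
            moreover have "2 \<le> arrivals u (u + d) \<omega>"
            proof -
              have "finite {k. u \<le> T k \<omega> \<and> T k \<omega> \<le> u + d}"
                by (rule finite_subset[OF _ finite_T_le[OF \<omega>(1), of "u + d"]]) auto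
              then have "card {i, Suc i} \<le> arrivals u (u + d) \<omega>"
                unfolding arrivals_def by (rule card_mono) (use \<omega> in auto)
              then show ?thesis by simp
            qed
            ultimately show "\<omega> \<in> (\<Union>n\<in>{..K+i}. E \<inter> {\<omega> \<in> space M. in_system u \<omega> = n \<and> arrivals u (u + d) \<omega> \<ge> 2})"
              using \<omega> by (auto simp: E_def)
          qed
        qed (auto intro!: sets.Int sets.finite_UN)
        moreover have "\<dots> \<le> (\<Sum>n\<le>K+i. g n d)"
          unfolding g_def by (rule finite_measure_subadditive_finite) (auto intro!: sets.Int)
        ultimately show ?thesis by simp
      qed
      show "((\<lambda>d. (f (u + d) - f u) / d) \<longlongrightarrow> 0) (at_right 0)"
      proof (rule tendsto_sandwich[OF _ _ tendsto_const])
        show "\<forall>\<^sub>F d in at_right 0. 0 \<le> (f (u + d) - f u) / d"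
          using bound by (auto simp: eventually_at_right_field intro!: exI[of _ 1])
        show "\<forall>\<^sub>F d in at_right 0. (f (u + d) - f u) / d \<le> (\<Sum>n\<le>K+i. g n d / d)"
          using bound by (auto simp: eventually_at_right_field sum_divide_distrib[symmetric] intro!: exI[of _ 1] divide_right_mono)
        show "((\<lambda>d. \<Sum>n\<le>K+i. g n d / d) \<longlongrightarrow> 0) (at_right 0)" using g by simp
      qed
    qed
    also have "f 0 = 0"
    proof -
      have "AE \<omega> in M. \<omega> \<notin> A \<inter> {\<omega> \<in> space M. T i \<omega> \<le> 0}"
        using no_arrival_at_fixed_time[OF order_refl] AE_space
      proof eventually_elim
        case (elim \<omega>)
        then show ?case using T_nonneg[OF elim(2), of i] by (auto simp: order.antisym)
      qed
      then show ?thesis unfolding f_def by (subst prob_eq_0) auto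
    qed
    finally show ?thesis by (simp add: f_def A_def)
  qed
  have "AE \<omega> in M. \<omega> \<notin> {\<omega> \<in> space M. N0 \<omega> \<le> K \<and> T i \<omega> = T (Suc i) \<omega>} \<inter> {\<omega> \<in> space M. T i \<omega> \<le> real b}" for K i b
  proof -
    have "prob ({\<omega> \<in> space M. N0 \<omega> \<le> K \<and> T i \<omega> = T (Suc i) \<omega>} \<inter> {\<omega> \<in> space M. T i \<omega> \<le> real b}) = 0"
      by (rule zero) simp
    then show ?thesis by (subst (asm) prob_eq_0) auto
  qed
  then have "AE \<omega> in M. \<forall>K i b. \<omega> \<notin> {\<omega> \<in> space M. N0 \<omega> \<le> K \<and> T i \<omega> = T (Suc i) \<omega>} \<inter> {\<omega> \<in> space M. T i \<omega> \<le> real b}"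
    unfolding AE_all_countable by blast
  then show ?thesis
    using no_arrival_at_fixed_time[OF order_refl] AE_space
  proof eventually_elim
    case (elim \<omega>)
    have "T i \<omega> \<noteq> T (Suc i) \<omega>" for i
      using elim(1)[rule_format, of "N0 \<omega>" i "nat \<lceil>T i \<omega>\<rceil>"] elim(3) by (auto simp: real_nat_ceiling_ge)
    then show ?case
      using T_monoD[OF elim(3)] T_nonneg[OF elim(3)] elim(2) by (metis le_SucI less_le order_refl)
  qed
qed

text \<open>
  The end of a service in progress is known in advance.  For an arrival in \<open>(u, u + d]\<close> to hit it, it must
  lie in the window \<open>(u, u + d]\<close>, which is an event of the past at \<open>u\<close> of arbitrarily small probability; the
  arrival contributes the factor \<open>d\<close>.  So the probability of a coincidence before \<open>u\<close> has right
  derivative 0.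
\<close>

lemma no_arrival_at_service_end:
  assumes t: "0 \<le> t"
  shows "AE \<omega> in M. \<not> (service_start j \<omega> \<le> t \<and> t < service_end j \<omega> \<and> in_system t \<omega> = n \<and> next_arrival t \<omega> = service_end j \<omega>)"
proof -
  note [measurable] = T_measurable in_system_measurable[OF t]
  define E where "E = {\<omega> \<in> space M. service_start j \<omega> \<le> t \<and> t < service_end j \<omega> \<and> in_system t \<omega> = n}"
  have EM[measurable]: "E \<in> sets M" unfolding E_def by measurable
  define A where "A = E \<inter> {\<omega> \<in> space M. next_arrival t \<omega> = service_end j \<omega>}"
  have AM[measurable]: "A \<in> sets M" unfolding A_def by measurable
  define f where "f u = prob (A \<inter> {\<omega> \<in> space M. next_arrival t \<omega> \<le> u})" for u
  have ft: "f t = 0"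
  proof -
    have "A \<inter> {\<omega> \<in> space M. next_arrival t \<omega> \<le> t} = {}"
      using next_arrival_gt[of _ t] by (auto simp: not_le[symmetric])
    then show ?thesis by (simp add: f_def)
  qed
  have zero: "f b = 0" if b: "t \<le> b" for b
  proof -
    have "f b = f t"
    proof (rule zero_right_derivative_imp_eq[OF b])
      show "continuous_on {t..b} f"
        unfolding f_def using t by (intro continuous_on_prob_le next_arrival_no_atom) auto
    next
      fix u assume u: "t \<le> u" "u < b"
      have u0: "0 \<le> u" using t u by simp
      \<comment> \<open>The service end lies in a window after \<open>u\<close> whose length tends to 0 with growing \<open>k\<close>.\<close>
      define B where "B k = E \<inter> {\<omega> \<in> space M. u < next_arrival t \<omega> \<and> u < service_end j \<omega> \<and> service_end j \<omega> \<le> u + 1 / real (Suc k)}" for k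
      have B: "B k \<in> past u" for k
      proof -
        note [measurable] = capped_start_end_past[OF u0]
        have [measurable]: "Measurable.pred (past_algebra u) (\<lambda>\<omega>. T i \<omega> \<le> t)" for i
          unfolding pred_past_iff by (rule past_gen(2)) (use u in simp)
        have E': "E \<in> sets (past_algebra u)"
        proof -
          note [measurable] = capped_start_end_past[OF t] in_system_past[OF t] end_le_past[OF t]
          have "{\<omega> \<in> space (past_algebra t). service_start j \<omega> \<le> t \<and> \<not> service_end j \<omega> \<le> t \<and> in_system t \<omega> = n} \<in> sets (past_algebra t)"
            by measurable
          also have "{\<omega> \<in> space (past_algebra t). service_start j \<omega> \<le> t \<and> \<not> service_end j \<omega> \<le> t \<and> in_system t \<omega> = n} = E"
            by (auto simp: E_def not_le)
          finally show ?thesis using past_mono[OF t u(1)] by (auto simp: sets_past_algebra)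
        qed
        have "{\<omega> \<in> space (past_algebra u). (\<forall>i. T i \<omega> \<le> t \<or> \<not> T i \<omega> \<le> u) \<and> u < capped_end u j \<omega> \<and> capped_end u j \<omega> \<le> u + 1 / real (Suc k)} \<in> sets (past_algebra u)" by measurable
        then have "E \<inter> {\<omega> \<in> space (past_algebra u). (\<forall>i. T i \<omega> \<le> t \<or> \<not> T i \<omega> \<le> u) \<and> u < capped_end u j \<omega> \<and> capped_end u j \<omega> \<le> u + 1 / real (Suc k)} \<in> sets (past_algebra u)"
          using E' by blast
        also have "E \<inter> {\<omega> \<in> space (past_algebra u). (\<forall>i. T i \<omega> \<le> t \<or> \<not> T i \<omega> \<le> u) \<and> u < capped_end u j \<omega> \<and> capped_end u j \<omega> \<le> u + 1 / real (Suc k)} = B k"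
          using less_next_arrival_iff[OF _ u(1)] u by (auto simp: B_def E_def capped_end_def not_le)
        finally show ?thesis by (simp add: sets_past_algebra)
      qed
      have BM[measurable]: "B k \<in> sets M" for k by (rule past_events[OF u0 B])
      have state: "in_system u \<omega> = n" if "\<omega> \<in> B k" for \<omega> k
        using in_system_until_next_event[of \<omega> j t u] u that by (auto simp: B_def E_def)
      have "(\<lambda>k. prob (B k)) \<longlonglongrightarrow> prob (\<Inter>k. B k)"
      proof (rule finite_Lim_measure_decseq)
        show "decseq B" unfolding decseq_def
        proof (intro allI impI subsetI)
          fix k l \<omega> assume kl: "k \<le> l" and w: "\<omega> \<in> B l"
          have "1 / real (Suc l) \<le> 1 / real (Suc k)" using kl by (simp add: frac_le)
          then show "\<omega> \<in> B k" using w by (auto simp: B_def)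
        qed
      qed auto
      also have "(\<Inter>k. B k) = {}"
      proof -
        have False if w: "\<And>k. \<omega> \<in> B k" for \<omega>
        proof -
          have "0 < service_end j \<omega> - u" using w[of 0] by (auto simp: B_def)
          then obtain k where "1 / real (Suc k) < service_end j \<omega> - u" using nat_approx_posE by blast
          then show False using w[of k] by (auto simp: B_def)
        qed
        then show ?thesis by blast
      qed
      finally have Blim: "(\<lambda>k. lam n * prob (B k)) \<longlonglongrightarrow> 0"
        using tendsto_mult_right_zero by auto
      show "((\<lambda>d. (f (u + d) - f u) / d) \<longlongrightarrow> 0) (at_right 0)"
      proof (rule tendstoI)
        fix e :: real assume e: "0 < e"
        from order_tendstoD(2)[OF Blim e] obtain k where k: "lam n * prob (B k) < e"
          by (auto simp: eventually_sequentially)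
        have "((\<lambda>d. prob (B k \<inter> {\<omega> \<in> space M. \<exists>i. u < T i \<omega> \<and> T i \<omega> \<le> u + d}) / d) \<longlongrightarrow> lam n * prob (B k)) (at_right 0)"
          using state by (intro arrival_rate u0 B) auto
        from order_tendstoD(2)[OF this k]
        have ev: "\<forall>\<^sub>F d in at_right 0. prob (B k \<inter> {\<omega> \<in> space M. \<exists>i. u < T i \<omega> \<and> T i \<omega> \<le> u + d}) / d < e" .
        moreover have "\<forall>\<^sub>F d in at_right (0::real). 0 < d \<and> d < 1 / real (Suc k)"
          by (auto simp: eventually_at_right_field intro!: exI[of _ "1 / real (Suc k)"])
        ultimately show "\<forall>\<^sub>F d in at_right 0. dist ((f (u + d) - f u) / d) 0 < e"
        proof eventually_elim
          case (elim d)
          have "f (u + d) - f u = prob (A \<inter> {\<omega> \<in> space M. next_arrival t \<omega> \<le> u + d} - A \<inter> {\<omega> \<in> space M. next_arrival t \<omega> \<le> u})"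
            unfolding f_def by (subst finite_measure_Diff) (use elim in auto)
          moreover have "prob (A \<inter> {\<omega> \<in> space M. next_arrival t \<omega> \<le> u + d} - A \<inter> {\<omega> \<in> space M. next_arrival t \<omega> \<le> u})
             \<le> prob (B k \<inter> {\<omega> \<in> space M. \<exists>i. u < T i \<omega> \<and> T i \<omega> \<le> u + d})"
          proof (rule finite_measure_mono)
            show "A \<inter> {\<omega> \<in> space M. next_arrival t \<omega> \<le> u + d} - A \<inter> {\<omega> \<in> space M. next_arrival t \<omega> \<le> u}
              \<subseteq> B k \<inter> {\<omega> \<in> space M. \<exists>i. u < T i \<omega> \<and> T i \<omega> \<le> u + d}"
            proof
              fix \<omega> assume w: "\<omega> \<in> A \<inter> {\<omega> \<in> space M. next_arrival t \<omega> \<le> u + d} - A \<inter> {\<omega> \<in> space M. next_arrival t \<omega> \<le> u}"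
              then have *: "\<omega> \<in> E" "\<omega> \<in> space M" "next_arrival t \<omega> = service_end j \<omega>"
                "u < next_arrival t \<omega>" "next_arrival t \<omega> \<le> u + d"
                by (auto simp: A_def)
              then have "\<omega> \<in> B k" using elim by (simp add: B_def)
              moreover have "\<exists>i. u < T i \<omega> \<and> T i \<omega> \<le> u + d"
                using *(4,5) unfolding next_arrival_def by blast
              ultimately show "\<omega> \<in> B k \<inter> {\<omega> \<in> space M. \<exists>i. u < T i \<omega> \<and> T i \<omega> \<le> u + d}"
                using * by simp
            qed
          qed (auto intro!: sets.Int)
          ultimately have "0 \<le> f (u + d) - f u" "f (u + d) - f u \<le> prob (B k \<inter> {\<omega> \<in> space M. \<exists>i. u < T i \<omega> \<and> T i \<omega> \<le> u + d})"
            by simp_all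
          then show ?case using elim
            by (auto simp: dist_real_def abs_divide intro: le_less_trans[OF divide_right_mono])
        qed
      qed
    qed
    then show ?thesis using ft by simp
  qed
  have "AE \<omega> in M. \<omega> \<notin> A \<inter> {\<omega> \<in> space M. next_arrival t \<omega> \<le> t + real b}" for b
  proof -
    have "prob (A \<inter> {\<omega> \<in> space M. next_arrival t \<omega> \<le> t + real b}) = 0"
      using zero[of "t + real b"] by (simp add: f_def)
    then show ?thesis by (subst (asm) prob_eq_0) auto
  qed
  then have "AE \<omega> in M. \<forall>b. \<omega> \<notin> A \<inter> {\<omega> \<in> space M. next_arrival t \<omega> \<le> t + real b}"
    unfolding AE_all_countable by blast
  then show ?thesis using AE_space
  proof (eventually_elim)
    case (elim \<omega>)
    obtain b where "next_arrival t \<omega> - t \<le> real b" using real_arch_simple by blast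
    then show ?case using elim(1)[rule_format, of b] elim(2) by (auto simp: A_def E_def)
  qed
qed

text \<open>
  A residual service time of 0 is a coincidence of an arrival with a service end.  A rational time between
  the last previous event and that arrival reduces it to countably many null events.
\<close>

lemma residual_positive: "AE \<omega> in M. \<forall>i. 0 < found i \<omega> \<longrightarrow> 0 < residual i \<omega>"
proof -
  have "AE \<omega> in M. \<not> (service_start j \<omega> \<le> (max 0 (real_of_rat q)) \<and> (max 0 (real_of_rat q)) < service_end j \<omega> \<and> in_system (max 0 (real_of_rat q)) \<omega> = n \<and> next_arrival (max 0 (real_of_rat q)) \<omega> = service_end j \<omega>)" for q j n
    by (rule no_arrival_at_service_end) simp
  then have "AE \<omega> in M. \<forall>q j n. \<not> (service_start j \<omega> \<le> (max 0 (real_of_rat q)) \<and> (max 0 (real_of_rat q)) < service_end j \<omega> \<and> in_system (max 0 (real_of_rat q)) \<omega> = n \<and> next_arrival (max 0 (real_of_rat q)) \<omega> = service_end j \<omega>)"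
    unfolding AE_all_countable by blast
  then show ?thesis using arrivals_strictly_increasing AE_space
  proof eventually_elim
    case (elim \<omega>)
    note \<omega> = elim(3)
    show ?case
    proof (intro allI impI, rule ccontr)
      fix i assume found: "0 < found i \<omega>" and "\<not> 0 < residual i \<omega>"
      then have eq: "service_end (completed_before i \<omega>) \<omega> = T i \<omega>"
        using residual_nonneg[OF \<omega>, of i] by (simp add: residual_def)
      have start: "service_start (completed_before i \<omega>) \<omega> < T i \<omega>"
        using elim by (intro start_less_of_found_pos[OF \<omega> _ _ found]) auto
      \<comment> \<open>\<open>m\<close> is the last event before the arrival, or the start of the service in progress.\<close>
      define m where "m = max (service_start (completed_before i \<omega>) \<omega>) (if i = 0 then 0 else T (i - 1) \<omega>)"
      have "m < T i \<omega>"
        using start elim(2) by (cases i) (auto simp: m_def)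
      then obtain q where q: "m < real_of_rat q" "real_of_rat q < T i \<omega>" using of_rat_dense by blast
      have "0 \<le> m" using start_nonneg[OF \<omega>] by (auto simp: m_def le_max_iff_disj)
      then have abs: "(max 0 (real_of_rat q)) = real_of_rat q" using q(1) by simp
      have "next_arrival (real_of_rat q) \<omega> = T i \<omega>"
      proof (rule next_arrival_between[OF \<omega> _ q(2)])
        fix k assume "k < i"
        then have "T k \<omega> \<le> T (i - 1) \<omega>" by (intro T_monoD[OF \<omega>]) simp
        also have "\<dots> \<le> m" using \<open>k < i\<close> by (simp add: m_def)
        finally show "T k \<omega> \<le> real_of_rat q" using q by simp
      qed
      then show False
        using elim(1)[rule_format, of "completed_before i \<omega>" q "in_system (real_of_rat q) \<omega>"] q eq by (simp add: abs m_def)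
    qed
  qed
qed

end

section \<open>Arrivals during a sojourn that begins at a random time\<close>

context single_server_queue
begin

text \<open>
  The events known at the random time \<open>\<tau>\<close>; for the beginning of a service they include its duration.
\<close>

definition stopped_algebra :: "('a \<Rightarrow> real) \<Rightarrow> 'a measure" where
  "stopped_algebra \<tau> = sigma (space M) {E \<in> sets M. \<forall>t\<ge>0. E \<inter> {\<omega> \<in> space M. \<tau> \<omega> \<le> t} \<in> past t}"

definition stopping_time :: "('a \<Rightarrow> real) \<Rightarrow> bool" where
  "stopping_time \<tau> \<longleftrightarrow> \<tau> \<in> borel_measurable M \<and> (\<forall>\<omega>\<in>space M. 0 \<le> \<tau> \<omega>) \<and>
     (\<forall>t\<ge>0. {\<omega> \<in> space M. \<tau> \<omega> \<le> t} \<in> past t)"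

lemma space_stopped_algebra[simp]: "space (stopped_algebra \<tau>) = space M"
  unfolding stopped_algebra_def by (rule space_measure_of) (auto dest: sets.sets_into_space)

context
  fixes \<tau> assumes \<tau>: "stopping_time \<tau>"
begin

lemma stopping_time_past: "0 \<le> t \<Longrightarrow> {\<omega> \<in> space M. \<tau> \<omega> \<le> t} \<in> sets (past_algebra t)"
  using \<tau> by (auto simp: stopping_time_def sets_past_algebra)

lemma sets_stopped_algebra:
  "sets (stopped_algebra \<tau>) = {E \<in> sets M. \<forall>t\<ge>0. E \<inter> {\<omega> \<in> space M. \<tau> \<omega> \<le> t} \<in> past t}" (is "_ = ?S")
proof -
  have "sigma_algebra (space M) ?S"
    unfolding sigma_algebra_iff2
  proof (intro conjI ballI allI impI)
    show "?S \<subseteq> Pow (space M)" by (auto dest: sets.sets_into_space)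
    show "{} \<in> ?S" using sets.empty_sets[of "past_algebra _"] by (auto simp: sets_past_algebra)
  next
    fix E assume E: "E \<in> ?S"
    have "(space M - E) \<inter> {\<omega> \<in> space M. \<tau> \<omega> \<le> t} \<in> past t" if "0 \<le> t" for t
    proof -
      have "(space M - E) \<inter> {\<omega> \<in> space M. \<tau> \<omega> \<le> t} =
        {\<omega> \<in> space M. \<tau> \<omega> \<le> t} - E \<inter> {\<omega> \<in> space M. \<tau> \<omega> \<le> t}" by auto
      also have "\<dots> \<in> sets (past_algebra t)"
        using E stopping_time_past[OF that] that by (intro sets.Diff) (auto simp: sets_past_algebra)
      finally show ?thesis by (simp add: sets_past_algebra)
    qed
    with E show "space M - E \<in> ?S" by auto
  next
    fix A :: "nat \<Rightarrow> 'a set" assume A: "range A \<subseteq> ?S"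
    have "(\<Union>i. A i) \<inter> {\<omega> \<in> space M. \<tau> \<omega> \<le> t} \<in> past t" if "0 \<le> t" for t
    proof -
      have "(\<Union>i. A i) \<inter> {\<omega> \<in> space M. \<tau> \<omega> \<le> t} = (\<Union>i. A i \<inter> {\<omega> \<in> space M. \<tau> \<omega> \<le> t})" by auto
      also have "\<dots> \<in> sets (past_algebra t)"
        using A that by (intro sets.countable_UN) (auto simp: sets_past_algebra)
      finally show ?thesis by (simp add: sets_past_algebra)
    qed
    with A show "(\<Union>i. A i) \<in> ?S" by auto
  qed
  then show ?thesis
    unfolding stopped_algebra_def by (rule sigma_algebra.sets_measure_of_eq)
qed

lemma subalgebra_stopped: "subalgebra M (stopped_algebra \<tau>)"
  by (auto simp: subalgebra_def sets_stopped_algebra)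

text \<open>
  It suffices to exhibit, for every fixed \<open>t\<close>, a version known at \<open>t\<close> that is correct once \<open>\<tau>\<close> has passed.
\<close>

lemma measurable_stoppedI:
  fixes f :: "'a \<Rightarrow> 'b"
  assumes f: "f \<in> measurable M N"
    and g: "\<And>t. 0 \<le> t \<Longrightarrow> g t \<in> measurable (past_algebra t) N"
    and eq: "\<And>t \<omega>. 0 \<le> t \<Longrightarrow> \<omega> \<in> space M \<Longrightarrow> \<tau> \<omega> \<le> t \<Longrightarrow> g t \<omega> = f \<omega>"
  shows "f \<in> measurable (stopped_algebra \<tau>) N"
proof (rule measurableI)
  fix A assume A: "A \<in> sets N"
  have "f -` A \<inter> space M \<inter> {\<omega> \<in> space M. \<tau> \<omega> \<le> t} \<in> past t" if t: "0 \<le> t" for t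
  proof -
    have "f -` A \<inter> space M \<inter> {\<omega> \<in> space M. \<tau> \<omega> \<le> t} = (g t -` A \<inter> space (past_algebra t)) \<inter> {\<omega> \<in> space M. \<tau> \<omega> \<le> t}"
      using eq[OF t] by auto
    also have "\<dots> \<in> sets (past_algebra t)"
      by (intro sets.Int measurable_sets[OF g[OF t] A] stopping_time_past t)
    finally show ?thesis by (simp add: sets_past_algebra)
  qed
  then show "f -` A \<inter> space (stopped_algebra \<tau>) \<in> sets (stopped_algebra \<tau>)"
    using measurable_sets[OF f A] by (simp add: sets_stopped_algebra)
qed (use measurable_space[OF f] in simp)

lemma next_arrival_stopped_measurable: "(\<lambda>\<omega>. next_arrival (\<tau> \<omega>) \<omega>) \<in> borel_measurable M"
proof -
  have [measurable]: "\<tau> \<in> borel_measurable M" using \<tau> by (simp add: stopping_time_def)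
  note [measurable] = T_measurable
  have [measurable]: "(\<lambda>\<omega>. card {i. T i \<omega> \<le> \<tau> \<omega>}) \<in> measurable M (count_space UNIV)"
    by (rule measurable_card_initial_segment) (auto simp: T_le_iff)
  show ?thesis
    unfolding next_arrival_def[abs_def] by (rule nat_indexed_measurable[where f = T, OF T_measurable]) measurable
qed

text \<open>
  Whether an arrival falls between \<open>\<tau>\<close> and \<open>t\<close> is decided by comparing \<open>\<tau>\<close> with the arrival epochs
  at rational times.
\<close>

lemma stopped_before_next_arrival:
  assumes E: "E \<in> sets (stopped_algebra \<tau>)" and t: "0 \<le> t"
  shows "E \<inter> {\<omega> \<in> space M. s < \<tau> \<omega> \<and> \<tau> \<omega> \<le> t \<and> t < next_arrival (\<tau> \<omega>) \<omega>} \<in> past t"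
proof -
  have E_t: "E \<inter> {\<omega> \<in> space M. \<tau> \<omega> \<le> t} \<in> sets (past_algebra t)"
    using E t by (simp add: sets_stopped_algebra sets_past_algebra)
  have le: "{\<omega> \<in> space M. \<tau> \<omega> \<le> r} \<in> sets (past_algebra t)" if "r \<le> t" for r
  proof (cases "0 \<le> r")
    case True
    then show ?thesis
      using stopping_time_past[OF True] past_mono[OF True that] by (auto simp: sets_past_algebra)
  next
    case False
    then have "{\<omega> \<in> space M. \<tau> \<omega> \<le> r} = {}"
      using \<tau> by (force simp: stopping_time_def)
    then show ?thesis by (simp only: sets.empty_sets)
  qed
  have T_le: "{\<omega> \<in> space M. T i \<omega> \<le> r} \<in> sets (past_algebra t)" if "r \<le> t" for i r
    using past_gen(2)[OF that] by (simp add: sets_past_algebra)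
  define H where "H i q = (if real_of_rat q \<le> t then {\<omega> \<in> space M. \<tau> \<omega> \<le> real_of_rat q} \<inter>
      ({\<omega> \<in> space M. T i \<omega> \<le> t} - {\<omega> \<in> space M. T i \<omega> \<le> real_of_rat q}) else {})" for i q
  have H: "H i q \<in> sets (past_algebra t)" for i q
    unfolding H_def by (auto intro!: sets.Int sets.Diff le T_le)
  have "(\<exists>q. \<omega> \<in> H i q) \<longleftrightarrow> \<tau> \<omega> < T i \<omega> \<and> T i \<omega> \<le> t" if \<omega>: "\<omega> \<in> space M" for i \<omega>
  proof
    assume "\<tau> \<omega> < T i \<omega> \<and> T i \<omega> \<le> t"
    moreover then obtain q where "\<tau> \<omega> < real_of_rat q" "real_of_rat q < T i \<omega>" using of_rat_dense by blast
    ultimately have "\<omega> \<in> H i q" using \<omega> by (auto simp: H_def)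
    then show "\<exists>q. \<omega> \<in> H i q" ..
  qed (auto simp: H_def split: if_splits)
  then have eq: "E \<inter> {\<omega> \<in> space M. s < \<tau> \<omega> \<and> \<tau> \<omega> \<le> t \<and> t < next_arrival (\<tau> \<omega>) \<omega>} =
     (E \<inter> {\<omega> \<in> space M. \<tau> \<omega> \<le> t} - {\<omega> \<in> space M. \<tau> \<omega> \<le> min s t}) - (\<Union>i q. H i q)"
    using less_next_arrival_iff by (auto simp: not_le not_less min_def) (metis less_le_not_le not_less)+
  have "(\<Union>i q. H i q) \<in> sets (past_algebra t)"
  proof -
    have "(\<Union>q. H i q) \<in> sets (past_algebra t)" for i
      by (rule sets.countable_UN) (use H in auto)
    then show ?thesis by (intro sets.countable_UN) auto
  qed
  then show ?thesis
    unfolding eq sets_past_algebra[symmetric]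
    by (intro sets.Diff E_t le) auto
qed

end
end

text \<open>
  The grid points are the first one that is not before \<open>x\<close> and the last one strictly before \<open>x\<close>.
\<close>

lemma grid_above_tendsto:
  fixes x :: real
  shows "(\<lambda>k. real_of_int \<lceil>real (Suc k) * x\<rceil> / real (Suc k)) \<longlonglongrightarrow> x"
    and "(\<lambda>k. real_of_int (\<lceil>real (Suc k) * x\<rceil> - 1) / real (Suc k)) \<longlonglongrightarrow> x"
    and "x \<le> real_of_int \<lceil>real (Suc k) * x\<rceil> / real (Suc k)"
    and "real_of_int (\<lceil>real (Suc k) * x\<rceil> - 1) / real (Suc k) < x"
proof -
  show *: "x \<le> real_of_int \<lceil>real (Suc k) * x\<rceil> / real (Suc k)"
     "real_of_int (\<lceil>real (Suc k) * x\<rceil> - 1) / real (Suc k) < x" for k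
    using le_of_int_ceiling[of "real (Suc k) * x"] of_int_ceiling_le_add_one[of "real (Suc k) * x"]
      ceiling_correct[of "real (Suc k) * x"]
    by (simp_all add: pos_le_divide_eq pos_divide_less_eq mult.commute del: of_nat_Suc)
  have diff: "real_of_int \<lceil>real (Suc k) * x\<rceil> / real (Suc k) = real_of_int (\<lceil>real (Suc k) * x\<rceil> - 1) / real (Suc k) + inverse (real (Suc k))" for k
    by (simp add: field_simps del: of_nat_Suc)
  have up: "(\<lambda>k. x + inverse (real (Suc k))) \<longlonglongrightarrow> x" and lo: "(\<lambda>k. x - inverse (real (Suc k))) \<longlonglongrightarrow> x"
    using tendsto_add[OF tendsto_const LIMSEQ_inverse_real_of_nat, of x]
      tendsto_diff[OF tendsto_const LIMSEQ_inverse_real_of_nat, of x]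
    by (simp_all del: of_nat_Suc)
  show "(\<lambda>k. real_of_int \<lceil>real (Suc k) * x\<rceil> / real (Suc k)) \<longlonglongrightarrow> x"
  proof (rule tendsto_sandwich[OF _ _ tendsto_const up])
    show "\<forall>\<^sub>F k in sequentially. x \<le> real_of_int \<lceil>real (Suc k) * x\<rceil> / real (Suc k)"
      using *(1) by (intro always_eventually allI)
    show "\<forall>\<^sub>F k in sequentially. real_of_int \<lceil>real (Suc k) * x\<rceil> / real (Suc k) \<le> x + inverse (real (Suc k))"
      unfolding diff using *(2) by (intro always_eventually allI add_right_mono less_imp_le)
  qed
  show "(\<lambda>k. real_of_int (\<lceil>real (Suc k) * x\<rceil> - 1) / real (Suc k)) \<longlonglongrightarrow> x"
  proof (rule tendsto_sandwich[OF _ _ lo tendsto_const])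
    show "\<forall>\<^sub>F k in sequentially. x - inverse (real (Suc k)) \<le> real_of_int (\<lceil>real (Suc k) * x\<rceil> - 1) / real (Suc k)"
      using *(1) diff by (intro always_eventually allI) (metis diff_le_eq)
    show "\<forall>\<^sub>F k in sequentially. real_of_int (\<lceil>real (Suc k) * x\<rceil> - 1) / real (Suc k) \<le> x"
      using *(2) by (intro always_eventually allI less_imp_le)
  qed
qed

context MnGn1_queue
begin

text \<open>
  From the beginning \<open>\<tau>\<close> of a sojourn up to the service end \<open>\<sigma>\<close>, the next arrival is an
  exponential clock, and \<open>\<sigma>\<close> is known at \<open>\<tau>\<close>.  For an exponential clock started at deterministic
  times this is \<open>prob_no_arrival\<close>.  Here \<open>\<tau>\<close> is approximated by grid points from above and
  \<open>\<sigma> - x\<close> by grid points strictly from below: between the two grid points the sojourn is under way, and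
  on each cell of the grid both are deterministic.
\<close>

theorem prob_arrival_during_sojourn:
  fixes \<tau> \<sigma> :: "'a \<Rightarrow> real" and x :: real
  assumes \<tau>: "stopping_time \<tau>" and \<sigma>: "\<sigma> \<in> borel_measurable (stopped_algebra \<tau>)"
    and E: "E \<in> sets (stopped_algebra \<tau>)" and x: "0 \<le> x" and lam: "0 < lam n"
    and state: "AE \<omega> in M. \<omega> \<in> E \<longrightarrow>
       (\<forall>u. \<tau> \<omega> \<le> u \<longrightarrow> u < \<sigma> \<omega> \<longrightarrow> u < next_arrival (\<tau> \<omega>) \<omega> \<longrightarrow> in_system u \<omega> = n)"
  shows "prob (E \<inter> {\<omega> \<in> space M. next_arrival (\<tau> \<omega>) \<omega> < \<sigma> \<omega> - x}) =
    (LINT \<omega>:E|M. exponential_cdf (lam n) (\<sigma> \<omega> - \<tau> \<omega> - x))"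
proof -
  define A where "A \<omega> = next_arrival (\<tau> \<omega>) \<omega>" for \<omega>
  have EM[measurable]: "E \<in> sets M" using E by (simp add: sets_stopped_algebra[OF \<tau>])
  have \<tau>M[measurable]: "\<tau> \<in> borel_measurable M" using \<tau> by (simp add: stopping_time_def)
  have \<sigma>M[measurable]: "\<sigma> \<in> borel_measurable M"
    using measurable_from_subalg[OF subalgebra_stopped[OF \<tau>] \<sigma>] .
  have AM[measurable]: "A \<in> borel_measurable M"
    unfolding A_def by (rule next_arrival_stopped_measurable[OF \<tau>])
  have A_gt: "\<tau> \<omega> < A \<omega>" if "\<omega> \<in> space M" for \<omega>
    unfolding A_def by (rule next_arrival_gt[OF that])
  have \<tau>0: "0 \<le> \<tau> \<omega>" if "\<omega> \<in> space M" for \<omega> using \<tau> that by (simp add: stopping_time_def)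
  \<comment> \<open>\<open>p\<close> and \<open>q\<close> are the grid points of mesh \<open>1 / Suc k\<close>, \<open>P\<close> and \<open>Q\<close> their numbers.\<close>
  define P where "P k \<omega> = \<lceil>real (Suc k) * \<tau> \<omega>\<rceil>" for k \<omega>
  define Q where "Q k \<omega> = \<lceil>real (Suc k) * (\<sigma> \<omega> - x)\<rceil> - 1" for k \<omega>
  define p where "p k \<omega> = real_of_int (P k \<omega>) / real (Suc k)" for k \<omega>
  define q where "q k \<omega> = real_of_int (Q k \<omega>) / real (Suc k)" for k \<omega>
  have [measurable]: "P k \<in> measurable M (count_space UNIV)" "Q k \<in> measurable M (count_space UNIV)" for k
    unfolding P_def Q_def by measurable
  have [measurable]: "p k \<in> borel_measurable M" "q k \<in> borel_measurable M" for k
    unfolding p_def q_def by measurable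
  have p: "(\<lambda>k. p k \<omega>) \<longlonglongrightarrow> \<tau> \<omega>" "\<tau> \<omega> \<le> p k \<omega>"
    and q: "(\<lambda>k. q k \<omega>) \<longlonglongrightarrow> \<sigma> \<omega> - x" "q k \<omega> < \<sigma> \<omega> - x" for k \<omega>
    unfolding p_def q_def P_def Q_def by (rule grid_above_tendsto)+
  define \<Phi> where "\<Phi> k \<omega> = (of_bool (P k \<omega> \<le> Q k \<omega> \<and> q k \<omega> < A \<omega>) :: real)" for k \<omega>
  define \<Psi> where "\<Psi> k \<omega> = of_bool (P k \<omega> \<le> Q k \<omega> \<and> p k \<omega> < A \<omega>) * exp (- lam n * (q k \<omega> - p k \<omega>))" for k \<omega>
  have [measurable]: "\<Phi> k \<in> borel_measurable M" "\<Psi> k \<in> borel_measurable M" for k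
    unfolding \<Phi>_def \<Psi>_def by measurable
  have pq: "p k \<omega> \<le> q k \<omega>" if "P k \<omega> \<le> Q k \<omega>" for k \<omega>
    using that by (simp add: p_def q_def divide_right_mono)
  have bound: "\<bar>\<Phi> k \<omega>\<bar> \<le> 1" "\<bar>\<Psi> k \<omega>\<bar> \<le> 1" for k \<omega>
    using lam pq[of k \<omega>] by (auto simp: \<Phi>_def \<Psi>_def split: split_of_bool)
  have int: "integrable M (\<Phi> k)" "integrable M (\<Psi> k)" for k
    by (rule integrable_const_bound[where B = 1]; use bound in \<open>auto\<close>)+
  \<comment> \<open>On a cell with both grid points fixed, the clock runs between two deterministic times.\<close>
  have grid: "(LINT \<omega>:E|M. \<Phi> k \<omega>) = (LINT \<omega>:E|M. \<Psi> k \<omega>)" for k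
  proof (rule set_integral_eq_by_countable_partition[where \<kappa> = "\<lambda>\<omega>. (P k \<omega>, Q k \<omega>)"])
    fix c :: "int \<times> int"
    obtain a b where c: "c = (a, b)" by (cases c)
    define t where "t = real_of_int a / real (Suc k)"
    define v where "v = real_of_int b / real (Suc k)"
    define H where "H = E \<inter> {\<omega> \<in> space M. (P k \<omega>, Q k \<omega>) = c}"
    have H[measurable]: "H \<in> sets M" unfolding H_def by measurable
    have on_H: "p k \<omega> = t" "q k \<omega> = v" "P k \<omega> = a" "Q k \<omega> = b" if "\<omega> \<in> H" for \<omega>
      using that by (auto simp: H_def c p_def q_def t_def v_def)
    have "(LINT \<omega>:H|M. \<Phi> k \<omega>) = (LINT \<omega>:H|M. \<Psi> k \<omega>)"
    proof (cases "a \<le> b \<and> 0 \<le> a")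
      case True
      then have t: "0 \<le> t" and tv: "t \<le> v" by (auto simp: t_def v_def divide_right_mono)
      define E2 where "E2 = E \<inter> {\<omega> \<in> space M. Q k \<omega> = b}"
      have E2: "E2 \<in> sets (stopped_algebra \<tau>)"
      proof -
        note [measurable] = \<sigma>
        have "{\<omega> \<in> space (stopped_algebra \<tau>). \<lceil>real (Suc k) * (\<sigma> \<omega> - x)\<rceil> - 1 = b} \<in> sets (stopped_algebra \<tau>)" by measurable
        then show ?thesis using E by (auto simp: E2_def Q_def intro: sets.Int)
      qed
      have P_iff: "P k \<omega> = a \<longleftrightarrow> (real_of_int a - 1) / real (Suc k) < \<tau> \<omega> \<and> \<tau> \<omega> \<le> t" for \<omega>
        unfolding P_def t_def ceiling_eq_iff
        by (simp add: pos_le_divide_eq pos_divide_less_eq mult.commute del: of_nat_Suc)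
      define H' where "H' = H \<inter> {\<omega> \<in> space M. t < A \<omega>}"
      have "H' = E2 \<inter> {\<omega> \<in> space M. (real_of_int a - 1) / real (Suc k) < \<tau> \<omega> \<and> \<tau> \<omega> \<le> t \<and> t < next_arrival (\<tau> \<omega>) \<omega>}"
        using P_iff by (auto simp: H'_def H_def E2_def c A_def)
      then have H': "H' \<in> past t"
        using stopped_before_next_arrival[OF \<tau> E2 t] by simp
      have next_eq: "next_arrival t \<omega> = A \<omega>" if "\<omega> \<in> H'" for \<omega>
        using that P_iff unfolding A_def
        by (intro next_arrival_cong) (auto simp: H'_def H_def c A_def)
      have "prob (H' \<inter> {\<omega> \<in> space M. v < next_arrival t \<omega>}) = exp (- lam n * (v - t)) * prob H'"
      proof (rule prob_no_arrival[OF t tv H'])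
        fix u assume u: "t \<le> u" "u < v"
        show "AE \<omega> in M. \<omega> \<in> H' \<and> u < next_arrival t \<omega> \<longrightarrow> in_system u \<omega> = n"
          using state AE_space
        proof eventually_elim
          case (elim \<omega>)
          show ?case
          proof
            assume w: "\<omega> \<in> H' \<and> u < next_arrival t \<omega>"
            then have wH: "\<omega> \<in> H" "\<omega> \<in> E" by (auto simp: H'_def H_def)
            have "u < \<sigma> \<omega>" using u q(2)[of k \<omega>] x on_H(2)[OF wH(1)] by simp
            moreover have "\<tau> \<omega> \<le> u" using u p(2)[of \<omega> k] on_H(1)[OF wH(1)] by simp
            ultimately show "in_system u \<omega> = n"
              using elim(1) wH next_eq w by (auto simp: A_def)
          qed
        qed
      qed
      moreover have "H' \<inter> {\<omega> \<in> space M. v < next_arrival t \<omega>} = H \<inter> {\<omega> \<in> space M. v < A \<omega>}"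
        using next_eq tv by (auto simp: H'_def)
      ultimately have eq: "prob (H \<inter> {\<omega> \<in> space M. v < A \<omega>}) = exp (- lam n * (v - t)) * prob (H \<inter> {\<omega> \<in> space M. t < A \<omega>})"
        by (simp add: H'_def)
      have "(LINT \<omega>:H|M. \<Phi> k \<omega>) = (LINT \<omega>|M. indicat_real (H \<inter> {\<omega> \<in> space M. v < A \<omega>}) \<omega>)"
        unfolding set_lebesgue_integral_def
      proof (rule Bochner_Integration.integral_cong[OF refl])
        fix \<omega> assume "\<omega> \<in> space M"
        then show "indicat_real H \<omega> *\<^sub>R \<Phi> k \<omega> = indicat_real (H \<inter> {\<omega> \<in> space M. v < A \<omega>}) \<omega>"
          using on_H[of \<omega>] True by (cases "\<omega> \<in> H") (simp_all add: \<Phi>_def)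
      qed
      moreover have "(LINT \<omega>:H|M. \<Psi> k \<omega>) = (LINT \<omega>|M. exp (- lam n * (v - t)) * indicat_real (H \<inter> {\<omega> \<in> space M. t < A \<omega>}) \<omega>)"
        unfolding set_lebesgue_integral_def
      proof (rule Bochner_Integration.integral_cong[OF refl])
        fix \<omega> assume "\<omega> \<in> space M"
        then show "indicat_real H \<omega> *\<^sub>R \<Psi> k \<omega> = exp (- lam n * (v - t)) * indicat_real (H \<inter> {\<omega> \<in> space M. t < A \<omega>}) \<omega>"
          using on_H[of \<omega>] True by (cases "\<omega> \<in> H") (simp_all add: \<Psi>_def indicator_def)
      qed
      moreover have "H \<inter> {\<omega> \<in> space M. v < A \<omega>} \<in> sets M" "H \<inter> {\<omega> \<in> space M. t < A \<omega>} \<in> sets M"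
        by measurable
      ultimately show ?thesis using eq by simp
    next
      case False
      have "\<not> P k \<omega> \<le> Q k \<omega>" if "\<omega> \<in> H" for \<omega>
      proof -
        have "\<omega> \<in> space M" using that by (simp add: H_def)
        then have "0 \<le> real (Suc k) * \<tau> \<omega>" using \<tau>0[of \<omega>] by simp
        then have "0 \<le> P k \<omega>" unfolding P_def by linarith
        then show ?thesis using on_H[OF that] False by auto
      qed
      then have "indicat_real H \<omega> *\<^sub>R \<Phi> k \<omega> = indicat_real H \<omega> *\<^sub>R \<Psi> k \<omega>" for \<omega>
        by (cases "\<omega> \<in> H"; simp add: \<Phi>_def \<Psi>_def)
      then show ?thesis by (simp only: set_lebesgue_integral_def)
    qed
    then show "(LINT \<omega>:E \<inter> {\<omega> \<in> space M. (P k \<omega>, Q k \<omega>) = c}|M. \<Phi> k \<omega>) =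
      (LINT \<omega>:E \<inter> {\<omega> \<in> space M. (P k \<omega>, Q k \<omega>) = c}|M. \<Psi> k \<omega>)"
      by (simp only: H_def)
  qed (use int in auto)
  \<comment> \<open>Because \<open>q\<close> stays strictly below \<open>\<sigma> - x\<close>, an arrival exactly at \<open>\<sigma> - x\<close> counts as not before it.\<close>
  define \<phi> where "\<phi> \<omega> = (of_bool (\<tau> \<omega> < \<sigma> \<omega> - x \<and> \<sigma> \<omega> - x \<le> A \<omega>) :: real)" for \<omega>
  define \<psi> where "\<psi> \<omega> = of_bool (\<tau> \<omega> < \<sigma> \<omega> - x) * exp (- lam n * (\<sigma> \<omega> - x - \<tau> \<omega>))" for \<omega>
  have [measurable]: "\<phi> \<in> borel_measurable M" "\<psi> \<in> borel_measurable M"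
    unfolding \<phi>_def \<psi>_def by measurable
  have lim: "(\<lambda>k. \<Phi> k \<omega>) \<longlonglongrightarrow> \<phi> \<omega>" "(\<lambda>k. \<Psi> k \<omega>) \<longlonglongrightarrow> \<psi> \<omega>" if \<omega>: "\<omega> \<in> space M" for \<omega>
  proof -
    have "(\<lambda>k. \<Phi> k \<omega>) \<longlonglongrightarrow> \<phi> \<omega> \<and> (\<lambda>k. \<Psi> k \<omega>) \<longlonglongrightarrow> \<psi> \<omega>"
    proof (cases "\<tau> \<omega> < \<sigma> \<omega> - x")
      case True
      define m where "m = (\<tau> \<omega> + (\<sigma> \<omega> - x)) / 2"
      have m: "\<tau> \<omega> < m" "m < \<sigma> \<omega> - x" using True by (auto simp: m_def)
      have ev: "\<forall>\<^sub>F k in sequentially. p k \<omega> < m" "\<forall>\<^sub>F k in sequentially. m < q k \<omega>"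
        "\<forall>\<^sub>F k in sequentially. p k \<omega> < A \<omega>"
        using order_tendstoD(2)[OF p(1) m(1)] order_tendstoD(1)[OF q(1) m(2)] order_tendstoD(2)[OF p(1) A_gt[OF \<omega>]] by auto
      have PQ: "\<forall>\<^sub>F k in sequentially. P k \<omega> \<le> Q k \<omega>"
        using ev(1,2)
      proof eventually_elim
        case (elim k)
        then have "p k \<omega> < q k \<omega>" by simp
        then show ?case by (simp add: p_def q_def divide_less_cancel)
      qed
      have "\<forall>\<^sub>F k in sequentially. (q k \<omega> < A \<omega>) = (\<sigma> \<omega> - x \<le> A \<omega>)"
      proof (cases "\<sigma> \<omega> - x \<le> A \<omega>")
        case True
        then show ?thesis using q(2)[of _ \<omega>] by (auto intro!: always_eventually intro: less_le_trans)
      next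
        case False
        then have "A \<omega> < \<sigma> \<omega> - x" by simp
        from order_tendstoD(1)[OF q(1) this] show ?thesis
          by eventually_elim (use False in auto)
      qed
      with PQ have "\<forall>\<^sub>F k in sequentially. \<Phi> k \<omega> = \<phi> \<omega>"
        by eventually_elim (use True in \<open>simp add: \<Phi>_def \<phi>_def\<close>)
      moreover have "(\<lambda>k. \<Psi> k \<omega>) \<longlonglongrightarrow> \<psi> \<omega>"
      proof (rule Lim_transform_eventually)
        show "(\<lambda>k. exp (- lam n * (q k \<omega> - p k \<omega>))) \<longlonglongrightarrow> \<psi> \<omega>"
          using True by (auto simp: \<psi>_def intro!: tendsto_intros p q)
        show "\<forall>\<^sub>F k in sequentially. exp (- lam n * (q k \<omega> - p k \<omega>)) = \<Psi> k \<omega>"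
          using PQ ev(3) by eventually_elim (simp add: \<Psi>_def)
      qed
      ultimately show ?thesis by (simp add: tendsto_eventually)
    next
      case False
      have "\<not> P k \<omega> \<le> Q k \<omega>" for k
      proof
        assume "P k \<omega> \<le> Q k \<omega>"
        then have "\<tau> \<omega> \<le> q k \<omega>" using pq p(2) order_trans by blast
        then show False using q(2)[of k \<omega>] False by simp
      qed
      then show ?thesis using False by (simp add: \<Phi>_def \<Psi>_def \<phi>_def \<psi>_def)
    qed
    then show "(\<lambda>k. \<Phi> k \<omega>) \<longlonglongrightarrow> \<phi> \<omega>" "(\<lambda>k. \<Psi> k \<omega>) \<longlonglongrightarrow> \<psi> \<omega>" by auto
  qed
  have "(\<lambda>k. LINT \<omega>:E|M. \<Phi> k \<omega>) \<longlonglongrightarrow> (LINT \<omega>:E|M. \<phi> \<omega>)"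
    unfolding set_lebesgue_integral_def
    by (rule integral_dominated_convergence[where w = "\<lambda>_. 1"])
      (use bound in \<open>auto intro!: AE_I2 tendsto_intros lim simp: indicator_def\<close>)
  moreover have "(\<lambda>k. LINT \<omega>:E|M. \<Psi> k \<omega>) \<longlonglongrightarrow> (LINT \<omega>:E|M. \<psi> \<omega>)"
    unfolding set_lebesgue_integral_def
    by (rule integral_dominated_convergence[where w = "\<lambda>_. 1"])
      (use bound in \<open>auto intro!: AE_I2 tendsto_intros lim simp: indicator_def\<close>)
  ultimately have eq: "(LINT \<omega>:E|M. \<phi> \<omega>) = (LINT \<omega>:E|M. \<psi> \<omega>)"
    unfolding grid by (rule LIMSEQ_unique)
  define \<eta> where "\<eta> \<omega> = (of_bool (\<tau> \<omega> < \<sigma> \<omega> - x) :: real)" for \<omega>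
  have [measurable]: "\<eta> \<in> borel_measurable M" unfolding \<eta>_def by measurable
  have sint: "set_integrable M E f" if "f \<in> borel_measurable M" "\<And>\<omega>. \<bar>f \<omega>\<bar> \<le> 1" for f :: "'a \<Rightarrow> real"
    unfolding set_integrable_def
    by (rule integrable_mult_indicator[OF EM]) (rule integrable_const_bound[where B = 1]; use that in auto)
  have \<psi>_bound: "\<bar>\<psi> \<omega>\<bar> \<le> 1" for \<omega>
    using lam by (auto simp: \<psi>_def split: split_of_bool)
  have "prob (E \<inter> {\<omega> \<in> space M. next_arrival (\<tau> \<omega>) \<omega> < \<sigma> \<omega> - x}) = (LINT \<omega>|M. indicat_real (E \<inter> {\<omega> \<in> space M. A \<omega> < \<sigma> \<omega> - x}) \<omega>)"
    by (simp add: A_def[symmetric])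
  also have "\<dots> = (LINT \<omega>:E|M. \<eta> \<omega> - \<phi> \<omega>)"
    unfolding set_lebesgue_integral_def
  proof (rule Bochner_Integration.integral_cong[OF refl])
    fix \<omega> assume "\<omega> \<in> space M"
    then show "indicat_real (E \<inter> {\<omega> \<in> space M. A \<omega> < \<sigma> \<omega> - x}) \<omega> = indicat_real E \<omega> *\<^sub>R (\<eta> \<omega> - \<phi> \<omega>)"
      using A_gt[of \<omega>] by (auto simp: \<eta>_def \<phi>_def indicator_def)
  qed
  also have "\<dots> = (LINT \<omega>:E|M. \<eta> \<omega>) - (LINT \<omega>:E|M. \<psi> \<omega>)"
    unfolding eq[symmetric] by (intro set_integral_diff sint) (auto simp: \<eta>_def \<phi>_def)
  also have "\<dots> = (LINT \<omega>:E|M. \<eta> \<omega> - \<psi> \<omega>)"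
    by (intro set_integral_diff(2)[symmetric] sint) (use \<psi>_bound in \<open>auto simp: \<eta>_def\<close>)
  also have "\<dots> = (LINT \<omega>:E|M. exponential_cdf (lam n) (\<sigma> \<omega> - \<tau> \<omega> - x))"
    unfolding set_lebesgue_integral_def
    by (intro Bochner_Integration.integral_cong[OF refl])
       (auto simp: \<eta>_def \<psi>_def exponential_cdf_def max_def algebra_simps split: split_of_bool)
  finally show ?thesis .
qed

end

section \<open>Frequencies of arrivals during sojourns\<close>

context single_server_queue
begin

text \<open>
  A service in progress at time 0 is left out, because its duration has an arbitrary law.
\<close>

definition fresh_start :: "nat \<Rightarrow> nat \<Rightarrow> 'a \<Rightarrow> bool" where
  "fresh_start n j \<omega> \<longleftrightarrow> in_system_at_start j \<omega> = n \<and> (j = 0 \<longrightarrow> N0 \<omega> = 0)"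

text \<open>
  The sojourn that begins with service \<open>j\<close> ends with an arrival, who sees a residual above \<open>x\<close>.
\<close>

definition hit_in_service :: "real \<Rightarrow> nat \<Rightarrow> 'a \<Rightarrow> bool" where
  "hit_in_service x j \<omega> \<longleftrightarrow> next_arrival (service_start j \<omega>) \<omega> < service_end j \<omega> - x"

text \<open>
  The sojourn that begins with arrival \<open>i\<close> ends with the next arrival, who sees a residual above \<open>x\<close>.
\<close>

definition hit_after_arrival :: "real \<Rightarrow> nat \<Rightarrow> 'a \<Rightarrow> bool" where
  "hit_after_arrival x i \<omega> \<longleftrightarrow> T (Suc i) \<omega> < service_end (completed_before i \<omega>) \<omega> - x"

text \<open>
  The events of \<open>past_of_service j\<close>; unlike the stopped algebra at the start of service \<open>j\<close>, they do not
  reveal its duration, so that the service law can be applied.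
\<close>

definition service_algebra :: "nat \<Rightarrow> 'a measure" where
  "service_algebra j = sigma (space M) (past_of_service j)"

lemma sigma_algebra_past_of_service: "sigma_algebra (space M) (past_of_service j)"
  unfolding past_of_service_def by (rule sigma_algebra_sigma_sets) auto

lemma space_service_algebra[simp]: "space (service_algebra j) = space M"
  unfolding service_algebra_def by (rule sigma_algebra.space_measure_of_eq[OF sigma_algebra_past_of_service])

lemma sets_service_algebra: "sets (service_algebra j) = past_of_service j"
  unfolding service_algebra_def by (rule sigma_algebra.sets_measure_of_eq[OF sigma_algebra_past_of_service])

lemma service_gens:
  "{\<omega> \<in> space M. N0 \<omega> = n} \<in> past_of_service j"
  "{\<omega> \<in> space M. T i \<omega> \<le> s \<and> T i \<omega> \<le> service_start j \<omega>} \<in> past_of_service j"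
  "i < j \<Longrightarrow> {\<omega> \<in> space M. X i \<omega> \<le> x} \<in> past_of_service j"
  unfolding past_of_service_def by (rule sigma_sets.Basic; blast)+

lemma N0_service[measurable]: "N0 \<in> measurable (service_algebra j) (count_space UNIV)"
proof (rule measurable_count_space_eq_countable[THEN iffD2])
  show "N0 \<in> space (service_algebra j) \<rightarrow> UNIV \<and> (\<forall>n\<in>UNIV. N0 -` {n} \<inter> space (service_algebra j) \<in> sets (service_algebra j))"
    using service_gens(1)[of _ j] by (auto simp: sets_service_algebra vimage_def Int_def conj_commute)
qed simp

lemma X_service: "i < j \<Longrightarrow> X i \<in> borel_measurable (service_algebra j)"
  by (rule borel_measurableI_le) (simp add: sets_service_algebra service_gens)

lemma arrived_service[measurable]: "Measurable.pred (service_algebra j) (\<lambda>\<omega>. T i \<omega> \<le> service_start j \<omega>)"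
proof -
  have "{\<omega> \<in> space M. T i \<omega> \<le> service_start j \<omega>} = (\<Union>s::nat. {\<omega> \<in> space M. T i \<omega> \<le> real s \<and> T i \<omega> \<le> service_start j \<omega>})"
    by (auto intro: real_arch_simple)
  also have "\<dots> \<in> sets (service_algebra j)"
    by (intro sets.countable_UN) (auto simp: sets_service_algebra service_gens)
  finally show ?thesis by (simp add: pred_def)
qed

text \<open>
  An arrival after the start of service \<open>j\<close> is not known yet.  The value \<open>-1\<close> lies outside the range of the epochs;
  it stands for such arrivals.
\<close>

definition seen_arrival :: "nat \<Rightarrow> nat \<Rightarrow> 'a \<Rightarrow> real" where
  "seen_arrival j i \<omega> = (if T i \<omega> \<le> service_start j \<omega> then T i \<omega> else - 1)"

lemma seen_arrival_service[measurable]: "seen_arrival j i \<in> borel_measurable (service_algebra j)"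
proof (rule borel_measurableI_le)
  fix y
  have a: "{\<omega> \<in> space M. T i \<omega> \<le> y \<and> T i \<omega> \<le> service_start j \<omega>} \<in> sets (service_algebra j)"
    by (simp add: sets_service_algebra service_gens)
  have b: "{\<omega> \<in> space (service_algebra j). \<not> T i \<omega> \<le> service_start j \<omega>} \<in> sets (service_algebra j)" by measurable
  have "{\<omega> \<in> space M. seen_arrival j i \<omega> \<le> y} = {\<omega> \<in> space M. T i \<omega> \<le> y \<and> T i \<omega> \<le> service_start j \<omega>} \<union>
      (if - 1 \<le> y then {\<omega> \<in> space (service_algebra j). \<not> T i \<omega> \<le> service_start j \<omega>} else {})"
    by (auto simp: seen_arrival_def)
  also have "\<dots> \<in> sets (service_algebra j)" using a b by auto
  finally show "{\<omega> \<in> space (service_algebra j). seen_arrival j i \<omega> \<le> y} \<in> sets (service_algebra j)" by simp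
qed

lemma entry_service:
  assumes "l \<le> j" shows "entry l \<in> borel_measurable (service_algebra j)"
proof -
  have [measurable]: "(\<lambda>\<omega>. seen_arrival j (l - N0 \<omega>) \<omega>) \<in> borel_measurable (service_algebra j)"
    by (rule nat_indexed_measurable[where f = "seen_arrival j", OF seen_arrival_service]) measurable
  have "(\<lambda>\<omega>. if l < N0 \<omega> then 0 else seen_arrival j (l - N0 \<omega>) \<omega>) \<in> borel_measurable (service_algebra j)"
    by measurable
  moreover have "(if l < N0 \<omega> then 0 else seen_arrival j (l - N0 \<omega>) \<omega>) = entry l \<omega>" if "\<omega> \<in> space (service_algebra j)" for \<omega>
  proof -
    have "\<omega> \<in> space M" using that by simp
    then have "entry l \<omega> \<le> service_start j \<omega>"
      using entry_le_start[of \<omega> l] start_mono[of \<omega> l j] assms by simp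
    then show ?thesis by (auto simp: entry_def seen_arrival_def)
  qed
  ultimately show ?thesis by (rule measurable_cong[THEN iffD1, rotated])
qed

lemma service_start_service:
  assumes "l \<le> j" shows "service_start l \<in> borel_measurable (service_algebra j)"
  using assms
proof (induction l)
  case 0
  then show ?case using entry_service[of 0 j] by (simp cong: measurable_cong)
next
  case (Suc l)
  note [measurable] = Suc.IH[OF Suc_leD[OF Suc.prems]] X_service[OF Suc_le_lessD[OF Suc.prems]] entry_service[OF Suc.prems]
  have "(\<lambda>\<omega>. max (service_start l \<omega> + X l \<omega>) (entry (Suc l) \<omega>)) \<in> borel_measurable (service_algebra j)" by measurable
  then show ?case by (simp cong: measurable_cong)
qed

lemma service_end_service:
  assumes "l < j" shows "service_end l \<in> borel_measurable (service_algebra j)"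
proof -
  note [measurable] = service_start_service[OF less_imp_le[OF assms]] X_service[OF assms]
  show ?thesis unfolding service_end_def[abs_def] by measurable
qed

lemma fresh_start_service:
  assumes "l \<le> j" shows "Measurable.pred (service_algebra j) (fresh_start n l)"
proof -
  note [measurable] = service_start_service[OF assms]
  have eq: "T i \<omega> \<le> service_start j \<omega> \<and> seen_arrival j i \<omega> \<le> service_start l \<omega> \<longleftrightarrow> T i \<omega> \<le> service_start l \<omega>"
    if "\<omega> \<in> space (service_algebra j)" for i \<omega>
    using start_mono[of \<omega> l j] that assms by (auto simp: seen_arrival_def)
  have "Measurable.pred (service_algebra j) (\<lambda>\<omega>. T i \<omega> \<le> service_start j \<omega> \<and> seen_arrival j i \<omega> \<le> service_start l \<omega>)" for i
    by measurable
  then have [measurable]: "Measurable.pred (service_algebra j) (\<lambda>\<omega>. T i \<omega> \<le> service_start l \<omega>)" for i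
    by (rule measurable_cong[THEN iffD1, rotated]) (rule eq)
  have [measurable]: "(\<lambda>\<omega>. card {i. T i \<omega> \<le> service_start l \<omega>}) \<in> measurable (service_algebra j) (count_space UNIV)"
    by (rule measurable_card_initial_segment) (auto simp: T_le_iff)
  show ?thesis
    unfolding fresh_start_def[abs_def] in_system_at_start_def by measurable
qed

lemma hit_in_service_iff:
  assumes "\<omega> \<in> space M" "0 \<le> x"
  shows "hit_in_service x j \<omega> \<longleftrightarrow> (\<exists>i. service_start j \<omega> < T i \<omega> \<and> T i \<omega> < service_end j \<omega> - x)"
  unfolding hit_in_service_def
  using next_arrival_gt[OF assms(1)] next_arrival_le[OF assms(1)]
  unfolding next_arrival_def by (meson le_less_trans)

lemma hit_in_service_service:
  assumes "l < j" "0 \<le> x" shows "Measurable.pred (service_algebra j) (hit_in_service x l)"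
proof -
  note [measurable] = service_start_service[OF less_imp_le[OF assms(1)]] service_end_service[OF assms(1)]
  have "Measurable.pred (service_algebra j) (\<lambda>\<omega>. \<exists>i. T i \<omega> \<le> service_start j \<omega> \<and> service_start l \<omega> < seen_arrival j i \<omega> \<and> seen_arrival j i \<omega> < service_end l \<omega> - x)"
    by measurable
  then show ?thesis
  proof (rule measurable_cong[THEN iffD1, rotated])
    fix \<omega> assume "\<omega> \<in> space (service_algebra j)"
    then have \<omega>: "\<omega> \<in> space M" by simp
    show "(\<exists>i. T i \<omega> \<le> service_start j \<omega> \<and> service_start l \<omega> < seen_arrival j i \<omega> \<and> seen_arrival j i \<omega> < service_end l \<omega> - x) = hit_in_service x l \<omega>"
      unfolding hit_in_service_iff[OF \<omega> assms(2)] seen_arrival_def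
      using end_le_start[OF \<omega> assms(1)] assms(2)
      by (intro ex_cong1) auto
  qed
qed

lemma stopping_time_service_start: "stopping_time (service_start j)"
  unfolding stopping_time_def using start_le_past start_nonneg by simp

lemma service_end_stopped: "service_end j \<in> borel_measurable (stopped_algebra (service_start j))"
  by (rule measurable_stoppedI[OF stopping_time_service_start service_end_measurable, where g = "\<lambda>t. capped_end t j"])
    (auto simp: capped_start_end_past capped_end_def)

lemma subalgebra_service: "subalgebra M (service_algebra j)"
proof -
  note [measurable] = N0_measurable T_measurable X_measurable
  have "past_of_service j \<subseteq> sets M"
    unfolding past_of_service_def by (intro sets.sigma_sets_subset) auto
  then show ?thesis by (simp add: subalgebra_def sets_service_algebra)
qed

text \<open>
  What is known before service \<open>j\<close> commences is known when it commences: both the service law and the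
  exponential clock apply to the same events.
\<close>

lemma past_of_service_stopped: "past_of_service j \<subseteq> sets (stopped_algebra (service_start j))"
proof -
  note [measurable] = N0_measurable T_measurable X_measurable
  have "{{\<omega> \<in> space M. N0 \<omega> = n} | n. True} \<union>
      {{\<omega> \<in> space M. T i \<omega> \<le> s \<and> T i \<omega> \<le> service_start j \<omega>} | i s. True} \<union>
      {{\<omega> \<in> space M. X i \<omega> \<le> x} | i x. i < j} \<subseteq> sets (stopped_algebra (service_start j))" (is "?A \<union> ?B \<union> ?C \<subseteq> _")
  proof (intro Un_least subsetI)
    fix S assume "S \<in> ?A"
    then obtain n where S: "S = {\<omega> \<in> space M. N0 \<omega> = n}" by auto
    have "S \<inter> {\<omega> \<in> space M. service_start j \<omega> \<le> t} \<in> sets (past_algebra t)" for t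
      using past_gen(1)[of n t] start_le_past[of j t] by (simp add: S sets_past_algebra[symmetric] sets.Int)
    then show "S \<in> sets (stopped_algebra (service_start j))"
      by (simp add: sets_stopped_algebra[OF stopping_time_service_start] sets_past_algebra S)
  next
    fix S assume "S \<in> ?B"
    then obtain i s where S: "S = {\<omega> \<in> space M. T i \<omega> \<le> s \<and> T i \<omega> \<le> service_start j \<omega>}" by auto
    have "S \<inter> {\<omega> \<in> space M. service_start j \<omega> \<le> t} \<in> sets (past_algebra t)" if t: "0 \<le> t" for t
    proof -
      note [measurable] = capped_start_end_past[OF t]
      have "S \<inter> {\<omega> \<in> space M. service_start j \<omega> \<le> t} = {\<omega> \<in> space (past_algebra t). T i \<omega> \<le> t \<and> service_start j \<omega> \<le> t \<and>
         (if T i \<omega> \<le> t then T i \<omega> else t + 1) \<le> s \<and> (if T i \<omega> \<le> t then T i \<omega> else t + 1) \<le> capped_start t j \<omega>}"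
        by (auto simp: S capped_start_def)
      also have "\<dots> \<in> sets (past_algebra t)" by measurable
      finally show ?thesis .
    qed
    then show "S \<in> sets (stopped_algebra (service_start j))"
      by (simp add: sets_stopped_algebra[OF stopping_time_service_start] sets_past_algebra) (simp add: S)
  next
    fix S assume "S \<in> ?C"
    then obtain i x where S: "S = {\<omega> \<in> space M. X i \<omega> \<le> x}" and i: "i < j" by auto
    have "S \<inter> {\<omega> \<in> space M. service_start j \<omega> \<le> t} \<in> sets (past_algebra t)" if t: "0 \<le> t" for t
    proof -
      have "S \<inter> {\<omega> \<in> space M. service_start j \<omega> \<le> t} = {\<omega> \<in> space (past_algebra t). service_start j \<omega> \<le> t \<and>
         (if service_start i \<omega> \<le> t then X i \<omega> else 0) \<le> x}"
        using start_mono[of _ i j] i by (fastforce simp: S)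
      also have "\<dots> \<in> sets (past_algebra t)" by measurable
      finally show ?thesis .
    qed
    then show "S \<in> sets (stopped_algebra (service_start j))"
      by (simp add: sets_stopped_algebra[OF stopping_time_service_start] sets_past_algebra) (simp add: S)
  qed
  from sets.sigma_sets_subset[OF this] show ?thesis by (simp add: past_of_service_def)
qed

lemma stopping_time_T: "stopping_time (T i)"
  unfolding stopping_time_def using past_gen(2) T_nonneg T_measurable by auto

lemma T_stopped: "T i \<in> borel_measurable (stopped_algebra (T i))"
  by (rule measurable_stoppedI[OF stopping_time_T T_measurable, where g = "\<lambda>t \<omega>. if T i \<omega> \<le> t then T i \<omega> else t + 1"]) auto

lemma stopped_T_mono:
  assumes "l \<le> k" shows "sets (stopped_algebra (T l)) \<subseteq> sets (stopped_algebra (T k))"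
proof
  fix E assume E: "E \<in> sets (stopped_algebra (T l))"
  have "E \<inter> {\<omega> \<in> space M. T k \<omega> \<le> t} \<in> past t" if t: "0 \<le> t" for t
  proof -
    have "E \<inter> {\<omega> \<in> space M. T k \<omega> \<le> t} = (E \<inter> {\<omega> \<in> space M. T l \<omega> \<le> t}) \<inter> {\<omega> \<in> space M. T k \<omega> \<le> t}"
      using T_monoD[OF _ assms] order_trans by blast
    also have "\<dots> \<in> sets (past_algebra t)"
    proof (rule sets.Int)
      show "E \<inter> {\<omega> \<in> space M. T l \<omega> \<le> t} \<in> sets (past_algebra t)"
        using E t by (simp add: sets_stopped_algebra[OF stopping_time_T] sets_past_algebra)
      show "{\<omega> \<in> space M. T k \<omega> \<le> t} \<in> sets (past_algebra t)"
        using past_gen(2)[of t t k] by (simp add: sets_past_algebra)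
    qed
    finally show ?thesis by (simp add: sets_past_algebra)
  qed
  then show "E \<in> sets (stopped_algebra (T k))"
    using E by (simp add: sets_stopped_algebra[OF stopping_time_T])
qed

lemma measurable_stopped_T_mono:
  "l \<le> k \<Longrightarrow> f \<in> measurable (stopped_algebra (T l)) N \<Longrightarrow> f \<in> measurable (stopped_algebra (T k)) N"
  using measurable_mono[of N N "stopped_algebra (T l)" "stopped_algebra (T k)"] stopped_T_mono[of l k] by auto

text \<open>
  The version of \<open>completed_before i\<close> that is known at time \<open>t\<close>.
\<close>

definition seen_completed :: "real \<Rightarrow> nat \<Rightarrow> 'a \<Rightarrow> nat" where
  "seen_completed t i \<omega> = card {j. capped_end t j \<omega> < (if T i \<omega> \<le> t then T i \<omega> else t + 1)}"

lemma seen_completed_past: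
  assumes t: "0 \<le> t" shows "seen_completed t i \<in> measurable (past_algebra t) (count_space UNIV)"
proof -
  note [measurable] = capped_start_end_past[OF t]
  show ?thesis
    unfolding seen_completed_def[abs_def]
  proof (rule measurable_card_initial_segment)
    fix \<omega> m assume "\<omega> \<in> space (past_algebra t)"
    then have \<omega>: "\<omega> \<in> space M" by simp
    define c where "c = (if T i \<omega> \<le> t then T i \<omega> else t + 1)"
    have c: "c \<le> t + 1" by (simp add: c_def)
    have iff: "capped_end t j \<omega> < c \<longleftrightarrow> service_start j \<omega> \<le> t \<and> service_end j \<omega> < c" for j
      using c by (auto simp: capped_end_def)
    have "m < card {j. capped_end t j \<omega> < c} \<longleftrightarrow> capped_end t m \<omega> < c"
      unfolding iff
    proof (rule less_card_initial_segment)
      show "finite {j. service_start j \<omega> \<le> t \<and> service_end j \<omega> < c}"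
        by (rule finite_subset[OF _ finite_start_le[OF \<omega>, of t]]) auto
    next
      fix k j assume "service_start k \<omega> \<le> t \<and> service_end k \<omega> < c" "j \<le> k"
      then show "service_start j \<omega> \<le> t \<and> service_end j \<omega> < c"
        using start_mono[OF \<omega>, of j k] end_mono[OF \<omega>, of j k] by simp
    qed
    then show "m < card {j. capped_end t j \<omega> < (if T i \<omega> \<le> t then T i \<omega> else t + 1)} \<longleftrightarrow>
       capped_end t m \<omega> < (if T i \<omega> \<le> t then T i \<omega> else t + 1)"
      by (simp add: c_def)
  qed measurable
qed

lemma seen_completed_eq:
  assumes \<omega>: "\<omega> \<in> space M" and t: "T i \<omega> \<le> t"
  shows "seen_completed t i \<omega> = completed_before i \<omega>"
proof -
  have "capped_end t j \<omega> < T i \<omega> \<longleftrightarrow> service_end j \<omega> < T i \<omega>" for j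
    using t start_le_end[OF \<omega>, of j] by (auto simp: capped_end_def)
  then show ?thesis using t by (simp add: seen_completed_def completed_before_def)
qed

lemma completed_before_stopped: "completed_before i \<in> measurable (stopped_algebra (T i)) (count_space UNIV)"
  by (rule measurable_stoppedI[OF stopping_time_T completed_before_measurable, where g = "\<lambda>t. seen_completed t i"])
    (auto simp: seen_completed_past seen_completed_eq)

lemma N0_stopped: "N0 \<in> measurable (stopped_algebra (T i)) (count_space UNIV)"
  by (rule measurable_stoppedI[OF stopping_time_T N0_measurable, where g = "\<lambda>t. N0"]) auto

lemma found_stopped: "found i \<in> measurable (stopped_algebra (T i)) (count_space UNIV)"
proof -
  note [measurable] = completed_before_stopped N0_stopped
  show ?thesis unfolding found_def[abs_def] by measurable
qed

text \<open>
  If the arrival finds an empty system there is no service in progress; the default keeps the variable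
  known at the arrival.
\<close>

definition current_service_end :: "nat \<Rightarrow> 'a \<Rightarrow> real" where
  "current_service_end i \<omega> = (if 0 < found i \<omega> then service_end (completed_before i \<omega>) \<omega> else T i \<omega>)"

lemma start_le_of_found_pos:
  assumes \<omega>: "\<omega> \<in> space M" and found: "0 < found i \<omega>"
  shows "service_start (completed_before i \<omega>) \<omega> \<le> T i \<omega>"
proof -
  define c where "c = completed_before i \<omega>"
  have c: "c < N0 \<omega> + i" using found by (simp add: found_def c_def)
  then have "entry c \<omega> \<le> T i \<omega>"
    using T_nonneg[OF \<omega>] by (auto simp: entry_def intro!: T_monoD[OF \<omega>])
  moreover have "service_end c' \<omega> < T i \<omega>" if "c' < c" for c'
    using that completed_iff[OF \<omega>, of c' i] by (simp add: c_def)
  ultimately have "service_start c \<omega> \<le> T i \<omega>"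
    by (cases c) (auto simp: service_end_def less_imp_le)
  then show ?thesis by (simp add: c_def)
qed

lemma current_service_end_stopped: "current_service_end i \<in> borel_measurable (stopped_algebra (T i))"
proof -
  define g where "g t \<omega> = (if 0 < N0 \<omega> + i - seen_completed t i \<omega> then capped_end t (seen_completed t i \<omega>) \<omega>
     else (if T i \<omega> \<le> t then T i \<omega> else t + 1))" for t \<omega>
  show ?thesis
  proof (rule measurable_stoppedI[OF stopping_time_T, where g = g])
    note [measurable] = T_measurable
    have [measurable]: "(\<lambda>\<omega>. service_end (completed_before i \<omega>) \<omega>) \<in> borel_measurable M"
      by (rule nat_indexed_measurable[where f = service_end]) measurable
    show "current_service_end i \<in> borel_measurable M" unfolding current_service_end_def[abs_def] by measurable
    show "g t \<in> borel_measurable (past_algebra t)" if t: "0 \<le> t" for t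
    proof -
      note [measurable] = seen_completed_past[OF t] capped_start_end_past[OF t]
      have [measurable]: "(\<lambda>\<omega>. capped_end t (seen_completed t i \<omega>) \<omega>) \<in> borel_measurable (past_algebra t)"
        by (rule nat_indexed_measurable[where f = "capped_end t"]) measurable
      show ?thesis unfolding g_def[abs_def] by measurable
    qed
    show "g t \<omega> = current_service_end i \<omega>" if "0 \<le> t" "\<omega> \<in> space M" "T i \<omega> \<le> t" for t \<omega>
      using start_le_of_found_pos[OF that(2), of i] that
      by (auto simp: g_def current_service_end_def seen_completed_eq found_def capped_end_def)
  qed
qed

lemma hit_after_arrival_stopped:
  "Measurable.pred (stopped_algebra (T (Suc i))) (\<lambda>\<omega>. 0 < found i \<omega> \<and> hit_after_arrival x i \<omega>)"
proof -
  note [measurable] = measurable_stopped_T_mono[OF le_SucI[OF order_refl] found_stopped, of i]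
    measurable_stopped_T_mono[OF le_SucI[OF order_refl] current_service_end_stopped, of i] T_stopped[of "Suc i"]
  have "Measurable.pred (stopped_algebra (T (Suc i))) (\<lambda>\<omega>. 0 < found i \<omega> \<and> T (Suc i) \<omega> < current_service_end i \<omega> - x)"
    by measurable
  also have "(\<lambda>\<omega>. 0 < found i \<omega> \<and> T (Suc i) \<omega> < current_service_end i \<omega> - x) = (\<lambda>\<omega>. 0 < found i \<omega> \<and> hit_after_arrival x i \<omega>)"
    by (auto simp: hit_after_arrival_def current_service_end_def)
  finally show ?thesis .
qed

end

context MnGn1_queue
begin

text \<open>
  Conditionally on an event before the service, its duration has the CDF \<open>G n\<close>, and a CDF determines the
  law.
\<close>

lemma expectation_service_time:
  fixes f :: "real \<Rightarrow> real"
  assumes n: "1 \<le> n" and E: "E \<in> past_of_service j" and fresh: "E \<subseteq> {\<omega> \<in> space M. fresh_start n j \<omega>}"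
    and G: "service_cdf (G n)" and f[measurable]: "f \<in> borel_measurable borel"
  shows "(LINT \<omega>:E|M. f (X j \<omega>)) = prob E * (LINT v|interval_measure (G n). f v)"
proof -
  note [measurable] = X_measurable
  have EM[measurable]: "E \<in> sets M"
    using E subalgebra_service[of j] by (auto simp: subalgebra_def sets_service_algebra)
  show ?thesis
  proof (cases "prob E = 0")
    case True
    then have "AE \<omega> in M. \<omega> \<notin> E" by (simp add: prob_eq_0)
    then have "(LINT \<omega>:E|M. f (X j \<omega>)) = (LINT \<omega>|M. 0)"
      unfolding set_lebesgue_integral_def by (intro integral_cong_AE) (auto elim: eventually_mono)
    with True show ?thesis by simp
  next
    case False
    then have pos: "0 < prob E" by (simp add: zero_less_measure_iff)
    \<comment> \<open>The probability measure conditioned on \<open>E\<close>.\<close>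
    define U where "U = density M (\<lambda>\<omega>. ennreal (indicat_real E \<omega> / prob E))"
    have int_U: "(LINT \<omega>|U. g \<omega>) = (LINT \<omega>:E|M. g \<omega>) / prob E" if [measurable]: "g \<in> borel_measurable M" for g :: "'a \<Rightarrow> real"
    proof -
      have "(LINT \<omega>|U. g \<omega>) = (LINT \<omega>|M. indicat_real E \<omega> / prob E * g \<omega>)"
        unfolding U_def using pos by (subst integral_real_density) auto
      also have "\<dots> = (LINT \<omega>:E|M. g \<omega>) / prob E"
        unfolding set_lebesgue_integral_def by (simp add: field_simps)
      finally show ?thesis .
    qed
    have U_sets[measurable_cong]: "sets U = sets M" and U_sp: "space U = space M" by (auto simp: U_def)
    have meas_U: "emeasure U A = ennreal (prob (E \<inter> A) / prob E)" if A[measurable]: "A \<in> sets M" for A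
    proof -
      have "emeasure U A = (\<integral>\<^sup>+\<omega>. ennreal (indicat_real (E \<inter> A) \<omega> / prob E) \<partial>M)"
        unfolding U_def by (subst emeasure_density) (auto intro!: nn_integral_cong simp: indicator_def)
      also have "\<dots> = ennreal (LINT \<omega>|M. indicat_real (E \<inter> A) \<omega> / prob E)"
        by (intro nn_integral_eq_integral) (auto simp: less_top[symmetric])
      also have "\<dots> = ennreal (prob (E \<inter> A) / prob E)" by simp
      finally show ?thesis .
    qed
    have "prob_space U"
    proof
      have "E \<inter> space M = E" using sets.sets_into_space[OF EM] by auto
      then show "emeasure U (space U) = 1" using meas_U[of "space M"] pos by (simp add: U_sp)
    qed
    then interpret U: prob_space U .
    define \<nu> where "\<nu> = distr U borel (X j)"
    have "real_distribution \<nu>" unfolding \<nu>_def by (rule U.real_distribution_distr) simp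
    moreover note service_cdf_interval_measure(1,2)[OF G]
    moreover have "cdf \<nu> = G n"
    proof
      fix y
      have "cdf \<nu> y = measure U {\<omega> \<in> space M. X j \<omega> \<le> y}"
        by (simp add: cdf_def2 \<nu>_def measure_distr vimage_def Int_def conj_commute U_sp)
      also have "\<dots> = prob (E \<inter> {\<omega> \<in> space M. X j \<omega> \<le> y}) / prob E"
        using meas_U[of "{\<omega> \<in> space M. X j \<omega> \<le> y}"] by (simp add: measure_def)
      also have "\<dots> = G n y"
        using service_law[OF n E, of y] fresh pos by (auto simp: fresh_start_def subset_eq)
      finally show "cdf \<nu> y = G n y" .
    qed
    ultimately have "\<nu> = interval_measure (G n)" by (intro cdf_unique) auto
    moreover have "(LINT v|\<nu>. f v) = (LINT \<omega>|U. f (X j \<omega>))"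
      unfolding \<nu>_def by (rule integral_distr[OF _ f]) measurable
    ultimately have "(LINT v|interval_measure (G n). f v) = (LINT \<omega>|U. f (X j \<omega>))" by simp
    then show ?thesis using int_U[of "\<lambda>\<omega>. f (X j \<omega>)"] pos by simp
  qed
qed

text \<open>
  The clock gives the probability conditionally on the duration, and the service law averages over the
  duration.
\<close>

lemma prob_hit_in_service:
  assumes n: "1 \<le> n" and E: "E \<in> past_of_service j" and fresh: "E \<subseteq> {\<omega> \<in> space M. fresh_start n j \<omega>}"
    and G: "service_cdf (G n)" and lam: "0 < lam n" and x: "0 \<le> x"
  shows "prob (E \<inter> {\<omega> \<in> space M. hit_in_service x j \<omega>}) = excess_tail (lam n) (G n) x * prob E"
proof -
  have "prob (E \<inter> {\<omega> \<in> space M. hit_in_service x j \<omega>}) =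
     (LINT \<omega>:E|M. exponential_cdf (lam n) (service_end j \<omega> - service_start j \<omega> - x))"
    unfolding hit_in_service_def
  proof (rule prob_arrival_during_sojourn[OF stopping_time_service_start service_end_stopped _ x lam])
    show "E \<in> sets (stopped_algebra (service_start j))" using E past_of_service_stopped by blast
    show "AE \<omega> in M. \<omega> \<in> E \<longrightarrow> (\<forall>u\<ge>service_start j \<omega>. u < service_end j \<omega> \<longrightarrow>
       u < next_arrival (service_start j \<omega>) \<omega> \<longrightarrow> in_system u \<omega> = n)"
    proof (intro AE_I2 impI allI)
      fix \<omega> u assume \<omega>: "\<omega> \<in> space M" and w: "\<omega> \<in> E" and u: "service_start j \<omega> \<le> u" "u < service_end j \<omega>"
         "u < next_arrival (service_start j \<omega>) \<omega>"
      have "in_system u \<omega> = in_system (service_start j \<omega>) \<omega>"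
        using u by (intro in_system_until_next_event[OF \<omega>, of j]) auto
      also have "\<dots> = in_system_at_start j \<omega>"
        using in_system_in_progress[OF \<omega>, of j "service_start j \<omega>"] u by (simp add: in_system_at_start_def)
      also have "\<dots> = n" using fresh w by (auto simp: fresh_start_def)
      finally show "in_system u \<omega> = n" .
    qed
  qed
  also have "\<dots> = (LINT \<omega>:E|M. exponential_cdf (lam n) (X j \<omega> - x))"
    by (simp add: service_end_def)
  also have "\<dots> = excess_tail (lam n) (G n) x * prob E"
    using expectation_service_time[OF n E fresh G, of "\<lambda>v. exponential_cdf (lam n) (v - x)"]
    by (simp add: excess_tail_def)
  finally show ?thesis .
qed

text \<open>
  The filtration consists of the events before the commencement of the successive services.
\<close>

theorem services_hit_frequency:
  assumes n: "1 \<le> n" and G: "service_cdf (G n)" and lam: "0 < lam n" and x: "0 \<le> x"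
  shows "AE \<omega> in M. filterlim (\<lambda>J. \<Sum>j<J. of_bool (fresh_start n j \<omega>) :: nat) at_top sequentially \<longrightarrow>
     (\<lambda>J. (\<Sum>j<J. of_bool (fresh_start n j \<omega> \<and> hit_in_service x j \<omega>)) / real (\<Sum>j<J. of_bool (fresh_start n j \<omega>)))
       \<longlonglongrightarrow> excess_tail (lam n) (G n) x"
proof -
  define g where "g = excess_tail (lam n) (G n) x"
  have g: "0 \<le> g" "g \<le> 1"
    using excess_tail_nonneg[OF lam G] excess_tail_less_1[OF lam G] by (auto simp: g_def less_imp_le)
  define \<xi> where "\<xi> j \<omega> = of_bool (hit_in_service x j \<omega>) - g" for j \<omega>
  have "AE \<omega> in M. filterlim (\<lambda>J. \<Sum>j<J. of_bool (fresh_start n j \<omega>) :: nat) at_top sequentially \<longrightarrow>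
     (\<lambda>J. (\<Sum>j<J. of_bool (fresh_start n j \<omega>) * \<xi> j \<omega>) / real (\<Sum>j<J. of_bool (fresh_start n j \<omega>))) \<longlonglongrightarrow> 0"
  proof (rule selected_average_tendsto_0[where F = service_algebra])
    show "subalgebra M (service_algebra k)" for k by (rule subalgebra_service)
    show "Measurable.pred (service_algebra k) (fresh_start n l)" if "l \<le> k" for l k
      using that by (rule fresh_start_service)
    show "\<xi> l \<in> borel_measurable (service_algebra k)" if "l < k" for l k
    proof -
      note [measurable] = hit_in_service_service[OF that x]
      show ?thesis unfolding \<xi>_def[abs_def] by measurable
    qed
    show "\<bar>\<xi> k \<omega>\<bar> \<le> 1" for k \<omega> using g by (auto simp: \<xi>_def split: split_of_bool)
    show "(LINT \<omega>:E|M. \<xi> k \<omega>) = 0"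
      if E: "E \<in> sets (service_algebra k)" and sub: "E \<subseteq> {\<omega> \<in> space M. fresh_start n k \<omega>}" for k E
    proof -
      have EM[measurable]: "E \<in> sets M" using E subalgebra_service[of k] by (auto simp: subalgebra_def)
      have H[measurable]: "Measurable.pred M (hit_in_service x k)"
        using measurable_from_subalg[OF subalgebra_service hit_in_service_service[OF lessI x]] .
      have "(LINT \<omega>:E|M. \<xi> k \<omega>) = (LINT \<omega>|M. indicat_real (E \<inter> {\<omega> \<in> space M. hit_in_service x k \<omega>}) \<omega> - g * indicat_real E \<omega>)"
        unfolding set_lebesgue_integral_def
        by (intro Bochner_Integration.integral_cong[OF refl]) (auto simp: \<xi>_def indicator_def)
      also have "\<dots> = prob (E \<inter> {\<omega> \<in> space M. hit_in_service x k \<omega>}) - g * prob E"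
      proof -
        have "E \<inter> {\<omega> \<in> space M. hit_in_service x k \<omega>} \<in> sets M" by measurable
        then show ?thesis by (subst Bochner_Integration.integral_diff) (auto simp: less_top[symmetric])
      qed
      also have "\<dots> = 0"
        using prob_hit_in_service[OF n _ sub G lam x] E by (simp add: sets_service_algebra g_def)
      finally show ?thesis .
    qed
  qed
  then show ?thesis
  proof (eventually_elim, intro impI)
    case (elim \<omega>)
    assume lim: "filterlim (\<lambda>J. \<Sum>j<J. of_bool (fresh_start n j \<omega>) :: nat) at_top sequentially"
    define S where "S J = (\<Sum>j<J. of_bool (fresh_start n j \<omega>) :: nat)" for J
    define U where "U J = (\<Sum>j<J. of_bool (fresh_start n j \<omega> \<and> hit_in_service x j \<omega>) :: real)" for J
    have pos: "eventually (\<lambda>J. 0 < S J) sequentially"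
      using lim eventually_gt_at_top[of 0] unfolding filterlim_iff S_def by blast
    have sum: "(\<Sum>j<J. of_bool (fresh_start n j \<omega>) * \<xi> j \<omega>) = U J - g * real (S J)" for J
      unfolding U_def S_def of_nat_sum sum_distrib_left sum_subtractf[symmetric]
      by (intro sum.cong) (auto simp: \<xi>_def)
    have "(\<lambda>J. (U J - g * real (S J)) / real (S J)) \<longlonglongrightarrow> 0"
      using elim lim unfolding sum by (simp only: S_def)
    then have "(\<lambda>J. (U J - g * real (S J)) / real (S J) + g) \<longlonglongrightarrow> 0 + g"
      by (intro tendsto_intros)
    then have "(\<lambda>J. U J / real (S J)) \<longlonglongrightarrow> 0 + g"
      by (rule Lim_transform_eventually) (use pos in \<open>eventually_elim, simp add: field_simps\<close>)
    then show "(\<lambda>J. (\<Sum>j<J. of_bool (fresh_start n j \<omega> \<and> hit_in_service x j \<omega>)) / real (\<Sum>j<J. of_bool (fresh_start n j \<omega>)))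
       \<longlonglongrightarrow> excess_tail (lam n) (G n) x"
      by (simp add: U_def S_def g_def)
  qed
qed

text \<open>
  The arrival that finds \<open>n\<close> customers brings the queue into state \<open>Suc n\<close>, hence the rate
  \<open>lam (Suc n)\<close>.
\<close>

lemma prob_hit_after_arrival:
  assumes n: "1 \<le> n" and E: "E \<in> sets (stopped_algebra (T i))" and sub: "E \<subseteq> {\<omega> \<in> space M. found i \<omega> = n}"
    and lam: "0 < lam (Suc n)" and x: "0 \<le> x"
  shows "prob (E \<inter> {\<omega> \<in> space M. hit_after_arrival x i \<omega>}) =
    (LINT \<omega>:E|M. exponential_cdf (lam (Suc n)) (residual i \<omega> - x))"
proof -
  note [measurable] = T_measurable
  have EM[measurable]: "E \<in> sets M" using E subalgebra_stopped[OF stopping_time_T] by (auto simp: subalgebra_def)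
  have current: "current_service_end i \<omega> = service_end (completed_before i \<omega>) \<omega>" if "\<omega> \<in> E" for \<omega>
    using sub that n by (auto simp: current_service_end_def)
  have [measurable]: "(\<lambda>\<omega>. service_end (completed_before i \<omega>) \<omega>) \<in> borel_measurable M"
    by (rule nat_indexed_measurable[where f = service_end]) measurable
  have next_T: "next_arrival (T i \<omega>) \<omega> = T (Suc i) \<omega>" if "\<omega> \<in> space M" "T i \<omega> < T (Suc i) \<omega>" for \<omega>
    using that by (intro next_arrival_between) (auto intro: T_monoD)
  have [measurable]: "(\<lambda>\<omega>. next_arrival (T i \<omega>) \<omega>) \<in> borel_measurable M"
    by (rule next_arrival_stopped_measurable[OF stopping_time_T])
  have [measurable]: "current_service_end i \<in> borel_measurable M"
    using measurable_from_subalg[OF subalgebra_stopped[OF stopping_time_T] current_service_end_stopped] .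
  have "prob (E \<inter> {\<omega> \<in> space M. hit_after_arrival x i \<omega>}) =
      prob (E \<inter> {\<omega> \<in> space M. next_arrival (T i \<omega>) \<omega> < current_service_end i \<omega> - x})"
  proof (rule finite_measure_eq_AE)
    show "AE \<omega> in M. (\<omega> \<in> E \<inter> {\<omega> \<in> space M. hit_after_arrival x i \<omega>}) =
       (\<omega> \<in> E \<inter> {\<omega> \<in> space M. next_arrival (T i \<omega>) \<omega> < current_service_end i \<omega> - x})"
      using arrivals_strictly_increasing AE_space
      by eventually_elim (auto simp: hit_after_arrival_def next_T current)
  qed (unfold hit_after_arrival_def, auto intro!: sets.Int)
  also have "\<dots> = (LINT \<omega>:E|M. exponential_cdf (lam (Suc n)) (current_service_end i \<omega> - T i \<omega> - x))"
  proof (rule prob_arrival_during_sojourn[OF stopping_time_T current_service_end_stopped E x lam])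
    show "AE \<omega> in M. \<omega> \<in> E \<longrightarrow> (\<forall>u\<ge>T i \<omega>. u < current_service_end i \<omega> \<longrightarrow>
       u < next_arrival (T i \<omega>) \<omega> \<longrightarrow> in_system u \<omega> = Suc n)"
      using arrivals_strictly_increasing AE_space
    proof (eventually_elim, intro impI allI)
      fix \<omega> u assume strict: "0 < T 0 \<omega> \<and> (\<forall>i. T i \<omega> < T (Suc i) \<omega>)" and \<omega>: "\<omega> \<in> space M" and w: "\<omega> \<in> E"
        and u: "T i \<omega> \<le> u" "u < current_service_end i \<omega>" "u < next_arrival (T i \<omega>) \<omega>"
      have found: "found i \<omega> = n" using sub w by auto
      have "T m \<omega> \<le> T i \<omega> \<longleftrightarrow> m < Suc i" for m
      proof (cases "m < Suc i")
        case True
        then show ?thesis by (auto intro!: T_monoD[OF \<omega>])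
      next
        case False
        then have "T (Suc i) \<omega> \<le> T m \<omega>" by (intro T_monoD[OF \<omega>]) simp
        then show ?thesis using False strict by (auto simp: not_le intro: less_le_trans)
      qed
      then have "{m. T m \<omega> \<le> T i \<omega>} = {..<Suc i}" by auto
      then have "{m. T m \<omega> \<le> u} = {..<Suc i}" using next_arrival_eq[OF \<omega> u(1,3)] by simp
      then have "in_system u \<omega> = N0 \<omega> + Suc i - completed_before i \<omega>"
        using in_system_in_progress[OF \<omega>, of "completed_before i \<omega>" u] u
          start_le_of_found_pos[OF \<omega>, of i] found n current[OF w] by simp
      also have "\<dots> = Suc n"
        using found completed_le[OF \<omega>, of i] by (simp add: found_def)
      finally show "in_system u \<omega> = Suc n" .
    qed
  qed
  also have "\<dots> = (LINT \<omega>:E|M. exponential_cdf (lam (Suc n)) (residual i \<omega> - x))"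
    unfolding set_lebesgue_integral_def
    by (intro Bochner_Integration.integral_cong[OF refl]) (auto simp: indicator_def residual_def current)
  finally show ?thesis .
qed

text \<open>
  Here the success probabilities vary with the residual that the arrival sees, so only the difference
  between successes and the sum of these probabilities is negligible.
\<close>

theorem arrivals_hit_frequency:
  assumes n: "1 \<le> n" and lam: "0 < lam (Suc n)" and x: "0 \<le> x"
  shows "AE \<omega> in M. filterlim (\<lambda>k. \<Sum>i<k. of_bool (found i \<omega> = n) :: nat) at_top sequentially \<longrightarrow>
     (\<lambda>k. ((\<Sum>i<k. of_bool (found i \<omega> = n \<and> hit_after_arrival x i \<omega>)) -
           (\<Sum>i<k. of_bool (found i \<omega> = n) * exponential_cdf (lam (Suc n)) (residual i \<omega> - x)))
          / real (\<Sum>i<k. of_bool (found i \<omega> = n))) \<longlonglongrightarrow> 0"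
proof -
  define q where "q i \<omega> = exponential_cdf (lam (Suc n)) (current_service_end i \<omega> - T i \<omega> - x)" for i \<omega>
  define \<xi> where "\<xi> i \<omega> = of_bool (0 < found i \<omega> \<and> hit_after_arrival x i \<omega>) - q i \<omega>" for i \<omega>
  have q_res: "q i \<omega> = exponential_cdf (lam (Suc n)) (residual i \<omega> - x)" if "found i \<omega> = n" for i \<omega>
    using that n by (simp add: q_def residual_def current_service_end_def)
  have q_bound: "\<bar>q i \<omega>\<bar> \<le> 1" for i \<omega>
    using exponential_cdf_bounds[OF lam] by (simp add: q_def)
  have q_meas: "q i \<in> borel_measurable (stopped_algebra (T i))" for i
  proof -
    note [measurable] = current_service_end_stopped T_stopped
    show ?thesis unfolding q_def[abs_def] by measurable
  qed
  have \<xi>_meas: "\<xi> l \<in> borel_measurable (stopped_algebra (T k))" if "l < k" for l k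
  proof -
    note [measurable] = hit_after_arrival_stopped[of l x] measurable_stopped_T_mono[OF le_SucI[OF order_refl] q_meas, of l]
    have "\<xi> l \<in> borel_measurable (stopped_algebra (T (Suc l)))" unfolding \<xi>_def[abs_def] by measurable
    then show ?thesis using that by (intro measurable_stopped_T_mono[of "Suc l" k]) auto
  qed
  have "AE \<omega> in M. filterlim (\<lambda>k. \<Sum>i<k. of_bool (found i \<omega> = n) :: nat) at_top sequentially \<longrightarrow>
     (\<lambda>k. (\<Sum>i<k. of_bool (found i \<omega> = n) * \<xi> i \<omega>) / real (\<Sum>i<k. of_bool (found i \<omega> = n))) \<longlonglongrightarrow> 0"
  proof (rule selected_average_tendsto_0[where F = "\<lambda>k. stopped_algebra (T k)" and e = "\<lambda>i \<omega>. found i \<omega> = n"])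
    show "subalgebra M (stopped_algebra (T k))" for k by (rule subalgebra_stopped[OF stopping_time_T])
    show "Measurable.pred (stopped_algebra (T k)) (\<lambda>\<omega>. found l \<omega> = n)" if "l \<le> k" for l k
    proof -
      note [measurable] = measurable_stopped_T_mono[OF that found_stopped]
      show ?thesis by measurable
    qed
    show "\<xi> l \<in> borel_measurable (stopped_algebra (T k))" if "l < k" for l k using that by (rule \<xi>_meas)
    show "\<bar>\<xi> k \<omega>\<bar> \<le> 1" for k \<omega>
    proof -
      have "0 \<le> q k \<omega>" "q k \<omega> \<le> 1" using exponential_cdf_bounds[OF lam] by (auto simp: q_def)
      then show ?thesis by (auto simp: \<xi>_def split: split_of_bool)
    qed
    show "(LINT \<omega>:E|M. \<xi> k \<omega>) = 0"
      if E: "E \<in> sets (stopped_algebra (T k))" and sub: "E \<subseteq> {\<omega> \<in> space M. found k \<omega> = n}" for k E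
    proof -
      have EM[measurable]: "E \<in> sets M" using E subalgebra_stopped[OF stopping_time_T] by (auto simp: subalgebra_def)
      have [measurable]: "Measurable.pred M (\<lambda>\<omega>. 0 < found k \<omega> \<and> hit_after_arrival x k \<omega>)"
        using measurable_from_subalg[OF subalgebra_stopped[OF stopping_time_T] hit_after_arrival_stopped] .
      have [measurable]: "q k \<in> borel_measurable M"
        using measurable_from_subalg[OF subalgebra_stopped[OF stopping_time_T] q_meas] .
      define H where "H = E \<inter> {\<omega> \<in> space M. hit_after_arrival x k \<omega>}"
      have "H = E \<inter> {\<omega> \<in> space M. 0 < found k \<omega> \<and> hit_after_arrival x k \<omega>}"
        using sub n by (auto simp: H_def)
      also have "\<dots> \<in> sets M" by measurable
      finally have H[measurable]: "H \<in> sets M" .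
      have int: "integrable M (\<lambda>\<omega>. indicat_real E \<omega> *\<^sub>R q k \<omega>)"
        by (rule integrable_mult_indicator[OF EM], rule integrable_const_bound[where B = 1])
          (auto simp: q_bound)
      have "(LINT \<omega>:E|M. \<xi> k \<omega>) = (LINT \<omega>|M. indicat_real H \<omega> - indicat_real E \<omega> *\<^sub>R q k \<omega>)"
        unfolding set_lebesgue_integral_def
        by (intro Bochner_Integration.integral_cong[OF refl]) (use sub n in \<open>auto simp: \<xi>_def indicator_def H_def\<close>)
      also have "\<dots> = prob H - (LINT \<omega>:E|M. q k \<omega>)"
        unfolding set_lebesgue_integral_def
        by (subst Bochner_Integration.integral_diff[OF _ int]) (auto simp: less_top[symmetric])
      also have "(LINT \<omega>:E|M. q k \<omega>) = (LINT \<omega>:E|M. exponential_cdf (lam (Suc n)) (residual k \<omega> - x))"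
        unfolding set_lebesgue_integral_def
        by (intro Bochner_Integration.integral_cong[OF refl]) (use sub in \<open>auto simp: indicator_def q_res\<close>)
      also have "\<dots> = prob H"
        unfolding H_def by (rule prob_hit_after_arrival[OF n E sub lam x, symmetric])
      finally show ?thesis by simp
    qed
  qed
  moreover have "(\<Sum>i<k. of_bool (found i \<omega> = n) * \<xi> i \<omega>) =
     (\<Sum>i<k. of_bool (found i \<omega> = n \<and> hit_after_arrival x i \<omega>)) -
     (\<Sum>i<k. of_bool (found i \<omega> = n) * exponential_cdf (lam (Suc n)) (residual i \<omega> - x))" for k \<omega>
    unfolding sum_subtractf[symmetric] using n by (intro sum.cong) (auto simp: \<xi>_def q_res)
  ultimately show ?thesis by simp
qed

end

section \<open>Counting arrivals and services along a path\<close>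

lemma count_filterlim_iff:
  fixes P :: "nat \<Rightarrow> bool"
  shows "filterlim (\<lambda>k. \<Sum>i<k. of_bool (P i) :: nat) at_top sequentially \<longleftrightarrow> (\<exists>\<^sub>\<infinity>i. P i)"
proof -
  have mono: "mono (\<lambda>k. \<Sum>i<k. of_bool (P i) :: nat)"
    by (intro monoI sum_mono2) auto
  have "eventually (\<lambda>k. Z \<le> (\<Sum>i<k. of_bool (P i) :: nat)) sequentially" if inf: "\<exists>\<^sub>\<infinity>i. P i" for Z
  proof (induction Z)
    case (Suc Z)
    then obtain k where k: "Z \<le> (\<Sum>i<k. of_bool (P i) :: nat)" by (auto simp: eventually_sequentially)
    from inf obtain i where i: "k \<le> i" "P i" by (auto simp: INFM_nat_le)
    have "Suc Z \<le> (\<Sum>i<Suc i. of_bool (P i) :: nat)"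
      using k monoD[OF mono i(1)] i(2) by simp
    then show ?case
      using monoD[OF mono] by (intro eventually_sequentiallyI[of "Suc i"]) (meson order_trans)
  qed simp
  moreover have "\<exists>\<^sub>\<infinity>i. P i" if lim: "filterlim (\<lambda>k. \<Sum>i<k. of_bool (P i) :: nat) at_top sequentially"
  proof (rule ccontr)
    assume "\<not> (\<exists>\<^sub>\<infinity>i. P i)"
    then obtain m where m: "\<And>i. m \<le> i \<Longrightarrow> \<not> P i" by (auto simp: INFM_nat_le)
    have bound: "(\<Sum>i<k. of_bool (P i) :: nat) \<le> m" for k
    proof -
      have "(\<Sum>i<k. of_bool (P i) :: nat) \<le> (\<Sum>i<m + k. of_bool (P i))" by (intro monoD[OF mono]) simp
      also have "\<dots> = (\<Sum>i<m. of_bool (P i))"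
        by (intro sum.mono_neutral_right) (auto simp: m)
      also have "\<dots> \<le> (\<Sum>i<m. 1)" by (intro sum_mono) auto
      finally show ?thesis by simp
    qed
    have "eventually (\<lambda>k. Suc m \<le> (\<Sum>i<k. of_bool (P i) :: nat)) sequentially"
      using lim by (simp only: filterlim_at_top)
    then show False using bound by (auto simp: eventually_sequentially) (meson Suc_n_not_le_n order_refl order_trans)
  qed
  ultimately show ?thesis by (auto simp: filterlim_at_top)
qed

lemma sum_of_bool_eq_point:
  fixes a b :: nat
  shows "(\<Sum>j=a..<b. of_bool (P j \<and> j = c)) = (of_bool (a \<le> c \<and> c < b \<and> P c) :: 'b :: semiring_1)"
proof -
  have "(\<Sum>j=a..<b. of_bool (P j \<and> j = c) :: 'b) = (\<Sum>j=a..<b. if j = c then of_bool (P c) else 0)"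
    by (intro sum.cong) auto
  then show ?thesis by (auto simp: sum.delta)
qed

lemma constant_of_Suc:
  fixes h :: "nat \<Rightarrow> 'b"
  assumes "\<And>i. h (Suc i) = h i"
  shows "h i = h 0"
  using assms by (induction i) auto

context single_server_queue
begin

context
  fixes \<omega>
  assumes \<omega>: "\<omega> \<in> space M" and pos: "0 < T 0 \<omega>" and strict: "\<And>i. T i \<omega> < T (Suc i) \<omega>"
begin

text \<open>
  Just before an arrival the services begun are the completed ones and the one in progress, if any.  The latter has begun
  strictly before, because no two arrivals coincide.
\<close>

lemma started_eq: "started_before i \<omega> = completed_before i \<omega> + of_bool (0 < found i \<omega>)"
proof -
  define c where "c = completed_before i \<omega>"
  have iff: "m < started_before i \<omega> \<longleftrightarrow> m < c + of_bool (0 < found i \<omega>)" for m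
  proof -
    consider "m < c" | "m = c" | "c < m" by linarith
    then show ?thesis
    proof cases
      case 1
      then have "service_end m \<omega> < T i \<omega>" by (simp add: c_def completed_iff[OF \<omega>])
      then have "service_start m \<omega> < T i \<omega>" using start_le_end[OF \<omega>] le_less_trans by blast
      then show ?thesis using 1 by (simp add: started_iff[OF \<omega>])
    next
      case 2
      show ?thesis
      proof (cases "0 < found i \<omega>")
        case True
        then show ?thesis using 2 start_less_of_found_pos[OF \<omega> pos strict True]
          by (simp add: started_iff[OF \<omega>] c_def)
      next
        case False
        then have "c = N0 \<omega> + i" using completed_le[OF \<omega>, of i] by (simp add: found_def c_def)
        then have "T i \<omega> \<le> service_start c \<omega>"
          using entry_le_T[OF \<omega>, of i] entry_le_start[OF \<omega>, of c] by simp
        then show ?thesis using 2 False by (simp add: started_iff[OF \<omega>])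
      qed
    next
      case 3
      have "T i \<omega> \<le> service_end c \<omega>" using end_completed[OF \<omega>] by (simp add: c_def)
      also have "\<dots> \<le> service_start m \<omega>" using 3 by (rule end_le_start[OF \<omega>])
      finally show ?thesis using 3 by (simp add: started_iff[OF \<omega>])
    qed
  qed
  from iff[of "started_before i \<omega>"] iff[of "c + of_bool (0 < found i \<omega>)"] show ?thesis
    by (simp add: c_def)
qed

lemma started_mono: "started_before i \<omega> \<le> started_before (Suc i) \<omega>"
proof (rule ccontr)
  assume "\<not> ?thesis"
  then have "service_start (started_before (Suc i) \<omega>) \<omega> < T i \<omega>" by (simp add: started_iff[OF \<omega>, symmetric])
  then have "service_start (started_before (Suc i) \<omega>) \<omega> < T (Suc i) \<omega>" using strict[of i] by simp
  then show False by (simp add: started_iff[OF \<omega>, symmetric])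
qed

text \<open>
  Between two consecutive arrivals no customer enters, so the service number alone determines the number of
  customers at its start.
\<close>

lemma service_started_between:
  assumes "started_before i \<omega> \<le> j" "j < started_before (Suc i) \<omega>"
  shows "next_arrival (service_start j \<omega>) \<omega> = T (Suc i) \<omega>"
    and "fresh_start n j \<omega> \<longleftrightarrow> N0 \<omega> + Suc i - j = n"
proof -
  have lo: "T i \<omega> \<le> service_start j \<omega>" and hi: "service_start j \<omega> < T (Suc i) \<omega>"
    using assms started_iff[OF \<omega>, of j i] started_iff[OF \<omega>, of j "Suc i"] by auto
  show "next_arrival (service_start j \<omega>) \<omega> = T (Suc i) \<omega>"
  proof (rule next_arrival_between[OF \<omega> _ hi])
    fix k assume "k < Suc i"
    then have "T k \<omega> \<le> T i \<omega>" by (intro T_monoD[OF \<omega>]) simp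
    with lo show "T k \<omega> \<le> service_start j \<omega>" by simp
  qed
  have "T m \<omega> \<le> service_start j \<omega> \<longleftrightarrow> m < Suc i" for m
    using lo hi T_monoD[OF \<omega>, of m i] T_monoD[OF \<omega>, of "Suc i" m] by (cases "m < Suc i") auto
  then have "{m. T m \<omega> \<le> service_start j \<omega>} = {..<Suc i}" by auto
  moreover have "N0 \<omega> = 0" if "j = 0"
  proof (rule ccontr)
    assume "N0 \<omega> \<noteq> 0"
    then have "service_start j \<omega> = 0" using that by (simp add: entry_def)
    then show False using lo pos T_monoD[OF \<omega>, of 0 i] by simp
  qed
  ultimately show "fresh_start n j \<omega> \<longleftrightarrow> N0 \<omega> + Suc i - j = n"
    by (auto simp: fresh_start_def in_system_at_start_def)
qed

text \<open>
  Between two arrivals the number of customers only decreases, in unit steps, and each positive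
  level in between is met by one service start.  The \<open>max\<close> accounts for the service that an arrival starts in an empty system.
\<close>

lemma fresh_starts_between_arrivals:
  assumes n: "1 \<le> n"
  shows "(\<Sum>j=started_before i \<omega>..<started_before (Suc i) \<omega>. of_bool (fresh_start n j \<omega>)) =
    (of_bool (found (Suc i) \<omega> \<le> n \<and> n \<le> max (found i \<omega>) 1) :: nat)"
proof -
  have le: "started_before (Suc i) \<omega> \<le> N0 \<omega> + Suc i"
    using completed_le[OF \<omega>, of "Suc i"] started_eq[of "Suc i"] by (auto simp: found_def split: split_of_bool)
  have "(\<Sum>j=started_before i \<omega>..<started_before (Suc i) \<omega>. of_bool (fresh_start n j \<omega>) :: nat) =
      (\<Sum>j=started_before i \<omega>..<started_before (Suc i) \<omega>. of_bool (n \<le> N0 \<omega> + Suc i \<and> j = N0 \<omega> + Suc i - n))"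
    using le n by (intro sum.cong refl arg_cong[where f = of_bool]) (auto simp: service_started_between)
  also have "\<dots> = of_bool (started_before i \<omega> \<le> N0 \<omega> + Suc i - n \<and> N0 \<omega> + Suc i - n < started_before (Suc i) \<omega> \<and> n \<le> N0 \<omega> + Suc i)"
    by (rule sum_of_bool_eq_point)
  also have "\<dots> = of_bool (found (Suc i) \<omega> \<le> n \<and> n \<le> max (found i \<omega>) 1)"
  proof (rule arg_cong[where f = of_bool])
    define c d where "c = completed_before i \<omega>" and "d = completed_before (Suc i) \<omega>"
    have cd: "c \<le> N0 \<omega> + i" "d \<le> N0 \<omega> + Suc i" "c \<le> d"
      using completed_le[OF \<omega>, of i] completed_le[OF \<omega>, of "Suc i"] completed_mono[OF \<omega>, of i "Suc i"]
      by (auto simp: c_def d_def)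
    have f: "found i \<omega> = N0 \<omega> + i - c" "found (Suc i) \<omega> = N0 \<omega> + Suc i - d"
      by (auto simp: found_def c_def d_def)
    have s: "started_before i \<omega> = c + of_bool (0 < found i \<omega>)" "started_before (Suc i) \<omega> = d + of_bool (0 < found (Suc i) \<omega>)"
      by (auto simp: started_eq c_def d_def)
    show "(started_before i \<omega> \<le> N0 \<omega> + Suc i - n \<and> N0 \<omega> + Suc i - n < started_before (Suc i) \<omega> \<and> n \<le> N0 \<omega> + Suc i) =
      (found (Suc i) \<omega> \<le> n \<and> n \<le> max (found i \<omega>) 1)"
      unfolding s unfolding f using cd n by (cases "c < N0 \<omega> + i"; cases "d < N0 \<omega> + Suc i") (auto simp: max_def)
  qed
  finally show ?thesis .
qed

lemma sum_started_Suc: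
  fixes g :: "nat \<Rightarrow> 'b :: comm_monoid_add"
  shows "(\<Sum>j<started_before (Suc i) \<omega>. g j) = (\<Sum>j<started_before i \<omega>. g j) + (\<Sum>j=started_before i \<omega>..<started_before (Suc i) \<omega>. g j)"
  using started_mono[of i] by (simp add: lessThan_atLeast0 sum.atLeastLessThan_concat)

lemma found_Suc_le: "found (Suc i) \<omega> \<le> Suc (found i \<omega>)"
  using completed_mono[OF \<omega>, of i "Suc i"] completed_le[OF \<omega>, of i] by (simp add: found_def)

text \<open>
  Upcrossings and downcrossings of a level alternate.  Level 1 is excluded, since services that commence with
  one customer also follow idle periods.
\<close>

lemma level_crossing_balance:
  assumes n: "2 \<le> n"
  shows "\<exists>K. \<forall>i. \<bar>real (\<Sum>l<i. of_bool (found l \<omega> = n)) - real (\<Sum>j<started_before i \<omega>. of_bool (fresh_start n j \<omega>))\<bar> \<le> K"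
proof -
  \<comment> \<open>The last term says whether the current level is above \<open>n\<close>; it makes the difference invariant.\<close>
  define h where "h i = (\<Sum>l<i. of_bool (found l \<omega> = n)) - (\<Sum>j<started_before i \<omega>. of_bool (fresh_start n j \<omega>))
     - (of_bool (n < found i \<omega>) :: real)" for i
  have "h (Suc i) = h i" for i
  proof -
    have "(\<Sum>j=started_before i \<omega>..<started_before (Suc i) \<omega>. of_bool (fresh_start n j \<omega>)) =
      (of_bool (found (Suc i) \<omega> \<le> n \<and> n \<le> found i \<omega>) :: real)"
      using arg_cong[OF fresh_starts_between_arrivals[of n i], of real] n by (simp add: max_def)
    then show ?thesis
      using found_Suc_le[of i] unfolding h_def sum_started_Suc
      by (cases "found i \<omega> < n"; cases "found i \<omega> = n") (auto split: split_of_bool)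
  qed
  then have h: "h i = h 0" for i by (rule constant_of_Suc)
  show ?thesis
  proof (intro exI allI)
    fix i
    have "\<bar>h i + of_bool (n < found i \<omega>)\<bar> \<le> \<bar>h 0\<bar> + 1"
      unfolding h[of i] by (auto split: split_of_bool)
    then show "\<bar>real (\<Sum>l<i. of_bool (found l \<omega> = n)) - real (\<Sum>j<started_before i \<omega>. of_bool (fresh_start n j \<omega>))\<bar> \<le> \<bar>h 0\<bar> + 1"
      by (simp add: h_def)
  qed
qed

lemma fresh_starts_1_of_small_found:
  assumes "\<exists>\<^sub>\<infinity>i. found i \<omega> \<le> 1"
  shows "\<exists>\<^sub>\<infinity>j. fresh_start 1 j \<omega>"
proof -
  have eq: "(\<Sum>j<started_before i \<omega>. of_bool (fresh_start 1 j \<omega>) :: nat) =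
      (\<Sum>j<started_before 0 \<omega>. of_bool (fresh_start 1 j \<omega>)) + (\<Sum>l<i. of_bool (found (Suc l) \<omega> \<le> 1))" for i
  proof (induction i)
    case (Suc i)
    then show ?case using fresh_starts_between_arrivals[of 1 i] by (simp add: sum_started_Suc)
  qed simp
  have "\<exists>\<^sub>\<infinity>l. found (Suc l) \<omega> \<le> 1"
    unfolding INFM_nat_le
  proof
    fix m
    obtain i where "Suc m \<le> i" "found i \<omega> \<le> 1" using assms by (auto simp: INFM_nat_le)
    then show "\<exists>l\<ge>m. found (Suc l) \<omega> \<le> 1" by (intro exI[of _ "i - 1"]) auto
  qed
  then have lim: "filterlim (\<lambda>i. \<Sum>l<i. of_bool (found (Suc l) \<omega> \<le> 1) :: nat) at_top sequentially"
    by (simp only: count_filterlim_iff)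
  have "filterlim (\<lambda>J. \<Sum>j<J. of_bool (fresh_start 1 j \<omega>) :: nat) at_top sequentially"
    unfolding filterlim_at_top
  proof
    fix Z :: nat
    from lim obtain i where i: "Z \<le> (\<Sum>l<i. of_bool (found (Suc l) \<omega> \<le> 1) :: nat)"
      by (auto simp: filterlim_at_top eventually_sequentially)
    then have Z: "Z \<le> (\<Sum>j<started_before i \<omega>. of_bool (fresh_start 1 j \<omega>) :: nat)" unfolding eq[of i] by simp
    show "\<forall>\<^sub>F J in sequentially. Z \<le> (\<Sum>j<J. of_bool (fresh_start 1 j \<omega>) :: nat)"
    proof (rule eventually_sequentiallyI[of "started_before i \<omega>"])
      fix J assume "started_before i \<omega> \<le> J"
      then have "(\<Sum>j<started_before i \<omega>. of_bool (fresh_start 1 j \<omega>) :: nat) \<le> (\<Sum>j<J. of_bool (fresh_start 1 j \<omega>))"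
        by (intro sum_mono2) auto
      with Z show "Z \<le> (\<Sum>j<J. of_bool (fresh_start 1 j \<omega>) :: nat)" by (rule order_trans)
    qed
  qed
  then show ?thesis by (simp only: count_filterlim_iff)
qed

text \<open>
  Consider arrival \<open>Suc i\<close> that finds \<open>Suc m\<close> customers.  Either the service in progress has begun after
  arrival \<open>i\<close>, and then this arrival is the first one during that service; or it was in progress at arrival
  \<open>i\<close>, who then found \<open>m\<close> customers.  The constant accounts for arrival 0 and the services before it.
\<close>

lemma arrivals_split_by_previous_event:
  assumes x: "0 \<le> x"
  shows "\<exists>K. \<forall>i. real (\<Sum>l<Suc i. of_bool (found l \<omega> = Suc m \<and> x < residual l \<omega>)) =
     real (\<Sum>j<started_before i \<omega>. of_bool (fresh_start (Suc m) j \<omega> \<and> hit_in_service x j \<omega>)) +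
     real (\<Sum>l<i. of_bool (1 \<le> m \<and> found l \<omega> = m \<and> hit_after_arrival x l \<omega>)) + K"
proof -
  define h where "h i = real (\<Sum>l<Suc i. of_bool (found l \<omega> = Suc m \<and> x < residual l \<omega>)) -
     real (\<Sum>j<started_before i \<omega>. of_bool (fresh_start (Suc m) j \<omega> \<and> hit_in_service x j \<omega>)) -
     real (\<Sum>l<i. of_bool (1 \<le> m \<and> found l \<omega> = m \<and> hit_after_arrival x l \<omega>))" for i
  have "h (Suc i) = h i" for i
  proof -
    define c d where "c = completed_before i \<omega>" and "d = completed_before (Suc i) \<omega>"
    have cd: "c \<le> N0 \<omega> + i" "d \<le> N0 \<omega> + Suc i" "c \<le> d"
      using completed_le[OF \<omega>, of i] completed_le[OF \<omega>, of "Suc i"] completed_mono[OF \<omega>, of i "Suc i"]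
      by (auto simp: c_def d_def)
    have f: "found i \<omega> = N0 \<omega> + i - c" "found (Suc i) \<omega> = N0 \<omega> + Suc i - d"
      by (auto simp: found_def c_def d_def)
    have s: "started_before i \<omega> = c + of_bool (0 < found i \<omega>)" "started_before (Suc i) \<omega> = d + of_bool (0 < found (Suc i) \<omega>)"
      by (auto simp: started_eq c_def d_def)
    have res: "x < residual (Suc i) \<omega> \<longleftrightarrow> T (Suc i) \<omega> < service_end d \<omega> - x"
      by (auto simp: residual_def d_def)
    have "(\<Sum>j=started_before i \<omega>..<started_before (Suc i) \<omega>. of_bool (fresh_start (Suc m) j \<omega> \<and> hit_in_service x j \<omega>)) =
       (\<Sum>j=started_before i \<omega>..<started_before (Suc i) \<omega>. of_bool ((found (Suc i) \<omega> = Suc m \<and> x < residual (Suc i) \<omega>) \<and> j = d) :: real)"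
    proof (intro sum.cong refl arg_cong[where f = of_bool])
      fix j assume j: "j \<in> {started_before i \<omega>..<started_before (Suc i) \<omega>}"
      have hit: "hit_in_service x j \<omega> \<longleftrightarrow> T (Suc i) \<omega> < service_end j \<omega> - x"
        using j service_started_between(1)[of i j] by (simp add: hit_in_service_def)
      have fresh: "fresh_start (Suc m) j \<omega> \<longleftrightarrow> N0 \<omega> + Suc i - j = Suc m"
        using j by (intro service_started_between(2)) auto
      have "j \<le> d" using j s(2) by (cases "0 < found (Suc i) \<omega>") auto
      moreover have "\<not> hit_in_service x j \<omega>" if "j < d"
      proof -
        have "service_end j \<omega> < T (Suc i) \<omega>" using that by (simp add: d_def completed_iff[OF \<omega>])
        then show ?thesis using x by (simp add: hit)
      qed
      ultimately show "(fresh_start (Suc m) j \<omega> \<and> hit_in_service x j \<omega>) =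
         ((found (Suc i) \<omega> = Suc m \<and> x < residual (Suc i) \<omega>) \<and> j = d)"
        using res hit fresh f(2) by (cases "j = d") auto
    qed
    also have "\<dots> = of_bool (started_before i \<omega> \<le> d \<and> d < started_before (Suc i) \<omega> \<and> found (Suc i) \<omega> = Suc m \<and> x < residual (Suc i) \<omega>)"
      by (rule sum_of_bool_eq_point)
    also have "\<dots> = of_bool (started_before i \<omega> \<le> d \<and> found (Suc i) \<omega> = Suc m \<and> x < residual (Suc i) \<omega>)"
      using s(2) by (intro arg_cong[where f = of_bool]) auto
    finally have U: "(\<Sum>j=started_before i \<omega>..<started_before (Suc i) \<omega>. of_bool (fresh_start (Suc m) j \<omega> \<and> hit_in_service x j \<omega>)) =
       (of_bool (started_before i \<omega> \<le> d \<and> found (Suc i) \<omega> = Suc m \<and> x < residual (Suc i) \<omega>) :: real)" .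
    have V: "(1 \<le> m \<and> found i \<omega> = m \<and> hit_after_arrival x i \<omega>) \<longleftrightarrow>
       d < started_before i \<omega> \<and> found (Suc i) \<omega> = Suc m \<and> x < residual (Suc i) \<omega>"
    proof
      assume a: "1 \<le> m \<and> found i \<omega> = m \<and> hit_after_arrival x i \<omega>"
      then have "T (Suc i) \<omega> < service_end c \<omega>" using x by (simp add: hit_after_arrival_def c_def)
      then have "d \<le> c" using completed_iff[OF \<omega>, of c "Suc i"] by (simp add: d_def)
      then have "d = c" using cd by simp
      then show "d < started_before i \<omega> \<and> found (Suc i) \<omega> = Suc m \<and> x < residual (Suc i) \<omega>"
        using a s(1) f cd res by (auto simp: hit_after_arrival_def c_def[symmetric])
    next
      assume a: "d < started_before i \<omega> \<and> found (Suc i) \<omega> = Suc m \<and> x < residual (Suc i) \<omega>"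
      then have "d = c" "0 < found i \<omega>" using cd s(1) by (cases "0 < found i \<omega>"; simp)+
      then show "1 \<le> m \<and> found i \<omega> = m \<and> hit_after_arrival x i \<omega>"
        using a f cd res by (auto simp: hit_after_arrival_def c_def[symmetric])
    qed
    have "(\<Sum>j<started_before (Suc i) \<omega>. of_bool (fresh_start (Suc m) j \<omega> \<and> hit_in_service x j \<omega>) :: real) =
      (\<Sum>j<started_before i \<omega>. of_bool (fresh_start (Suc m) j \<omega> \<and> hit_in_service x j \<omega>)) +
       of_bool (started_before i \<omega> \<le> d \<and> found (Suc i) \<omega> = Suc m \<and> x < residual (Suc i) \<omega>)"
      unfolding sum_started_Suc U ..
    moreover have "(of_bool (1 \<le> m \<and> found i \<omega> = m \<and> hit_after_arrival x i \<omega>) :: real) =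
       of_bool (d < started_before i \<omega> \<and> found (Suc i) \<omega> = Suc m \<and> x < residual (Suc i) \<omega>)"
      by (simp only: V)
    ultimately show ?thesis
      unfolding h_def of_nat_sum of_nat_of_bool sum.lessThan_Suc[of _ "Suc i"] sum.lessThan_Suc[of "\<lambda>l. of_bool (1 \<le> m \<and> found l \<omega> = m \<and> hit_after_arrival x l \<omega>)" i]
      by (cases "d < started_before i \<omega>") (simp_all add: not_less not_le)
  qed
  then have "h i = h 0" for i by (rule constant_of_Suc)
  then show ?thesis
    by (intro exI[of _ "h 0"] allI) (simp add: h_def algebra_simps)
qed

lemma started_unbounded: "filterlim (\<lambda>i. started_before i \<omega>) at_top sequentially"
  unfolding filterlim_at_top
proof
  fix j :: nat
  have "eventually (\<lambda>i. service_start j \<omega> < T i \<omega>) sequentially"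
    using T_unbounded[OF \<omega>] by (simp add: filterlim_at_top_dense)
  then show "eventually (\<lambda>i. j \<le> started_before i \<omega>) sequentially"
    by eventually_elim (simp add: started_iff[OF \<omega>, symmetric] less_imp_le)
qed

text \<open>
  A state with a positive long-run fraction of time is occupied at arbitrarily late times \<open>t\<close>, and the next
  arrival after \<open>t\<close> finds at most as many customers.
\<close>

lemma found_recurrent:
  assumes frac: "((\<lambda>t. measure lborel {s \<in> {0..t}. in_system s \<omega> = m} / t) \<longlongrightarrow> p) at_top" and p: "0 < p"
  shows "\<exists>q. \<exists>\<^sub>\<infinity>i. found i \<omega> = q"
proof -
  have visits: "\<exists>t\<ge>t0. in_system t \<omega> = m" if t0: "0 \<le> t0" for t0
  proof (rule ccontr)
    assume "\<not> ?thesis"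
    then have "in_system s \<omega> \<noteq> m" if "t0 \<le> s" for s using that by blast
    then have "s < t0" if "in_system s \<omega> = m" for s using that not_less by blast
    then have sub: "{s \<in> {0..t}. in_system s \<omega> = m} \<subseteq> {0..t0}" for t by (auto simp: less_imp_le)
    have le: "measure lborel {s \<in> {0..t}. in_system s \<omega> = m} \<le> t0" for t
    proof (cases "{s \<in> {0..t}. in_system s \<omega> = m} \<in> sets lborel")
      case True
      then have "measure lborel {s \<in> {0..t}. in_system s \<omega> = m} \<le> measure lborel {0..t0}"
        using t0 by (intro measure_mono_fmeasurable[OF sub]) (auto simp: fmeasurable_def)
      then show ?thesis using t0 by simp
    next
      case False
      then show ?thesis using t0 by (simp add: measure_notin_sets)
    qed
    have "((\<lambda>t. measure lborel {s \<in> {0..t}. in_system s \<omega> = m} / t) \<longlongrightarrow> 0) at_top"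
    proof (rule tendsto_sandwich[OF _ _ tendsto_const])
      show "\<forall>\<^sub>F t in at_top. 0 \<le> measure lborel {s \<in> {0..t}. in_system s \<omega> = m} / t"
        using eventually_gt_at_top[of 0] by eventually_elim simp
      show "\<forall>\<^sub>F t in at_top. measure lborel {s \<in> {0..t}. in_system s \<omega> = m} / t \<le> t0 / t"
        using eventually_gt_at_top[of 0] by eventually_elim (intro divide_right_mono le, simp)
      show "((\<lambda>t. t0 / t) \<longlongrightarrow> 0) at_top"
        by (rule tendsto_divide_0[OF tendsto_const]) (simp add: filterlim_at_top_imp_at_infinity filterlim_ident)
    qed
    then have "p = 0" using tendsto_unique[OF _ frac] by simp
    with p show False by simp
  qed
  have small: "\<exists>\<^sub>\<infinity>i. found i \<omega> \<le> m"
    unfolding INFM_nat_le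
  proof
    fix k
    obtain t where t: "T k \<omega> \<le> t" "in_system t \<omega> = m" using visits[OF T_nonneg[OF \<omega>]] by blast
    define i where "i = card {l. T l \<omega> \<le> t}"
    have "k \<le> i" using T_le_iff[OF \<omega>, of k t] t by (simp add: i_def)
    have "t < T i \<omega>" using T_le_iff[OF \<omega>, of i t] by (simp add: i_def)
    have "card {j. service_end j \<omega> \<le> t} \<le> completed_before i \<omega>"
    proof (rule ccontr)
      assume "\<not> ?thesis"
      then have "service_end (completed_before i \<omega>) \<omega> \<le> t" by (simp only: end_le_iff[OF \<omega>] not_le)
      then show False using end_completed[OF \<omega>, of i] \<open>t < T i \<omega>\<close> by simp
    qed
    then have "found i \<omega> \<le> in_system t \<omega>" by (simp add: found_def in_system_def i_def[symmetric])
    then show "\<exists>i\<ge>k. found i \<omega> \<le> m" using \<open>k \<le> i\<close> t(2) by blast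
  qed
  show ?thesis
  proof (rule ccontr)
    assume "\<not> ?thesis"
    then have "\<forall>q\<in>{..m}. eventually (\<lambda>i. found i \<omega> \<noteq> q) sequentially"
      by (auto simp: frequently_def cofinite_eq_sequentially)
    then have "eventually (\<lambda>i. \<forall>q\<in>{..m}. found i \<omega> \<noteq> q) sequentially"
      by (intro eventually_ball_finite) auto
    then have "eventually (\<lambda>i. \<not> found i \<omega> \<le> m) sequentially"
      by eventually_elim auto
    then show False using small by (simp add: frequently_def cofinite_eq_sequentially)
  qed
qed

end

end

section \<open>Limits of ratios of counts\<close>

text \<open>
  Monotone functions are squeezed between their values at neighbouring rational points.
\<close>

lemma tendsto_of_rational_tendsto:
  fixes f :: "nat \<Rightarrow> real \<Rightarrow> real" and F :: "real \<Rightarrow> real"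
  assumes mono: "\<And>k. mono (f k)" and lim: "\<And>q. q \<in> \<rat> \<Longrightarrow> (\<lambda>k. f k q) \<longlonglongrightarrow> F q" and cont: "isCont F y"
  shows "(\<lambda>k. f k y) \<longlonglongrightarrow> F y"
proof (rule LIMSEQ_I)
  fix e :: real assume e: "0 < e"
  then obtain d where d: "0 < d" "\<And>z. \<bar>z - y\<bar> < d \<Longrightarrow> \<bar>F z - F y\<bar> < e / 2"
    using cont[unfolded continuous_at_eps_delta, rule_format, of "e / 2"] by (auto simp: dist_real_def)
  obtain a where a: "a \<in> \<rat>" "y - d < a" "a < y" using Rats_dense_in_real[of "y - d" y] d by auto
  obtain b where b: "b \<in> \<rat>" "y < b" "b < y + d" using Rats_dense_in_real[of y "y + d"] d by auto
  have Fa: "\<bar>F a - F y\<bar> < e / 2" and Fb: "\<bar>F b - F y\<bar> < e / 2"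
    using d(2)[of a] d(2)[of b] a b by auto
  have "eventually (\<lambda>k. \<bar>f k a - F a\<bar> < e / 2) sequentially" "eventually (\<lambda>k. \<bar>f k b - F b\<bar> < e / 2) sequentially"
    using tendstoD[OF lim[OF a(1)], of "e / 2"] tendstoD[OF lim[OF b(1)], of "e / 2"] e by (auto simp: dist_real_def)
  then have "eventually (\<lambda>k. norm (f k y - F y) < e) sequentially"
  proof eventually_elim
    case (elim k)
    have "f k a \<le> f k y" "f k y \<le> f k b" using a b by (auto intro!: monoD[OF mono])
    then show ?case using elim Fa Fb unfolding real_norm_def by linarith
  qed
  then show "\<exists>no. \<forall>n\<ge>no. norm (f n y - F y) < e" by (simp add: eventually_sequentially)
qed

text \<open>
  The sums are integrals with respect to the empirical measure of the selected values, which converges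
  weakly.
\<close>

lemma empirical_average_tendsto:
  fixes r :: "nat \<Rightarrow> real" and P :: "nat \<Rightarrow> bool" and \<phi> :: "real \<Rightarrow> real"
  assumes count: "filterlim (\<lambda>k. \<Sum>i<k. of_bool (P i) :: nat) at_top sequentially"
    and cdf: "\<And>y. (\<lambda>k. real (\<Sum>i<k. of_bool (P i \<and> r i \<le> y)) / real (\<Sum>i<k. of_bool (P i))) \<longlonglongrightarrow> F y"
    and F: "service_cdf F" and \<phi>: "\<And>v. isCont \<phi> v" "\<And>v. \<bar>\<phi> v\<bar> \<le> B"
  shows "(\<lambda>k. (\<Sum>i<k. of_bool (P i) * \<phi> (r i)) / real (\<Sum>i<k. of_bool (P i))) \<longlonglongrightarrow> (LINT v|interval_measure F. \<phi> v)"
proof -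
  obtain N where N: "1 \<le> (\<Sum>i<N. of_bool (P i) :: nat)"
    using count[unfolded filterlim_at_top, rule_format, of 1] unfolding eventually_sequentially by blast
  define A where "A k = {i. i < k + N \<and> P i}" for k
  have fin: "finite (A k)" and ne: "A k \<noteq> {}" for k
  proof -
    show "finite (A k)" by (simp add: A_def)
    show "A k \<noteq> {}"
    proof
      assume "A k = {}"
      then have "\<not> P i" if "i < N" for i using that by (auto simp: A_def)
      then have "(\<Sum>i<N. of_bool (P i) :: nat) = 0" by (intro sum.neutral) auto
      with N show False by linarith
    qed
  qed
  \<comment> \<open>The first \<open>N\<close> indices are always included, so that the empirical measure exists for every \<open>k\<close>.\<close>
  define \<mu> where "\<mu> k = distr (measure_pmf (pmf_of_set (A k))) borel r" for k
  have \<mu>: "real_distribution (\<mu> k)" for k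
    unfolding \<mu>_def by (rule prob_space.real_distribution_distr) (auto intro: measure_pmf.prob_space_axioms)
  have sum: "sum g (A k) = (\<Sum>i<k + N. of_bool (P i) * g i)" for g :: "nat \<Rightarrow> real" and k
    by (rule sum.mono_neutral_cong_left) (auto simp: A_def)
  have card: "real (card (A k)) = real (\<Sum>i<k + N. of_bool (P i))" for k
    using sum[of "\<lambda>_. 1" k] by simp
  have cdf_\<mu>: "cdf (\<mu> k) y = real (\<Sum>i<k + N. of_bool (P i \<and> r i \<le> y)) / real (\<Sum>i<k + N. of_bool (P i))" for k y
  proof -
    have "cdf (\<mu> k) y = measure (measure_pmf (pmf_of_set (A k))) (r -` {..y})"
      by (simp add: cdf_def2 \<mu>_def measure_distr)
    also have "\<dots> = real (card (A k \<inter> r -` {..y})) / real (card (A k))"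
      by (rule measure_pmf_of_set[OF ne fin])
    also have "real (card (A k \<inter> r -` {..y})) = (\<Sum>i\<in>A k. of_bool (r i \<le> y))"
      using fin[of k] by (simp add: Int_def)
    also have "\<dots> = (\<Sum>i<k + N. of_bool (P i) * of_bool (r i \<le> y))" by (rule sum)
    also have "\<dots> = real (\<Sum>i<k + N. of_bool (P i \<and> r i \<le> y))"
      by (simp add: of_bool_conj)
    finally show ?thesis by (simp only: card)
  qed
  have int_\<mu>: "(LINT v|\<mu> k. \<phi> v) = (\<Sum>i<k + N. of_bool (P i) * \<phi> (r i)) / real (\<Sum>i<k + N. of_bool (P i))" for k
  proof -
    have "\<phi> \<in> borel_measurable borel"
      by (intro borel_measurable_continuous_onI continuous_at_imp_continuous_on) (simp add: \<phi>)
    then have "(LINT v|\<mu> k. \<phi> v) = (LINT i|measure_pmf (pmf_of_set (A k)). \<phi> (r i))"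
      unfolding \<mu>_def by (intro integral_distr) auto
    also have "\<dots> = sum (\<lambda>i. \<phi> (r i)) (A k) / real (card (A k))" by (rule integral_pmf_of_set[OF ne fin])
    finally show ?thesis by (simp only: sum card)
  qed
  have "weak_conv_m \<mu> (interval_measure F)"
    unfolding weak_conv_m_def weak_conv_def service_cdf_interval_measure(2)[OF F] cdf_\<mu>
    using LIMSEQ_ignore_initial_segment[OF cdf] by blast
  then have "(\<lambda>k. LINT v|\<mu> k. \<phi> v) \<longlonglongrightarrow> (LINT v|interval_measure F. \<phi> v)"
    using \<phi> by (intro weak_conv_imp_integral_bdd_continuous_conv[OF \<mu> service_cdf_interval_measure(1)[OF F]]) auto
  then show ?thesis
    unfolding int_\<mu> by (rule LIMSEQ_offset)
qed

text \<open>
  The bookkeeping of the recursion.  \<open>A\<close> counts arrivals at the level, \<open>C\<^sub>0\<close> and \<open>Cx\<close> those with residual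
  above 0 and above \<open>x\<close>, \<open>S\<close> the services that start at the level, \<open>P\<close> the arrivals at the level below, and
  \<open>U\<close> and \<open>V\<close> the successful sojourns of the two kinds.  Up to negligible terms $A = g_0 A + V_0$, so
  $V_0 / A \to 1 - g_0$, and $V_x / V_0 \to \rho_x / \rho_0$.
\<close>

lemma counts_ratio_limit:
  fixes A C\<^sub>0 Cx S U\<^sub>0 Ux V\<^sub>0 Vx P :: "nat \<Rightarrow> real"
  assumes P: "filterlim P at_top sequentially"
    and CA: "\<And>i. C\<^sub>0 i = A i" and A_step: "\<And>i. A i \<le> A (Suc i)" "\<And>i. A (Suc i) \<le> A i + 1"
    and bal: "\<And>i. \<bar>A i - S i\<bar> \<le> K"
    and dec0: "\<And>i. C\<^sub>0 (Suc i) = U\<^sub>0 i + V\<^sub>0 i + k\<^sub>0" and decx: "\<And>i. Cx (Suc i) = Ux i + Vx i + kx"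
    and U\<^sub>0_nonneg: "\<And>i. 0 \<le> U\<^sub>0 i"
    and U\<^sub>0: "filterlim S at_top sequentially \<Longrightarrow> (\<lambda>i. U\<^sub>0 i / S i) \<longlonglongrightarrow> g\<^sub>0"
    and Ux: "filterlim S at_top sequentially \<Longrightarrow> (\<lambda>i. Ux i / S i) \<longlonglongrightarrow> gx"
    and V\<^sub>0: "(\<lambda>i. V\<^sub>0 i / P i) \<longlonglongrightarrow> \<rho>\<^sub>0" and Vx: "(\<lambda>i. Vx i / P i) \<longlonglongrightarrow> \<rho>x" and \<rho>\<^sub>0: "0 < \<rho>\<^sub>0"
  shows "filterlim A at_top sequentially" and "(\<lambda>i. Cx i / A i) \<longlonglongrightarrow> gx + (1 - g\<^sub>0) * \<rho>x / \<rho>\<^sub>0"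
proof -
  have Ppos: "eventually (\<lambda>i. 0 < P i) sequentially"
    using P by (simp add: filterlim_at_top_dense)
  have "filterlim (\<lambda>i. V\<^sub>0 i / P i * P i) at_top sequentially"
    by (rule filterlim_tendsto_pos_mult_at_top[OF V\<^sub>0 \<rho>\<^sub>0 P])
  then have V0_top: "filterlim V\<^sub>0 at_top sequentially"
    by (rule filterlim_mono_eventually) (use Ppos in \<open>auto elim: eventually_mono\<close>)
  have "filterlim (\<lambda>i. V\<^sub>0 i + k\<^sub>0) at_top sequentially"
    using filterlim_tendsto_add_at_top[OF tendsto_const V0_top, of k\<^sub>0] by (simp add: add.commute)
  then have "filterlim (\<lambda>i. A (Suc i)) at_top sequentially"
    by (rule filterlim_at_top_mono) (use dec0 CA U\<^sub>0_nonneg in \<open>auto intro!: always_eventually\<close>)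
  then show A: "filterlim A at_top sequentially" by (simp add: filterlim_sequentially_Suc)
  have Apos: "eventually (\<lambda>i. 0 < A i) sequentially" using A by (simp add: filterlim_at_top_dense)
  have "filterlim (\<lambda>i. A i + - K) at_top sequentially"
    using filterlim_tendsto_add_at_top[OF tendsto_const A, of "- K"] by (simp add: add.commute)
  then have S: "filterlim S at_top sequentially"
  proof (rule filterlim_at_top_mono)
    show "eventually (\<lambda>i. A i + - K \<le> S i) sequentially"
      using bal by (intro always_eventually allI) (simp add: abs_le_iff algebra_simps)
  qed
  have Spos: "eventually (\<lambda>i. 0 < S i) sequentially" using S by (simp add: filterlim_at_top_dense)
  have inv: "(\<lambda>i. c / A i) \<longlonglongrightarrow> 0" for c
    by (rule tendsto_divide_0[OF tendsto_const]) (use A filterlim_at_top_imp_at_infinity in blast)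
  have small: "(\<lambda>i. h i / A i) \<longlonglongrightarrow> 0" if h: "\<And>i. \<bar>h i\<bar> \<le> c" for h :: "nat \<Rightarrow> real" and c
  proof (rule Lim_null_comparison[OF _ inv[of c]])
    show "eventually (\<lambda>i. norm (h i / A i) \<le> c / A i) sequentially"
      using Apos by eventually_elim (simp add: h divide_right_mono)
  qed
  have SA: "(\<lambda>i. S i / A i) \<longlonglongrightarrow> 1"
  proof -
    have "(\<lambda>i. 1 - (A i - S i) / A i) \<longlonglongrightarrow> 1 - 0"
      by (rule tendsto_diff[OF tendsto_const small[OF bal]])
    then show ?thesis
      by (simp, elim Lim_transform_eventually) (use Apos in \<open>eventually_elim, simp add: field_simps\<close>)
  qed
  have ratio_U: "(\<lambda>i. W i / A i) \<longlonglongrightarrow> w" if "(\<lambda>i. W i / S i) \<longlonglongrightarrow> w" for W :: "nat \<Rightarrow> real" and w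
  proof -
    have "(\<lambda>i. W i / S i * (S i / A i)) \<longlonglongrightarrow> w * 1" by (intro tendsto_intros that SA)
    then show ?thesis
      by (simp only: mult_1_right, elim Lim_transform_eventually) (use Spos in \<open>eventually_elim, simp\<close>)
  qed
  have step: "(\<lambda>i. A (Suc i) / A i) \<longlonglongrightarrow> 1"
  proof -
    have "(\<lambda>i. 1 + (A (Suc i) - A i) / A i) \<longlonglongrightarrow> 1 + 0"
    proof (rule tendsto_add[OF tendsto_const small])
      show "\<bar>A (Suc i) - A i\<bar> \<le> 1" for i using A_step[of i] by simp
    qed
    then show ?thesis
      by (simp, elim Lim_transform_eventually) (use Apos in \<open>eventually_elim, simp add: field_simps\<close>)
  qed
  have V0A: "(\<lambda>i. V\<^sub>0 i / A i) \<longlonglongrightarrow> 1 - g\<^sub>0"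
  proof -
    have "(\<lambda>i. A (Suc i) / A i - U\<^sub>0 i / A i - k\<^sub>0 / A i) \<longlonglongrightarrow> 1 - g\<^sub>0 - 0"
      by (intro tendsto_intros step ratio_U U\<^sub>0 S inv)
    then show ?thesis
      using dec0 CA by (simp add: diff_divide_distrib[symmetric])
  qed
  have PV: "(\<lambda>i. Vx i / P i / (V\<^sub>0 i / P i)) \<longlonglongrightarrow> \<rho>x / \<rho>\<^sub>0"
    using \<rho>\<^sub>0 by (intro tendsto_intros Vx V\<^sub>0) auto
  have "(\<lambda>i. Vx i / P i / (V\<^sub>0 i / P i) * (V\<^sub>0 i / A i)) \<longlonglongrightarrow> \<rho>x / \<rho>\<^sub>0 * (1 - g\<^sub>0)"
    by (intro tendsto_mult PV V0A)
  moreover have "eventually (\<lambda>i. 0 < V\<^sub>0 i) sequentially" using V0_top by (simp add: filterlim_at_top_dense)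
  ultimately have VxA: "(\<lambda>i. Vx i / A i) \<longlonglongrightarrow> \<rho>x / \<rho>\<^sub>0 * (1 - g\<^sub>0)"
    by (rule Lim_transform_eventually[OF _ eventually_mono[OF eventually_conj[OF Ppos]]]) auto
  have "(\<lambda>i. (Ux i / A i + Vx i / A i + kx / A i) / (A (Suc i) / A i)) \<longlonglongrightarrow> (gx + \<rho>x / \<rho>\<^sub>0 * (1 - g\<^sub>0) + 0) / 1"
    by (intro tendsto_intros ratio_U Ux S VxA inv step) auto
  then have "(\<lambda>i. Cx (Suc i) / A (Suc i)) \<longlonglongrightarrow> (gx + \<rho>x / \<rho>\<^sub>0 * (1 - g\<^sub>0) + 0) / 1"
  proof (rule Lim_transform_eventually)
    show "eventually (\<lambda>i. (Ux i / A i + Vx i / A i + kx / A i) / (A (Suc i) / A i) = Cx (Suc i) / A (Suc i)) sequentially"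
      using Apos by eventually_elim (simp add: decx add_divide_distrib[symmetric])
  qed
  then show "(\<lambda>i. Cx i / A i) \<longlonglongrightarrow> gx + (1 - g\<^sub>0) * \<rho>x / \<rho>\<^sub>0"
    by (subst (asm) filterlim_sequentially_Suc) (simp add: mult.commute)
qed

text \<open>
  If the level below were visited boundedly often, nearly all arrivals at this level would stem from services
  that start at it; but only the fraction \<open>g < 1\<close> of those are successful, while their number is nearly \<open>A\<close>.
\<close>

lemma count_unbounded_descent:
  fixes A S U V P :: "nat \<Rightarrow> real"
  assumes A: "filterlim A at_top sequentially" and A_step: "\<And>i. A i \<le> A (Suc i)"
    and bal: "\<And>i. \<bar>A i - S i\<bar> \<le> K" and dec: "\<And>i. A (Suc i) = U i + V i + k"
    and U: "filterlim S at_top sequentially \<Longrightarrow> (\<lambda>i. U i / S i) \<longlonglongrightarrow> g" and g: "g < 1"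
    and VP: "\<And>i. V i \<le> P i"
  shows "filterlim P at_top sequentially"
proof -
  have "filterlim (\<lambda>i. A i + - K) at_top sequentially"
    using filterlim_tendsto_add_at_top[OF tendsto_const A, of "- K"] by (simp add: add.commute)
  then have S: "filterlim S at_top sequentially"
  proof (rule filterlim_at_top_mono)
    show "eventually (\<lambda>i. A i + - K \<le> S i) sequentially"
      using bal by (intro always_eventually allI) (simp add: abs_le_iff algebra_simps)
  qed
  have Spos: "eventually (\<lambda>i. 0 < S i) sequentially" using S by (simp add: filterlim_at_top_dense)
  have "(\<lambda>i. 1 - U i / S i) \<longlonglongrightarrow> 1 - g" by (intro tendsto_intros U S)
  moreover have "0 < 1 - g" using g by simp
  ultimately have "filterlim (\<lambda>i. (1 - U i / S i) * S i) at_top sequentially"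
    using S by (rule filterlim_tendsto_pos_mult_at_top)
  then have "filterlim (\<lambda>i. - (K + k) + (1 - U i / S i) * S i) at_top sequentially"
    by (rule filterlim_tendsto_add_at_top[OF tendsto_const])
  then show ?thesis
  proof (rule filterlim_at_top_mono)
    show "eventually (\<lambda>i. - (K + k) + (1 - U i / S i) * S i \<le> P i) sequentially"
      using Spos
    proof eventually_elim
      case (elim i)
      have "(1 - U i / S i) * S i = S i - U i" using elim by (simp add: left_diff_distrib)
      moreover have "S i - K \<le> A (Suc i)" using bal[of i] A_step[of i] by (simp add: abs_le_iff)
      ultimately show ?case using dec[of i] VP[of i] by linarith
    qed
  qed
qed

section \<open>The long-run residual service times\<close>

lemma count_along_iff:
  fixes s :: "nat \<Rightarrow> nat"
  assumes s: "filterlim s at_top sequentially"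
  shows "filterlim (\<lambda>i. real (\<Sum>j<s i. of_bool (P j))) at_top sequentially \<longleftrightarrow> (\<exists>\<^sub>\<infinity>j. P j)"
proof
  assume lim: "filterlim (\<lambda>i. real (\<Sum>j<s i. of_bool (P j))) at_top sequentially"
  have "filterlim (\<lambda>J. \<Sum>j<J. of_bool (P j) :: nat) at_top sequentially"
    unfolding filterlim_at_top
  proof
    fix Z :: nat
    from lim have "eventually (\<lambda>i. real Z \<le> real (\<Sum>j<s i. of_bool (P j))) sequentially"
      unfolding filterlim_at_top by blast
    then obtain i where "real Z \<le> real (\<Sum>j<s i. of_bool (P j))"
      unfolding eventually_sequentially by blast
    then have Z: "Z \<le> (\<Sum>j<s i. of_bool (P j))" unfolding of_nat_le_iff .
    show "\<forall>\<^sub>F J in sequentially. Z \<le> (\<Sum>j<J. of_bool (P j) :: nat)"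
    proof (rule eventually_sequentiallyI[of "s i"])
      fix J assume "s i \<le> J"
      then have "(\<Sum>j<s i. of_bool (P j) :: nat) \<le> (\<Sum>j<J. of_bool (P j))"
        by (intro sum_mono2) auto
      with Z show "Z \<le> (\<Sum>j<J. of_bool (P j) :: nat)" by (rule order_trans)
    qed
  qed
  then show "\<exists>\<^sub>\<infinity>j. P j" by (simp only: count_filterlim_iff)
next
  assume "\<exists>\<^sub>\<infinity>j. P j"
  then have "filterlim (\<lambda>J. \<Sum>j<J. of_bool (P j) :: nat) at_top sequentially" by (simp only: count_filterlim_iff)
  from filterlim_compose[OF filterlim_real_sequentially filterlim_compose[OF this s]]
  show "filterlim (\<lambda>i. real (\<Sum>j<s i. of_bool (P j))) at_top sequentially" .
qed

lemmas count_iff = count_along_iff[OF filterlim_ident]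

context MnGn1_queue
begin

definition tail_count :: "nat \<Rightarrow> real \<Rightarrow> nat \<Rightarrow> 'a \<Rightarrow> real" where
  "tail_count n x k \<omega> = real (\<Sum>i<k. of_bool (found i \<omega> = n \<and> x < residual i \<omega>))"

definition found_count :: "nat \<Rightarrow> nat \<Rightarrow> 'a \<Rightarrow> real" where
  "found_count n k \<omega> = real (\<Sum>i<k. of_bool (found i \<omega> = n))"

definition fresh_count :: "nat \<Rightarrow> nat \<Rightarrow> 'a \<Rightarrow> real" where
  "fresh_count n J \<omega> = real (\<Sum>j<J. of_bool (fresh_start n j \<omega>))"

definition service_hits :: "nat \<Rightarrow> real \<Rightarrow> nat \<Rightarrow> 'a \<Rightarrow> real" where
  "service_hits n x J \<omega> = real (\<Sum>j<J. of_bool (fresh_start n j \<omega> \<and> hit_in_service x j \<omega>))"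

definition arrival_hits :: "nat \<Rightarrow> real \<Rightarrow> nat \<Rightarrow> 'a \<Rightarrow> real" where
  "arrival_hits m x k \<omega> = real (\<Sum>i<k. of_bool (1 \<le> m \<and> found i \<omega> = m \<and> hit_after_arrival x i \<omega>))"

text \<open>
  The almost sure properties of a path from which the limits follow without further probability.
  Only rational \<open>x\<close> are admitted, so that countably many null sets suffice.
\<close>

definition regular_path :: "'a \<Rightarrow> bool" where
  "regular_path \<omega> \<longleftrightarrow> \<omega> \<in> space M \<and> 0 < T 0 \<omega> \<and> (\<forall>i. T i \<omega> < T (Suc i) \<omega>) \<and>
     (\<forall>i. 0 < found i \<omega> \<longrightarrow> 0 < residual i \<omega>) \<and> (\<exists>q. \<exists>\<^sub>\<infinity>i. found i \<omega> = q) \<and>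
     (\<forall>n. 1 \<le> n \<longrightarrow> (\<forall>x\<in>{x \<in> \<rat>. 0 \<le> x}. (\<exists>\<^sub>\<infinity>j. fresh_start n j \<omega>) \<longrightarrow>
        (\<lambda>J. service_hits n x J \<omega> / fresh_count n J \<omega>) \<longlonglongrightarrow> excess_tail (lam n) (G n) x)) \<and>
     (\<forall>n. 1 \<le> n \<longrightarrow> (\<forall>x\<in>{x \<in> \<rat>. 0 \<le> x}. (\<exists>\<^sub>\<infinity>i. found i \<omega> = n) \<longrightarrow>
        (\<lambda>k. (arrival_hits n x k \<omega> -
           (\<Sum>i<k. of_bool (found i \<omega> = n) * exponential_cdf (lam (Suc n)) (residual i \<omega> - x)))
          / found_count n k \<omega>) \<longlonglongrightarrow> 0))"

context
  assumes stable: stable and lam_pos: "\<And>n. 0 < lam n" and G_cdf: "\<And>n. 1 \<le> n \<Longrightarrow> service_cdf (G n)"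
begin

lemma AE_regular_path: "AE \<omega> in M. regular_path \<omega>"
proof -
  have c: "countable {x \<in> \<rat>. 0 \<le> (x::real)}" by (rule countable_subset[OF _ countable_rat]) auto
  have "AE \<omega> in M. 1 \<le> n \<longrightarrow> (\<forall>x\<in>{x \<in> \<rat>. 0 \<le> x}. (\<exists>\<^sub>\<infinity>j. fresh_start n j \<omega>) \<longrightarrow>
        (\<lambda>J. service_hits n x J \<omega> / fresh_count n J \<omega>) \<longlonglongrightarrow> excess_tail (lam n) (G n) x)" for n
  proof (cases "1 \<le> n")
    case True
    have "AE \<omega> in M. \<forall>x\<in>{x \<in> \<rat>. 0 \<le> x}. (\<exists>\<^sub>\<infinity>j. fresh_start n j \<omega>) \<longrightarrow>
        (\<lambda>J. service_hits n x J \<omega> / fresh_count n J \<omega>) \<longlonglongrightarrow> excess_tail (lam n) (G n) x"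
      unfolding AE_ball_countable[OF c]
    proof
      fix x :: real assume "x \<in> {x \<in> \<rat>. 0 \<le> x}"
      then have "0 \<le> x" by simp
      from services_hit_frequency[OF True G_cdf[OF True] lam_pos this]
      show "AE \<omega> in M. (\<exists>\<^sub>\<infinity>j. fresh_start n j \<omega>) \<longrightarrow>
        (\<lambda>J. service_hits n x J \<omega> / fresh_count n J \<omega>) \<longlonglongrightarrow> excess_tail (lam n) (G n) x"
        unfolding count_filterlim_iff service_hits_def fresh_count_def of_nat_sum of_nat_of_bool .
    qed
    then show ?thesis by eventually_elim simp
  qed simp
  moreover have "AE \<omega> in M. 1 \<le> n \<longrightarrow> (\<forall>x\<in>{x \<in> \<rat>. 0 \<le> x}. (\<exists>\<^sub>\<infinity>i. found i \<omega> = n) \<longrightarrow>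
        (\<lambda>k. (arrival_hits n x k \<omega> -
           (\<Sum>i<k. of_bool (found i \<omega> = n) * exponential_cdf (lam (Suc n)) (residual i \<omega> - x)))
          / found_count n k \<omega>) \<longlonglongrightarrow> 0)" for n
  proof (cases "1 \<le> n")
    case True
    have "AE \<omega> in M. \<forall>x\<in>{x \<in> \<rat>. 0 \<le> x}. (\<exists>\<^sub>\<infinity>i. found i \<omega> = n) \<longrightarrow>
        (\<lambda>k. (arrival_hits n x k \<omega> -
           (\<Sum>i<k. of_bool (found i \<omega> = n) * exponential_cdf (lam (Suc n)) (residual i \<omega> - x)))
          / found_count n k \<omega>) \<longlonglongrightarrow> 0"
      unfolding AE_ball_countable[OF c]
    proof
      fix x :: real assume "x \<in> {x \<in> \<rat>. 0 \<le> x}"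
      then have "0 \<le> x" by simp
      from arrivals_hit_frequency[OF True lam_pos this]
      show "AE \<omega> in M. (\<exists>\<^sub>\<infinity>i. found i \<omega> = n) \<longrightarrow>
        (\<lambda>k. (arrival_hits n x k \<omega> -
           (\<Sum>i<k. of_bool (found i \<omega> = n) * exponential_cdf (lam (Suc n)) (residual i \<omega> - x)))
          / found_count n k \<omega>) \<longlonglongrightarrow> 0"
        unfolding count_filterlim_iff arrival_hits_def found_count_def of_nat_sum of_nat_of_bool
        using True by simp
    qed
    then show ?thesis by eventually_elim simp
  qed simp
  moreover have "AE \<omega> in M. \<exists>q. \<exists>\<^sub>\<infinity>i. found i \<omega> = q"
  proof -
    obtain p where p: "AE \<omega> in M. \<forall>n. ((\<lambda>t. measure lborel {s \<in> {0..t}. in_system s \<omega> = n} / t) \<longlongrightarrow> pmf p n) at_top"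
      using stable by (auto simp: stable_def)
    obtain m where "m \<in> set_pmf p" using set_pmf_not_empty[of p] by blast
    then have m: "0 < pmf p m" by (simp add: pmf_positive)
    show ?thesis
      using p arrivals_strictly_increasing AE_space
    proof eventually_elim
      case (elim \<omega>)
      then show ?case by (intro found_recurrent[OF elim(3) _ _ elim(1)[rule_format] m]) auto
    qed
  qed
  ultimately show ?thesis
    unfolding regular_path_def
    using arrivals_strictly_increasing residual_positive by (simp add: AE_all_countable AE_conj_iff)
qed

context
  fixes \<omega> assumes reg: "regular_path \<omega>"
begin

lemma regular_pathD:
  "\<omega> \<in> space M" "0 < T 0 \<omega>" "T i \<omega> < T (Suc i) \<omega>" "0 < found i \<omega> \<Longrightarrow> 0 < residual i \<omega>"
  using reg by (auto simp: regular_path_def)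

text \<open>
  The residual seen is never 0 on a regular path, so all arrivals at the level are counted at \<open>x = 0\<close>.
\<close>

lemma found_count_eq_tail: "1 \<le> n \<Longrightarrow> tail_count n 0 k \<omega> = found_count n k \<omega>"
  unfolding tail_count_def found_count_def
  by (intro arg_cong[where f = real] sum.cong) (auto intro: regular_pathD(4))

lemma found_count_step: "found_count n k \<omega> \<le> found_count n (Suc k) \<omega>" "found_count n (Suc k) \<omega> \<le> found_count n k \<omega> + 1"
  unfolding found_count_def sum.lessThan_Suc by (auto split: split_of_bool)

lemma found_count_at_top_iff: "filterlim (\<lambda>k. found_count n k \<omega>) at_top sequentially \<longleftrightarrow> (\<exists>\<^sub>\<infinity>i. found i \<omega> = n)"
  unfolding found_count_def by (rule count_iff)

lemma started_at_top: "filterlim (\<lambda>i. started_before i \<omega>) at_top sequentially"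
  by (rule started_unbounded) (rule regular_pathD)+

lemma service_hits_limit:
  assumes "1 \<le> n" "x \<in> \<rat>" "0 \<le> x" "filterlim (\<lambda>i. fresh_count n (started_before i \<omega>) \<omega>) at_top sequentially"
  shows "(\<lambda>i. service_hits n x (started_before i \<omega>) \<omega> / fresh_count n (started_before i \<omega>) \<omega>)
    \<longlonglongrightarrow> excess_tail (lam n) (G n) x"
proof -
  have "\<exists>\<^sub>\<infinity>j. fresh_start n j \<omega>"
    using assms(4) unfolding fresh_count_def count_along_iff[OF started_at_top] .
  then have "(\<lambda>J. service_hits n x J \<omega> / fresh_count n J \<omega>) \<longlonglongrightarrow> excess_tail (lam n) (G n) x"
    using reg assms(1-3) by (simp add: regular_path_def)
  from filterlim_compose[OF this started_at_top] show ?thesis .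
qed

lemma balance: "2 \<le> n \<Longrightarrow> \<exists>K. \<forall>i. \<bar>found_count n i \<omega> - fresh_count n (started_before i \<omega>) \<omega>\<bar> \<le> K"
  unfolding found_count_def fresh_count_def by (intro level_crossing_balance regular_pathD)

lemma decomposition: "0 \<le> x \<Longrightarrow> \<exists>K. \<forall>i. tail_count (Suc m) x (Suc i) \<omega> =
    service_hits (Suc m) x (started_before i \<omega>) \<omega> + arrival_hits m x i \<omega> + K"
  unfolding tail_count_def service_hits_def arrival_hits_def
  by (intro arrivals_split_by_previous_event regular_pathD)

lemma arrival_hits_le: "arrival_hits m x k \<omega> \<le> found_count m k \<omega>"
  unfolding arrival_hits_def found_count_def of_nat_le_iff by (intro sum_mono) auto

text \<open>
  The recursion runs upwards in the level, but stability only provides some level that is met infinitely often;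
  this step leads down from there.
\<close>

lemma found_infinitely_often_descent:
  assumes m: "1 \<le> m" and inf: "\<exists>\<^sub>\<infinity>i. found i \<omega> = Suc m"
  shows "\<exists>\<^sub>\<infinity>i. found i \<omega> = m"
proof -
  obtain K where K: "\<And>i. \<bar>found_count (Suc m) i \<omega> - fresh_count (Suc m) (started_before i \<omega>) \<omega>\<bar> \<le> K"
    using balance[of "Suc m"] m by auto
  obtain k where k: "\<And>i. tail_count (Suc m) 0 (Suc i) \<omega> =
    service_hits (Suc m) 0 (started_before i \<omega>) \<omega> + arrival_hits m 0 i \<omega> + k"
    using decomposition[of 0 m] by auto
  have "filterlim (\<lambda>k. found_count m k \<omega>) at_top sequentially"
  proof (rule count_unbounded_descent[where A = "\<lambda>i. found_count (Suc m) i \<omega>"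
        and S = "\<lambda>i. fresh_count (Suc m) (started_before i \<omega>) \<omega>", OF _ found_count_step(1) K])
    show "filterlim (\<lambda>k. found_count (Suc m) k \<omega>) at_top sequentially"
      using inf by (simp add: found_count_at_top_iff)
    show "found_count (Suc m) (Suc i) \<omega> = service_hits (Suc m) 0 (started_before i \<omega>) \<omega> + arrival_hits m 0 i \<omega> + k" for i
      using k[of i] by (simp add: found_count_eq_tail)
    show "(\<lambda>i. service_hits (Suc m) 0 (started_before i \<omega>) \<omega> / fresh_count (Suc m) (started_before i \<omega>) \<omega>)
      \<longlonglongrightarrow> excess_tail (lam (Suc m)) (G (Suc m)) 0"
      if "filterlim (\<lambda>i. fresh_count (Suc m) (started_before i \<omega>) \<omega>) at_top sequentially"
      using that by (intro service_hits_limit) auto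
    show "excess_tail (lam (Suc m)) (G (Suc m)) 0 < 1"
      by (intro excess_tail_less_1 lam_pos G_cdf) simp
    show "arrival_hits m 0 i \<omega> \<le> found_count m i \<omega>" for i by (rule arrival_hits_le)
  qed
  then show ?thesis by (simp add: found_count_at_top_iff)
qed

lemma fresh_start_1_infinitely_often: "\<exists>\<^sub>\<infinity>j. fresh_start 1 j \<omega>"
proof -
  have small: "\<exists>\<^sub>\<infinity>i. found i \<omega> \<le> 1" if "\<exists>\<^sub>\<infinity>i. found i \<omega> = q" for q
    using that
  proof (induction q)
    case 0
    then show ?case by (rule INFM_mono) simp
  next
    case (Suc m)
    show ?case
    proof (cases "m = 0")
      case True
      with Suc.prems show ?thesis by (auto elim: INFM_mono)
    next
      case False
      then show ?thesis using Suc.IH found_infinitely_often_descent[of m] Suc.prems by simp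
    qed
  qed
  obtain q where "\<exists>\<^sub>\<infinity>i. found i \<omega> = q" using reg by (auto simp: regular_path_def)
  from small[OF this] show ?thesis by (intro fresh_starts_1_of_small_found regular_pathD)
qed

text \<open>
  An arrival that finds an empty system starts a service rather than a sojourn of the second kind, so at level 1 only
  sojourns of the first kind occur.
\<close>

lemma tail_frequency_1:
  shows "\<exists>\<^sub>\<infinity>i. found i \<omega> = 1"
    and "x \<in> \<rat> \<Longrightarrow> 0 \<le> x \<Longrightarrow> (\<lambda>k. tail_count 1 x k \<omega> / found_count 1 k \<omega>)
      \<longlonglongrightarrow> excess_tail (lam 1) (G 1) x / excess_tail (lam 1) (G 1) 0"
proof -
  define s where "s i = started_before i \<omega>" for i
  have S: "filterlim (\<lambda>i. fresh_count 1 (s i) \<omega>) at_top sequentially"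
    unfolding fresh_count_def s_def count_along_iff[OF started_at_top] by (rule fresh_start_1_infinitely_often)
  have lim: "(\<lambda>i. tail_count 1 x (Suc i) \<omega> / fresh_count 1 (s i) \<omega>) \<longlonglongrightarrow> excess_tail (lam 1) (G 1) x"
    if x: "x \<in> \<rat>" "0 \<le> x" for x
  proof -
    obtain K where K: "\<And>i. tail_count (Suc 0) x (Suc i) \<omega> = service_hits (Suc 0) x (s i) \<omega> + arrival_hits 0 x i \<omega> + K"
      using decomposition[OF x(2), of 0] by (auto simp: s_def)
    have "(\<lambda>i. service_hits 1 x (s i) \<omega> / fresh_count 1 (s i) \<omega> + K / fresh_count 1 (s i) \<omega>) \<longlonglongrightarrow> excess_tail (lam 1) (G 1) x + 0"
      unfolding s_def
      by (intro tendsto_add service_hits_limit tendsto_divide_0[OF tendsto_const] filterlim_at_top_imp_at_infinity)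
         (use x S in \<open>auto simp: s_def\<close>)
    then show ?thesis
      using K by (simp add: add_divide_distrib arrival_hits_def)
  qed
  have pos: "0 < excess_tail (lam 1) (G 1) 0" by (intro excess_tail_pos lam_pos G_cdf) simp
  have Spos: "eventually (\<lambda>i. 0 < fresh_count 1 (s i) \<omega>) sequentially"
    using S by (simp add: filterlim_at_top_dense)
  have lim0: "(\<lambda>i. found_count 1 (Suc i) \<omega> / fresh_count 1 (s i) \<omega>) \<longlonglongrightarrow> excess_tail (lam 1) (G 1) 0"
    using lim[of 0] by (simp add: found_count_eq_tail)
  have "filterlim (\<lambda>i. found_count 1 (Suc i) \<omega> / fresh_count 1 (s i) \<omega> * fresh_count 1 (s i) \<omega>) at_top sequentially"
    by (rule filterlim_tendsto_pos_mult_at_top[OF lim0 pos S])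
  then have "filterlim (\<lambda>i. found_count 1 (Suc i) \<omega>) at_top sequentially"
    by (rule filterlim_mono_eventually) (use Spos in \<open>auto elim: eventually_mono\<close>)
  then show "\<exists>\<^sub>\<infinity>i. found i \<omega> = 1"
    unfolding filterlim_sequentially_Suc[of "\<lambda>i. found_count 1 i \<omega>"] found_count_at_top_iff .
  show "(\<lambda>k. tail_count 1 x k \<omega> / found_count 1 k \<omega>)
      \<longlonglongrightarrow> excess_tail (lam 1) (G 1) x / excess_tail (lam 1) (G 1) 0" if x: "x \<in> \<rat>" "0 \<le> x"
  proof -
    have "(\<lambda>i. tail_count 1 x (Suc i) \<omega> / fresh_count 1 (s i) \<omega> / (found_count 1 (Suc i) \<omega> / fresh_count 1 (s i) \<omega>))
      \<longlonglongrightarrow> excess_tail (lam 1) (G 1) x / excess_tail (lam 1) (G 1) 0"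
      using pos by (intro tendsto_divide lim x lim0) auto
    then have "(\<lambda>i. tail_count 1 x (Suc i) \<omega> / found_count 1 (Suc i) \<omega>)
      \<longlonglongrightarrow> excess_tail (lam 1) (G 1) x / excess_tail (lam 1) (G 1) 0"
      by (rule Lim_transform_eventually) (use Spos in \<open>eventually_elim, simp\<close>)
    then show ?thesis by (subst (asm) filterlim_sequentially_Suc)
  qed
qed

end

text \<open>
  The residuals seen at level \<open>n\<close> have the empirical CDF \<open>F\<close> in the long run, on every regular path.  This is
  stronger than convergence for each point almost surely, and it is the form in which the next level uses it.
\<close>

definition long_run_cdf :: "nat \<Rightarrow> (real \<Rightarrow> real) \<Rightarrow> bool" where
  "long_run_cdf n F \<longleftrightarrow> service_cdf F \<and> (\<forall>\<omega>. regular_path \<omega> \<longrightarrow> (\<exists>\<^sub>\<infinity>i. found i \<omega> = n) \<and>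
     (\<forall>y. (\<lambda>k. real (\<Sum>i<k. of_bool (found i \<omega> = n \<and> residual i \<omega> \<le> y)) / found_count n k \<omega>) \<longlonglongrightarrow> F y))"

lemma long_run_cdf_eq:
  assumes "long_run_cdf n F"
  shows "residual_cdf n = F"
proof
  fix y
  have card: "card {i. i < k \<and> P i} = (\<Sum>i<k. of_bool (P i))" for k and P :: "nat \<Rightarrow> bool"
    by (simp add: Int_def)
  let ?f = "\<lambda>\<omega> k. real (\<Sum>i<k. of_bool (found i \<omega> = n \<and> residual i \<omega> \<le> y)) / real (\<Sum>i<k. of_bool (found i \<omega> = n))"
  have lim: "AE \<omega> in M. ?f \<omega> \<longlonglongrightarrow> F y"
    using AE_regular_path
  proof eventually_elim
    case (elim \<omega>)
    then show ?case using assms unfolding long_run_cdf_def found_count_def by blast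
  qed
  show "residual_cdf n y = F y"
    unfolding residual_cdf_def card
  proof (rule the_equality)
    show "AE \<omega> in M. ?f \<omega> \<longlonglongrightarrow> F y" by (rule lim)
  next
    fix r assume "AE \<omega> in M. ?f \<omega> \<longlonglongrightarrow> r"
    with lim have "AE \<omega> in M. r = F y"
      by eventually_elim (rule LIMSEQ_unique)
    then show "r = F y" by simp
  qed
qed

text \<open>
  The tails at rational points determine the limit of the whole empirical CDF, since \<open>F\<close> is continuous.
\<close>

lemma long_run_cdfI:
  assumes F: "service_cdf F" and cont: "\<And>x. isCont F x" and zero: "\<And>x. x \<le> 0 \<Longrightarrow> F x = 0"
    and inf: "\<And>\<omega>. regular_path \<omega> \<Longrightarrow> \<exists>\<^sub>\<infinity>i. found i \<omega> = n"
    and tail: "\<And>\<omega> x. regular_path \<omega> \<Longrightarrow> x \<in> \<rat> \<Longrightarrow> 0 \<le> x \<Longrightarrow> (\<lambda>k. tail_count n x k \<omega> / found_count n k \<omega>) \<longlonglongrightarrow> 1 - F x"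
  shows "long_run_cdf n F"
  unfolding long_run_cdf_def
proof (intro conjI allI impI F)
  fix \<omega> assume reg: "regular_path \<omega>"
  show inf_n: "\<exists>\<^sub>\<infinity>i. found i \<omega> = n" by (rule inf[OF reg])
  note \<omega> = regular_pathD(1)[OF reg]
  define f where "f k y = real (\<Sum>i<k. of_bool (found i \<omega> = n \<and> residual i \<omega> \<le> y)) / found_count n k \<omega>" for k y
  have "(\<lambda>k. f k y) \<longlonglongrightarrow> F y" for y
  proof (rule tendsto_of_rational_tendsto[OF _ _ cont])
    show "mono (f k)" for k
      unfolding mono_def f_def
      by (intro allI impI divide_right_mono of_nat_mono sum_mono) (auto simp: found_count_def split: split_of_bool)
  next
    fix q :: real assume q: "q \<in> \<rat>"
    show "(\<lambda>k. f k q) \<longlonglongrightarrow> F q"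
    proof (cases "0 \<le> q")
      case True
      have pos: "eventually (\<lambda>k. 0 < found_count n k \<omega>) sequentially"
        using inf_n found_count_at_top_iff[OF reg, of n] by (simp add: filterlim_at_top_dense)
      have "(\<lambda>k. 1 - tail_count n q k \<omega> / found_count n k \<omega>) \<longlonglongrightarrow> 1 - (1 - F q)"
        by (intro tendsto_diff tendsto_const tail reg q True)
      then have "(\<lambda>k. 1 - tail_count n q k \<omega> / found_count n k \<omega>) \<longlonglongrightarrow> F q" by simp
      then show ?thesis
      proof (rule Lim_transform_eventually)
        have "real (\<Sum>i<k. of_bool (found i \<omega> = n \<and> residual i \<omega> \<le> q)) = found_count n k \<omega> - tail_count n q k \<omega>" for k
          unfolding found_count_def tail_count_def of_nat_sum sum_subtractf[symmetric]
          by (intro sum.cong) auto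
        then show "eventually (\<lambda>k. 1 - tail_count n q k \<omega> / found_count n k \<omega> = f k q) sequentially"
          using pos unfolding f_def by (auto elim!: eventually_mono simp: diff_divide_distrib)
      qed
    next
      case False
      have "\<not> residual i \<omega> \<le> q" for i using residual_nonneg[OF \<omega>, of i] False by simp
      then have "f k q = 0" for k by (simp add: f_def)
      then show ?thesis using zero[of q] False by simp
    qed
  qed
  then show "(\<lambda>k. real (\<Sum>i<k. of_bool (found i \<omega> = n \<and> residual i \<omega> \<le> y)) / found_count n k \<omega>) \<longlonglongrightarrow> F y" for y
    by (simp only: f_def)
qed

lemma long_run_cdf_1: "long_run_cdf 1 (D (lam 1) (G 1))"
proof -
  have G: "service_cdf (G 1)" by (rule G_cdf) simp
  note D = D_props[OF lam_pos G]
  show ?thesis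
  proof (rule long_run_cdfI)
    show "service_cdf (D (lam 1) (G 1))" by (intro service_cdfI_continuous D)
    show "(\<lambda>k. tail_count 1 x k \<omega> / found_count 1 k \<omega>) \<longlonglongrightarrow> 1 - D (lam 1) (G 1) x"
      if "regular_path \<omega>" "x \<in> \<rat>" "0 \<le> x" for \<omega> x
      using tail_frequency_1(2)[OF that] that(3) unfolding D_eq_excess_tail[OF lam_pos G] by simp
  qed (use D tail_frequency_1(1) in auto)
qed

text \<open>
  The success probabilities of the sojourns of the second kind are averaged over the residuals seen at the
  level below, whose empirical CDF tends to \<open>F\<close>.
\<close>

lemma arrival_hits_limit:
  assumes m: "1 \<le> m" and F: "long_run_cdf m F" and reg: "regular_path \<omega>" and x: "x \<in> \<rat>" "0 \<le> x"
  shows "(\<lambda>k. arrival_hits m x k \<omega> / found_count m k \<omega>) \<longlonglongrightarrow> excess_tail (lam (Suc m)) F x"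
proof -
  define q where "q k = (\<Sum>i<k. of_bool (found i \<omega> = m) * exponential_cdf (lam (Suc m)) (residual i \<omega> - x))" for k
  have inf: "\<exists>\<^sub>\<infinity>i. found i \<omega> = m" using F reg by (simp add: long_run_cdf_def)
  have "(\<lambda>k. (arrival_hits m x k \<omega> - q k) / found_count m k \<omega>) \<longlonglongrightarrow> 0"
    using reg m x inf unfolding regular_path_def q_def by blast
  moreover have "(\<lambda>k. q k / found_count m k \<omega>) \<longlonglongrightarrow> (LINT v|interval_measure F. exponential_cdf (lam (Suc m)) (v - x))"
    unfolding q_def found_count_def
  proof (rule empirical_average_tendsto)
    show "filterlim (\<lambda>k. \<Sum>i<k. of_bool (found i \<omega> = m) :: nat) at_top sequentially"
      using inf by (simp only: count_filterlim_iff)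
    show "(\<lambda>k. real (\<Sum>i<k. of_bool (found i \<omega> = m \<and> residual i \<omega> \<le> y)) / real (\<Sum>i<k. of_bool (found i \<omega> = m))) \<longlonglongrightarrow> F y" for y
      using F reg unfolding long_run_cdf_def found_count_def by blast
    show "service_cdf F" using F by (simp add: long_run_cdf_def)
    show "isCont (\<lambda>v. exponential_cdf (lam (Suc m)) (v - x)) v" for v
      by (rule isCont_o2[OF _ exponential_cdf_continuous]) (intro continuous_intros)
    show "\<bar>exponential_cdf (lam (Suc m)) (v - x)\<bar> \<le> 1" for v by (rule exponential_cdf_bounds[OF lam_pos])
  qed
  ultimately have "(\<lambda>k. (arrival_hits m x k \<omega> - q k) / found_count m k \<omega> + q k / found_count m k \<omega>)
    \<longlonglongrightarrow> 0 + (LINT v|interval_measure F. exponential_cdf (lam (Suc m)) (v - x))"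
    by (rule tendsto_add)
  then show ?thesis by (simp add: excess_tail_def add_divide_distrib[symmetric])
qed

text \<open>
  The tail of the mixture is $g(x) + (1 - g(0)) \rho(x) / \rho(0)$, the limit found in \<open>counts_ratio_limit\<close>.
\<close>

lemma long_run_cdf_Suc:
  assumes m: "1 \<le> m" and F: "long_run_cdf m F"
  shows "long_run_cdf (Suc m) (\<lambda>x. (1 - LST (G (Suc m)) (lam (Suc m))) * D (lam (Suc m)) (G (Suc m)) x
     + LST (G (Suc m)) (lam (Suc m)) * D (lam (Suc m)) F x)"
proof -
  define a where "a = lam (Suc m)"
  define H where "H = G (Suc m)"
  have a: "0 < a" by (simp add: a_def lam_pos)
  have H: "service_cdf H" unfolding H_def by (rule G_cdf) simp
  have Fc: "service_cdf F" using F by (simp add: long_run_cdf_def)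
  define g \<rho> where "g = excess_tail a H" and "\<rho> = excess_tail a F"
  have g: "0 < g 0" "g 0 < 1" unfolding g_def using excess_tail_pos[OF a H] excess_tail_less_1[OF a H] by auto
  have \<rho>: "0 < \<rho> 0" unfolding \<rho>_def by (rule excess_tail_pos[OF a Fc])
  have LST: "LST H a = 1 - g 0" unfolding g_def by (rule LST_eq_excess_tail[OF a H])
  define R where "R x = g 0 * D a H x + (1 - g 0) * D a F x" for x
  have mix: "isCont R x" "service_cdf R" "x \<le> 0 \<Longrightarrow> R x = 0" for x
    using mixture_D_props[OF _ _ a H Fc, of "g 0"] g unfolding R_def[abs_def] by auto
  have R_tail: "1 - R x = g x + (1 - g 0) * \<rho> x / \<rho> 0" if "0 \<le> x" for x
    using that g \<rho> by (simp add: R_def D_eq_excess_tail[OF a H] D_eq_excess_tail[OF a Fc] g_def[symmetric] \<rho>_def[symmetric])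
      (simp add: field_simps)
  have main: "(\<exists>\<^sub>\<infinity>i. found i \<omega> = Suc m) \<and> (\<lambda>k. tail_count (Suc m) x k \<omega> / found_count (Suc m) k \<omega>) \<longlonglongrightarrow> 1 - R x"
    if reg: "regular_path \<omega>" and x: "x \<in> \<rat>" "0 \<le> x" for \<omega> x
  proof -
    define s where "s i = started_before i \<omega>" for i
    obtain K where K: "\<And>i. \<bar>found_count (Suc m) i \<omega> - fresh_count (Suc m) (s i) \<omega>\<bar> \<le> K"
      using balance[OF reg, of "Suc m"] m by (auto simp: s_def)
    obtain k0 where k0: "\<And>i. tail_count (Suc m) 0 (Suc i) \<omega> = service_hits (Suc m) 0 (s i) \<omega> + arrival_hits m 0 i \<omega> + k0"
      using decomposition[OF reg order_refl, of m] by (auto simp: s_def)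
    obtain kx where kx: "\<And>i. tail_count (Suc m) x (Suc i) \<omega> = service_hits (Suc m) x (s i) \<omega> + arrival_hits m x i \<omega> + kx"
      using decomposition[OF reg x(2), of m] by (auto simp: s_def)
    have P: "filterlim (\<lambda>i. found_count m i \<omega>) at_top sequentially"
      using F reg by (simp add: found_count_at_top_iff[OF reg] long_run_cdf_def)
    have CA: "tail_count (Suc m) 0 i \<omega> = found_count (Suc m) i \<omega>" for i
      by (rule found_count_eq_tail[OF reg]) simp
    have U: "(\<lambda>i. service_hits (Suc m) y (s i) \<omega> / fresh_count (Suc m) (s i) \<omega>) \<longlonglongrightarrow> g y"
      if "filterlim (\<lambda>i. fresh_count (Suc m) (s i) \<omega>) at_top sequentially" "y \<in> \<rat>" "0 \<le> y" for y
      using service_hits_limit[OF reg _ that(2,3), of "Suc m"] that(1) by (simp add: s_def g_def a_def H_def)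
    have V: "(\<lambda>i. arrival_hits m y i \<omega> / found_count m i \<omega>) \<longlonglongrightarrow> \<rho> y" if "y \<in> \<rat>" "0 \<le> y" for y
      using arrival_hits_limit[OF m F reg that] by (simp add: \<rho>_def a_def)
    note limits = counts_ratio_limit[where A = "\<lambda>i. found_count (Suc m) i \<omega>" and P = "\<lambda>i. found_count m i \<omega>"
        and C\<^sub>0 = "\<lambda>i. tail_count (Suc m) 0 i \<omega>" and Cx = "\<lambda>i. tail_count (Suc m) x i \<omega>"
        and S = "\<lambda>i. fresh_count (Suc m) (s i) \<omega>" and U\<^sub>0 = "\<lambda>i. service_hits (Suc m) 0 (s i) \<omega>"
        and Ux = "\<lambda>i. service_hits (Suc m) x (s i) \<omega>" and V\<^sub>0 = "\<lambda>i. arrival_hits m 0 i \<omega>"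
        and Vx = "\<lambda>i. arrival_hits m x i \<omega>" and g\<^sub>0 = "g 0" and gx = "g x" and \<rho>\<^sub>0 = "\<rho> 0" and \<rho>x = "\<rho> x",
        OF P CA found_count_step[OF reg] K k0 kx _ U U V V \<rho>]
    have nn: "0 \<le> service_hits (Suc m) 0 (s i) \<omega>" for i by (simp add: service_hits_def)
    show ?thesis
      unfolding R_tail[OF x(2)] found_count_at_top_iff[OF reg, symmetric]
      by (intro conjI limits) (use x nn in auto)
  qed
  have "long_run_cdf (Suc m) R"
  proof (rule long_run_cdfI)
    show "\<exists>\<^sub>\<infinity>i. found i \<omega> = Suc m" if "regular_path \<omega>" for \<omega>
      using main[OF that, of 0] by simp
  qed (use mix main in auto)
  then show ?thesis
    unfolding R_def[abs_def] a_def[symmetric] H_def[symmetric] LST by simp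
qed

lemma long_run_cdf_residual:
  assumes n: "1 \<le> n"
  shows "long_run_cdf n (residual_cdf n)"
  using n
proof (induction n rule: dec_induct)
  case base
  show ?case using long_run_cdf_1 long_run_cdf_eq by metis
next
  case (step m)
  show ?case using long_run_cdf_Suc[OF step(1) step.IH] long_run_cdf_eq by metis
qed

end

end

theorem theorem11:
  fixes M :: "'a measure" and N0 :: "'a \<Rightarrow> nat" and T X :: "nat \<Rightarrow> 'a \<Rightarrow> real"
    and lam :: "nat \<Rightarrow> real" and G R :: "nat \<Rightarrow> real \<Rightarrow> real"
  assumes queue: "MnGn1_queue M N0 T X lam G"
    and stable: "single_server_queue.stable M N0 T X"
    and lam_pos: "\<And>n. lam n > 0"
    and G_cdf: "\<And>n. n \<ge> 1 \<Longrightarrow> service_cdf (G n)"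
    and R_def: "\<And>n. n \<ge> 1 \<Longrightarrow> R n = single_server_queue.residual_cdf M N0 T X n"
  shows "R 1 = D (lam 1) (G 1) \<and>
    (\<forall>n\<ge>2. R n = (\<lambda>x. (1 - LST (G n) (lam n)) * D (lam n) (G n) x
                       + LST (G n) (lam n) * D (lam n) (R (n - 1)) x))"
proof -
  interpret MnGn1_queue M N0 T X lam G by (rule queue)
  have cdf: "long_run_cdf n (residual_cdf n)" if "1 \<le> n" for n
    using stable lam_pos G_cdf that by (rule long_run_cdf_residual)
  have eq: "residual_cdf n = F" if "long_run_cdf n F" for n F
    using stable lam_pos G_cdf that by (rule long_run_cdf_eq)
  have first: "long_run_cdf 1 (D (lam 1) (G 1))"
    using stable lam_pos G_cdf by (rule long_run_cdf_1)
  have "R 1 = D (lam 1) (G 1)"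
    using R_def[OF order_refl] eq[OF first] by (rule trans)
  moreover have "R n = (\<lambda>x. (1 - LST (G n) (lam n)) * D (lam n) (G n) x
                       + LST (G n) (lam n) * D (lam n) (R (n - 1)) x)" if n: "n \<ge> 2" for n
  proof -
    obtain m where m: "n = Suc m" "1 \<le> m" using n by (cases n) auto
    have "long_run_cdf (Suc m) (\<lambda>x. (1 - LST (G (Suc m)) (lam (Suc m))) * D (lam (Suc m)) (G (Suc m)) x
       + LST (G (Suc m)) (lam (Suc m)) * D (lam (Suc m)) (residual_cdf m) x)"
      using stable lam_pos G_cdf m(2) cdf[OF m(2)] by (rule long_run_cdf_Suc)
    note rec = eq[OF this]
    have "R (Suc m) = residual_cdf (Suc m)" by (rule R_def) simp
    moreover have "R m = residual_cdf m" using m(2) by (rule R_def)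
    ultimately show ?thesis using rec unfolding m(1) diff_Suc_1 by metis
  qed
  ultimately show ?thesis by blast
qed

end
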